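(* Let $p$ be a prime and let $\{\lambda(m)\}_{m\in\mathbb{Z}}$ be a sequence of reals. The following are equivalent: (A) $\{\lambda(m)\}$ represents the spectrum of a rotation invariant Laplacian on $\mathbb{Q}_p$, i.e. there is a rotation invariant Laplacian $\mathcal{L}$ on $\mathbb{Q}_p$ such that for every $m\in\mathbb{Z}$ and every ball $B\subset\mathbb{Q}_p$ of radius $p^m$ one has $\mathcal{L}f=\lambda(m)f$ for all $f\in\mathcal{H}_B$. (B) The sequence is given by $$\lambda(m)=a(m)-(p-1)^{-1}\{a(m+1)-a(m)\},\quad m\in\mathbb{Z},$$ with a sequence $\{a(m)\}_{m\in\mathbb{Z}}$ of real numbers satisfying $$a(m)\ge a(m+1),\qquad a(+\infty)=0,\qquad0<a(-\infty)=W\le+\infty .$$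
   Context: $\|\cdot\|_p$ is the $p$-adic norm, $\mu_p$ the Haar measure on $\mathbb{Q}_p$ with $\mu_p(\mathbb{Z}_p)=1$. Here $a(\pm\infty)=\lim_{m\to\pm\infty}a(m)$. Consider a symmetric, translation invariant Markov semigroup $\{P_t\}_{t\ge0}$ on the additive group $\mathbb{Q}_p$: $P_tf=p_t*f$, where $\{p_t\}_{t>0}$ is a weakly continuous convolution semigroup of symmetric probability measures on $\mathbb{Q}_p$. It is called rotation invariant if $\theta_a(p_t)=p_t$ (image measure) for all $t>0$ and all $a\in\mathbb{Q}_p$ with $\|a\|_p=1$, where $\theta_a(x)=ax$. A rotation invariant Laplacian is the (positive definite) generator $\mathcal{L}$ in $L^2(\mathbb{Q}_p,\mu_p)$ of such a rotation invariant semigroup: $P_t=\exp(-t\mathcal{L})$. Its domain contains the space of compactly supported locally constant functions. For a ball $B$ of radius $p^m$ (a set $\{y:\|x-y\|_p\le p^m\}$), its children are the $p$ disjoint balls $C\subset B$ of radius $p^{m-1}$, and $\mathcal{H}_B$ is the $(p-1)$-dimensional span of the functions $f_C=\frac1{\mu_p(C)}\mathbf{1}_C-\frac1{\mu_p(B)}\mathbf{1}_B$, $C$ running over the children of $B$. The functions in all spaces $\mathcal{H}_B$ span a dense subspace of $L^2(\mathbb{Q}_p,\mu_p)$.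
   Formalization: The identity semigroup (all p_t equal to the point mass at 0, so the Laplacian is the zero operator) is excluded from the rotation invariant Laplacians, since it gives λ = 0, for which (A) would hold but (B) fails because it forces a = 0, contradicting W > 0. *)

theory Defs
  imports "HOL-Probability.Probability" "Berlekamp_Zassenhaus.Finite_Field"
begin

section \<open>The \<open>p\<close>-adic absolute value on the rationals\<close>

definition padic_abs :: "nat \<Rightarrow> rat \<Rightarrow> real" where
  "padic_abs p x =
    (if x = 0 then 0
     else real p powi (int (multiplicity (int p) (snd (quotient_of x)))
                       - int (multiplicity (int p) (fst (quotient_of x)))))"

lemma padic_abs_zero [simp]: "padic_abs p 0 = 0"
  by (simp add: padic_abs_def)

lemma padic_abs_fract:
  assumes "prime p" "a \<noteq> 0" "b \<noteq> 0"
  shows "padic_abs p (of_int a / of_int b)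
           = real p powi (int (multiplicity (int p) b) - int (multiplicity (int p) a))"
proof -
  let ?x = "of_int a / of_int b :: rat"
  obtain c d where q: "quotient_of ?x = (c, d)" by fastforce
  have d: "d > 0" using quotient_of_denom_pos [OF q] .
  have x: "?x = of_int c / of_int d" using quotient_of_div [OF q] .
  have c: "c \<noteq> 0" using x assms d by auto
  have "(of_int (a * d) :: rat) = of_int (c * b)"
    using x assms(3) d by (simp add: field_simps)
  then have "a * d = c * b" by (simp only: of_int_eq_iff)
  then have "multiplicity (int p) (a * d) = multiplicity (int p) (c * b)" by simp
  then have "multiplicity (int p) a + multiplicity (int p) d
           = multiplicity (int p) c + multiplicity (int p) b"
    using assms c d by (simp add: prime_elem_multiplicity_mult_distrib)
  then have "int (multiplicity (int p) d) - int (multiplicity (int p) c)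
      = int (multiplicity (int p) b) - int (multiplicity (int p) a)" by linarith
  then show ?thesis
    using assms by (simp add: padic_abs_def q)
qed

lemma rat_fract_cases:
  obtains a b :: int where "b \<noteq> 0" "(x::rat) = of_int a / of_int b"
  by (metis quotient_of_denom_pos quotient_of_div less_irrefl surj_pair)

lemma padic_abs_nonneg [simp]: "0 \<le> padic_abs p x"
  by (simp add: padic_abs_def)

lemma padic_abs_eq_0_iff [simp]:
  assumes "prime p" shows "padic_abs p x = 0 \<longleftrightarrow> x = 0"
  using prime_gt_0_nat [OF assms] by (simp add: padic_abs_def)

lemma padic_abs_one [simp]: "padic_abs p 1 = 1"
  by (simp add: padic_abs_def)

lemma padic_abs_mult:
  assumes p: "prime p"
  shows "padic_abs p (x * y) = padic_abs p x * padic_abs p y"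
proof (cases "x = 0 \<or> y = 0")
  case False
  obtain a b where ab: "b \<noteq> 0" "x = of_int a / of_int b" by (rule rat_fract_cases)
  obtain c d where cd: "d \<noteq> 0" "y = of_int c / of_int d" by (rule rat_fract_cases)
  have nz: "a \<noteq> 0" "c \<noteq> 0" using False ab cd by auto
  have xy: "x * y = of_int (a * c) / of_int (b * d)" by (simp add: ab cd)
  have p0: "real p \<noteq> 0" using p by auto
  have ac: "a * c \<noteq> 0" and bd: "b * d \<noteq> 0" using nz ab cd by simp_all
  let ?m = "\<lambda>n. int (multiplicity (int p) n)"
  have e: "?m (b * d) - ?m (a * c) = (?m b - ?m a) + (?m d - ?m c)"
    using p nz ab(1) cd(1) by (simp add: prime_elem_multiplicity_mult_distrib)
  show ?thesis
    unfolding xy padic_abs_fract [OF p ac bd]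
    unfolding ab(2) cd(2) padic_abs_fract [OF p nz(1) ab(1)] padic_abs_fract [OF p nz(2) cd(1)] e
    by (rule power_int_add) (use p0 in blast)
qed auto

lemma padic_abs_minus [simp]:
  assumes "prime p" shows "padic_abs p (- x) = padic_abs p x"
proof (cases "x = 0")
  case False
  obtain a b where ab: "b \<noteq> 0" "x = of_int a / of_int b" by (rule rat_fract_cases)
  have a: "a \<noteq> 0" using False ab by auto
  have m: "- x = of_int (- a) / of_int b" by (simp add: ab)
  have ma: "- a \<noteq> 0" using a by simp
  have "multiplicity (int p) (- a) = multiplicity (int p) a"
    using multiplicity_times_unit_right [of "-1" "int p" a] by simp
  then show ?thesis
    unfolding m padic_abs_fract [OF assms ma ab(1)]
    unfolding ab(2) padic_abs_fract [OF assms a ab(1)] by simp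
qed simp

lemma padic_abs_minus_commute: "prime p \<Longrightarrow> padic_abs p (x - y) = padic_abs p (y - x)"
  by (metis minus_diff_eq padic_abs_minus)

lemma padic_abs_ultrametric:
  assumes p: "prime p"
  shows "padic_abs p (x + y) \<le> max (padic_abs p x) (padic_abs p y)"
proof (cases "x = 0 \<or> y = 0 \<or> x + y = 0")
  case False
  obtain a b where ab: "b \<noteq> 0" "x = of_int a / of_int b" by (rule rat_fract_cases)
  obtain c d where cd: "d \<noteq> 0" "y = of_int c / of_int d" by (rule rat_fract_cases)
  have bd: "b * d \<noteq> 0" using ab cd by simp
  have x: "x = of_int (a * d) / of_int (b * d)" using ab cd by (simp add: field_simps)
  have y: "y = of_int (c * b) / of_int (b * d)" using ab cd by (simp add: field_simps)
  have xy: "x + y = of_int (a * d + c * b) / of_int (b * d)" unfolding x y by (simp add: add_divide_distrib)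
  have nz: "a * d \<noteq> 0" "c * b \<noteq> 0" "a * d + c * b \<noteq> 0"
  proof -
    show "a * d \<noteq> 0" "c * b \<noteq> 0" using False ab cd by auto
    have "x + y \<noteq> 0" using False by blast
    then show "a * d + c * b \<noteq> 0" unfolding xy by (metis div_0 of_int_0)
  qed
  let ?m = "multiplicity (int p)"
  have "min (?m (a * d)) (?m (c * b)) \<le> ?m (a * d + c * b)"
  proof (rule multiplicity_geI)
    show "int p ^ min (?m (a * d)) (?m (c * b)) dvd a * d + c * b"
      by (intro dvd_add multiplicity_dvd') simp_all
  qed (use p nz(3) prime_gt_1_nat [OF p] in simp_all)
  moreover have "1 \<le> real p" using prime_ge_1_nat [OF p] by simp
  ultimately have
    "real p powi (int (?m (b * d)) - int (?m (a * d + c * b))) \<le>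
       max (real p powi (int (?m (b * d)) - int (?m (a * d))))
           (real p powi (int (?m (b * d)) - int (?m (c * b))))"
    by (auto simp: le_max_iff_disj min_le_iff_disj intro: power_int_increasing)
  then show ?thesis
    unfolding xy padic_abs_fract [OF p nz(3) bd]
    unfolding x y padic_abs_fract [OF p nz(1) bd] padic_abs_fract [OF p nz(2) bd] .
qed (auto simp: le_max_iff_disj)

lemma padic_abs_triangle:
  assumes "prime p" shows "padic_abs p (x + y) \<le> padic_abs p x + padic_abs p y"
  using padic_abs_ultrametric [OF assms, of x y] padic_abs_nonneg [of p x] padic_abs_nonneg [of p y]
  by linarith

lemma padic_abs_diff_triangle:
  assumes "prime p" shows "\<bar>padic_abs p x - padic_abs p y\<bar> \<le> padic_abs p (x - y)"
  using padic_abs_triangle [OF assms, of "x - y" y] padic_abs_triangle [OF assms, of "y - x" x]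
    padic_abs_minus_commute [OF assms, of x y]
  by simp

lemma padic_abs_inverse:
  assumes "prime p" shows "padic_abs p (inverse x) = inverse (padic_abs p x)"
proof (cases "x = 0")
  case False
  then have "padic_abs p x * padic_abs p (inverse x) = 1"
    by (simp add: padic_abs_mult [OF assms, symmetric])
  then show ?thesis by (metis inverse_unique)
qed simp


section \<open>The field \<open>\<rat>\<^sub>p\<close>\<close>

text \<open>
  \<open>'p padic\<close> is the completion of the rationals for the \<open>p\<close>-adic absolute value, where the
  prime is \<open>p = CARD('p)\<close>: Cauchy sequences modulo null sequences.
\<close>

definition padic_vanishes :: "nat \<Rightarrow> (nat \<Rightarrow> rat) \<Rightarrow> bool" where
  "padic_vanishes p X \<longleftrightarrow> (\<lambda>n. padic_abs p (X n)) \<longlonglongrightarrow> 0"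

definition padic_cauchy :: "nat \<Rightarrow> (nat \<Rightarrow> rat) \<Rightarrow> bool" where
  "padic_cauchy p X \<longleftrightarrow> (\<forall>r>0. \<exists>k. \<forall>m\<ge>k. \<forall>n\<ge>k. padic_abs p (X m - X n) < r)"

definition padic_rel :: "nat \<Rightarrow> (nat \<Rightarrow> rat) \<Rightarrow> (nat \<Rightarrow> rat) \<Rightarrow> bool" where
  "padic_rel p X Y \<longleftrightarrow> padic_cauchy p X \<and> padic_cauchy p Y \<and> padic_vanishes p (\<lambda>n. X n - Y n)"

context
  fixes p :: nat
  assumes p: "prime p"
begin

lemma padic_vanishes_0: "padic_vanishes p (\<lambda>n. 0)"
  by (simp add: padic_vanishes_def)

lemma padic_vanishes_minus: "padic_vanishes p X \<Longrightarrow> padic_vanishes p (\<lambda>n. - X n)"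
  using p by (simp add: padic_vanishes_def)

lemma padic_vanishes_add:
  assumes "padic_vanishes p X" "padic_vanishes p Y"
  shows "padic_vanishes p (\<lambda>n. X n + Y n)"
  unfolding padic_vanishes_def
proof (rule tendsto_sandwich [OF _ _ tendsto_const])
  show "(\<lambda>n. padic_abs p (X n) + padic_abs p (Y n)) \<longlonglongrightarrow> 0"
    using tendsto_add [OF assms [unfolded padic_vanishes_def]] by simp
qed (simp_all add: padic_abs_triangle p)

lemma padic_vanishes_mult_bounded:
  assumes "\<And>n. padic_abs p (X n) \<le> B" "padic_vanishes p Y"
  shows "padic_vanishes p (\<lambda>n. X n * Y n)"
  unfolding padic_vanishes_def
proof (rule tendsto_sandwich [OF _ _ tendsto_const])
  show "(\<lambda>n. B * padic_abs p (Y n)) \<longlonglongrightarrow> 0"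
    using tendsto_mult_left [OF assms(2) [unfolded padic_vanishes_def], of B] by simp
qed (simp_all add: padic_abs_mult p assms(1) mult_right_mono)

lemma padic_cauchy_const: "padic_cauchy p (\<lambda>n. c)"
  by (simp add: padic_cauchy_def)

lemma padic_cauchy_minus: "padic_cauchy p X \<Longrightarrow> padic_cauchy p (\<lambda>n. - X n)"
  unfolding padic_cauchy_def minus_diff_minus by (simp only: padic_abs_minus [OF p])

lemma padic_cauchy_add:
  assumes "padic_cauchy p X" "padic_cauchy p Y"
  shows "padic_cauchy p (\<lambda>n. X n + Y n)"
  unfolding padic_cauchy_def
proof (intro allI impI)
  fix r :: real assume r: "0 < r"
  obtain i where i: "\<forall>m\<ge>i. \<forall>n\<ge>i. padic_abs p (X m - X n) < r"
    using assms(1) r unfolding padic_cauchy_def by blast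
  obtain j where j: "\<forall>m\<ge>j. \<forall>n\<ge>j. padic_abs p (Y m - Y n) < r"
    using assms(2) r unfolding padic_cauchy_def by blast
  have "padic_abs p (X m + Y m - (X n + Y n)) < r" if "m \<ge> max i j" "n \<ge> max i j" for m n
  proof -
    have "padic_abs p (X m - X n) < r" "padic_abs p (Y m - Y n) < r" using i j that by auto
    then show ?thesis
      using padic_abs_ultrametric [OF p, of "X m - X n" "Y m - Y n"] unfolding add_diff_add by simp
  qed
  then show "\<exists>k. \<forall>m\<ge>k. \<forall>n\<ge>k. padic_abs p (X m + Y m - (X n + Y n)) < r" by blast
qed

lemma padic_cauchy_abs:
  assumes "padic_cauchy p X" shows "Cauchy (\<lambda>n. padic_abs p (X n))"
  unfolding Cauchy_def
proof (intro allI impI)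
  fix e :: real assume "0 < e"
  then obtain k where k: "\<forall>m\<ge>k. \<forall>n\<ge>k. padic_abs p (X m - X n) < e"
    using assms unfolding padic_cauchy_def by blast
  have "dist (padic_abs p (X m)) (padic_abs p (X n)) < e" if "m \<ge> k" "n \<ge> k" for m n
    unfolding dist_real_def
    by (rule le_less_trans [OF padic_abs_diff_triangle [OF p]]) (use k that in blast)
  then show "\<exists>k. \<forall>m\<ge>k. \<forall>n\<ge>k. dist (padic_abs p (X m)) (padic_abs p (X n)) < e" by blast
qed

lemma padic_cauchy_bounded:
  assumes "padic_cauchy p X"
  obtains B where "0 < B" "\<And>n. padic_abs p (X n) \<le> B"
proof -
  have "Bseq (\<lambda>n. padic_abs p (X n))"
    using padic_cauchy_abs [OF assms] by (rule Cauchy_Bseq)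
  then obtain B where "0 < B" "\<And>n. norm (padic_abs p (X n)) \<le> B" by (rule BseqE) blast
  then show ?thesis using that [of B] by simp
qed

lemma padic_cauchy_mult:
  assumes "padic_cauchy p X" "padic_cauchy p Y"
  shows "padic_cauchy p (\<lambda>n. X n * Y n)"
  unfolding padic_cauchy_def
proof (intro allI impI)
  fix r :: real assume r: "0 < r"
  obtain A where A: "0 < A" "\<And>n. padic_abs p (X n) \<le> A"
    by (rule padic_cauchy_bounded [OF assms(1)]) blast
  obtain B where B: "0 < B" "\<And>n. padic_abs p (Y n) \<le> B"
    by (rule padic_cauchy_bounded [OF assms(2)]) blast
  have rB: "0 < r / B" and rA: "0 < r / A" using r A B by simp_all
  obtain i where i: "\<forall>m\<ge>i. \<forall>n\<ge>i. padic_abs p (X m - X n) < r / B"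
    using assms(1) rB unfolding padic_cauchy_def by blast
  obtain j where j: "\<forall>m\<ge>j. \<forall>n\<ge>j. padic_abs p (Y m - Y n) < r / A"
    using assms(2) rA unfolding padic_cauchy_def by blast
  have "padic_abs p (X m * Y m - X n * Y n) < r" if mn: "m \<ge> max i j" "n \<ge> max i j" for m n
  proof -
    have "padic_abs p (X m) * padic_abs p (Y m - Y n) \<le> A * padic_abs p (Y m - Y n)"
      by (simp add: A(2) mult_right_mono)
    also have "\<dots> < A * (r / A)"
      using j mn A(1) by (intro mult_strict_left_mono) auto
    finally have 1: "padic_abs p (X m * (Y m - Y n)) < r"
      using A(1) by (simp add: padic_abs_mult p)
    have "padic_abs p (X m - X n) * padic_abs p (Y n) \<le> padic_abs p (X m - X n) * B"
      by (simp add: B(2) mult_left_mono)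
    also have "\<dots> < r / B * B"
      using i mn B(1) by (intro mult_strict_right_mono) auto
    finally have 2: "padic_abs p ((X m - X n) * Y n) < r"
      using B(1) by (simp add: padic_abs_mult p)
    show ?thesis
      unfolding mult_diff_mult
      using padic_abs_ultrametric [OF p, of "X m * (Y m - Y n)" "(X m - X n) * Y n"] 1 2 by simp
  qed
  then show "\<exists>k. \<forall>m\<ge>k. \<forall>n\<ge>k. padic_abs p (X m * Y m - X n * Y n) < r" by blast
qed

lemma padic_cauchy_not_vanishes:
  assumes X: "padic_cauchy p X" and nz: "\<not> padic_vanishes p X"
  obtains b k where "0 < b" "\<And>n. n \<ge> k \<Longrightarrow> b < padic_abs p (X n)"
proof -
  obtain L where L: "(\<lambda>n. padic_abs p (X n)) \<longlonglongrightarrow> L"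
    using padic_cauchy_abs [OF X] Cauchy_convergent unfolding convergent_def by blast
  have "L \<noteq> 0" using L nz by (auto simp: padic_vanishes_def)
  moreover have "0 \<le> L" by (rule LIMSEQ_le_const [OF L]) simp
  ultimately have "0 < L / 2" "L / 2 < L" by simp_all
  with order_tendstoD(1) [OF L, of "L / 2"] that show ?thesis
    unfolding eventually_sequentially by metis
qed

lemma padic_cauchy_inverse:
  assumes X: "padic_cauchy p X" and nz: "\<not> padic_vanishes p X"
  shows "padic_cauchy p (\<lambda>n. inverse (X n))"
  unfolding padic_cauchy_def
proof (intro allI impI)
  fix r :: real assume r: "0 < r"
  obtain b i where b: "0 < b" and i: "\<And>n. n \<ge> i \<Longrightarrow> b < padic_abs p (X n)"
    by (rule padic_cauchy_not_vanishes [OF X nz]) blast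
  have "0 < b * r * b" using b r by simp
  then obtain j where j: "\<forall>m\<ge>j. \<forall>n\<ge>j. padic_abs p (X m - X n) < b * r * b"
    using X unfolding padic_cauchy_def by blast
  have "padic_abs p (inverse (X m) - inverse (X n)) < r"
    if mn: "m \<ge> max i j" "n \<ge> max i j" for m n
  proof -
    have bm: "b < padic_abs p (X m)" and bn: "b < padic_abs p (X n)" using i mn by auto
    then have "X m \<noteq> 0" "X n \<noteq> 0" using b by auto
    then have "padic_abs p (inverse (X m) - inverse (X n))
        = inverse (padic_abs p (X m)) * padic_abs p (X m - X n) * inverse (padic_abs p (X n))"
      by (simp add: inverse_diff_inverse padic_abs_mult padic_abs_inverse p)
    also have "\<dots> < inverse b * (b * r * b) * inverse b"
      using bm bn b j mn by (intro mult_strict_mono less_imp_inverse_less) (auto simp: r)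
    also have "\<dots> = r" using b by simp
    finally show ?thesis .
  qed
  then show "\<exists>k. \<forall>m\<ge>k. \<forall>n\<ge>k. padic_abs p (inverse (X m) - inverse (X n)) < r" by blast
qed

lemma padic_vanishes_diff_inverse:
  assumes X: "padic_cauchy p X" "\<not> padic_vanishes p X"
    and Y: "padic_cauchy p Y" "\<not> padic_vanishes p Y"
    and XY: "padic_vanishes p (\<lambda>n. X n - Y n)"
  shows "padic_vanishes p (\<lambda>n. inverse (X n) - inverse (Y n))"
  unfolding padic_vanishes_def
proof -
  obtain a i where a: "0 < a" and i: "\<And>n. n \<ge> i \<Longrightarrow> a < padic_abs p (X n)"
    by (rule padic_cauchy_not_vanishes [OF X]) blast
  obtain b j where b: "0 < b" and j: "\<And>n. n \<ge> j \<Longrightarrow> b < padic_abs p (Y n)"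
    by (rule padic_cauchy_not_vanishes [OF Y]) blast
  show "(\<lambda>n. padic_abs p (inverse (X n) - inverse (Y n))) \<longlonglongrightarrow> 0"
  proof (rule tendsto_sandwich [OF _ _ tendsto_const])
    show "(\<lambda>n. inverse a * padic_abs p (X n - Y n) * inverse b) \<longlonglongrightarrow> 0"
      using tendsto_mult [OF tendsto_mult [OF tendsto_const XY [unfolded padic_vanishes_def]] tendsto_const,
          of "inverse a" "inverse b"] by simp
    have "padic_abs p (inverse (X n) - inverse (Y n)) \<le> inverse a * padic_abs p (X n - Y n) * inverse b"
      if n: "n \<ge> max i j" for n
    proof -
      have an: "a < padic_abs p (X n)" and bn: "b < padic_abs p (Y n)" using i j n by auto
      then have "X n \<noteq> 0" "Y n \<noteq> 0" using a b by auto
      then have "padic_abs p (inverse (X n) - inverse (Y n))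
          = inverse (padic_abs p (X n)) * padic_abs p (X n - Y n) * inverse (padic_abs p (Y n))"
        by (simp add: inverse_diff_inverse padic_abs_mult padic_abs_inverse p)
      also have "\<dots> \<le> inverse a * padic_abs p (X n - Y n) * inverse b"
        using an bn a b by (intro mult_mono le_imp_inverse_le) auto
      finally show ?thesis .
    qed
    then show "\<forall>\<^sub>F n in sequentially. padic_abs p (inverse (X n) - inverse (Y n))
        \<le> inverse a * padic_abs p (X n - Y n) * inverse b"
      unfolding eventually_sequentially by blast
  qed simp
qed

lemma padic_rel_refl: "padic_cauchy p X \<Longrightarrow> padic_rel p X X"
  by (simp add: padic_rel_def padic_vanishes_0)

lemma part_equivp_padic_rel: "part_equivp (padic_rel p)"
proof (rule part_equivpI)
  show "\<exists>X. padic_rel p X X" using padic_rel_refl padic_cauchy_const by blast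
  show "symp (padic_rel p)"
    by (rule sympI) (auto simp: padic_rel_def dest: padic_vanishes_minus)
  show "transp (padic_rel p)"
    unfolding padic_rel_def by (rule transpI) (force dest: padic_vanishes_add)
qed

lemma padic_rel_add:
  "padic_rel p X X' \<Longrightarrow> padic_rel p Y Y' \<Longrightarrow> padic_rel p (\<lambda>n. X n + Y n) (\<lambda>n. X' n + Y' n)"
  unfolding padic_rel_def add_diff_add by (simp add: padic_cauchy_add padic_vanishes_add)

lemma padic_rel_minus:
  "padic_rel p X X' \<Longrightarrow> padic_rel p (\<lambda>n. - X n) (\<lambda>n. - X' n)"
  unfolding padic_rel_def minus_diff_minus by (simp only: padic_cauchy_minus padic_vanishes_minus simp_thms)

lemma padic_rel_mult:
  assumes "padic_rel p X X'" "padic_rel p Y Y'"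
  shows "padic_rel p (\<lambda>n. X n * Y n) (\<lambda>n. X' n * Y' n)"
proof -
  have c: "padic_cauchy p X" "padic_cauchy p X'" "padic_cauchy p Y" "padic_cauchy p Y'"
    and v: "padic_vanishes p (\<lambda>n. X n - X' n)" "padic_vanishes p (\<lambda>n. Y n - Y' n)"
    using assms by (auto simp: padic_rel_def)
  obtain A where A: "\<And>n. padic_abs p (X n) \<le> A" by (rule padic_cauchy_bounded [OF c(1)]) blast
  obtain B where B: "\<And>n. padic_abs p (Y' n) \<le> B" by (rule padic_cauchy_bounded [OF c(4)]) blast
  have "padic_vanishes p (\<lambda>n. X n * (Y n - Y' n) + Y' n * (X n - X' n))"
    by (intro padic_vanishes_add padic_vanishes_mult_bounded [OF A v(2)]
        padic_vanishes_mult_bounded [OF B v(1)])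
  then show ?thesis
    by (simp add: padic_rel_def padic_cauchy_mult c mult_diff_mult mult.commute)
qed

lemma padic_rel_inverse:
  assumes "padic_rel p X Y"
  shows "padic_rel p (if padic_vanishes p X then (\<lambda>n. 0) else (\<lambda>n. inverse (X n)))
                     (if padic_vanishes p Y then (\<lambda>n. 0) else (\<lambda>n. inverse (Y n)))"
proof -
  have c: "padic_cauchy p X" "padic_cauchy p Y" and v: "padic_vanishes p (\<lambda>n. X n - Y n)"
    using assms by (auto simp: padic_rel_def)
  have "padic_vanishes p X \<longleftrightarrow> padic_vanishes p Y"
    using padic_vanishes_add [OF _ v, of Y] padic_vanishes_add [OF _ padic_vanishes_minus [OF v], of X]
    by auto
  then show ?thesis
    using c v by (simp add: padic_rel_def padic_cauchy_const padic_vanishes_0 padic_cauchy_inverse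
        padic_vanishes_diff_inverse)
qed

lemma padic_vanishes_abs_diff:
  assumes "padic_vanishes p (\<lambda>n. X n - Y n)"
  shows "(\<lambda>n. padic_abs p (X n) - padic_abs p (Y n)) \<longlonglongrightarrow> 0"
proof (rule Lim_null_comparison)
  show "\<forall>\<^sub>F n in sequentially. norm (padic_abs p (X n) - padic_abs p (Y n)) \<le> padic_abs p (X n - Y n)"
    using padic_abs_diff_triangle [OF p] by simp
qed (use assms in \<open>simp add: padic_vanishes_def\<close>)

lemma padic_rel_lim:
  assumes "padic_rel p X Y"
  shows "lim (\<lambda>n. padic_abs p (X n)) = lim (\<lambda>n. padic_abs p (Y n))"
proof -
  have "(\<lambda>n. padic_abs p (X n)) \<longlonglongrightarrow> L \<longleftrightarrow> (\<lambda>n. padic_abs p (Y n)) \<longlonglongrightarrow> L" for L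
    by (rule Lim_transform_eq, rule padic_vanishes_abs_diff) (use assms in \<open>simp add: padic_rel_def\<close>)
  then show ?thesis by (simp add: lim_def)
qed

end

text \<open>
  This is \<open>quotient_type\<close> done by hand: that command does not accept a relation with a type
  variable that is constrained but absent from the raw type.
\<close>

typedef (overloaded) ('p::prime_card) padic =
  "{c. \<exists>X. padic_cauchy CARD('p) X \<and> c = {Y. padic_rel CARD('p) X Y}}"
  using padic_cauchy_const [OF prime_card] by blast

definition abs_padic :: "(nat \<Rightarrow> rat) \<Rightarrow> 'p::prime_card padic" where
  "abs_padic X = Abs_padic {Y. padic_rel CARD('p) X Y}"

definition rep_padic :: "'p::prime_card padic \<Rightarrow> nat \<Rightarrow> rat" where
  "rep_padic x = (SOME X. X \<in> Rep_padic x)"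

definition cr_padic :: "(nat \<Rightarrow> rat) \<Rightarrow> 'p::prime_card padic \<Rightarrow> bool" where
  "cr_padic X x \<longleftrightarrow> padic_rel CARD('p) X X \<and> abs_padic X = x"

lemma Quotient_padic:
  "Quotient (padic_rel CARD('p)) (abs_padic :: _ \<Rightarrow> 'p::prime_card padic) rep_padic cr_padic"
proof -
  note E = part_equivp_padic_rel [OF prime_card [where 'a = 'p]]
  note sym = part_equivp_symp [OF E] and trans = part_equivp_transp [OF E]
  have refl: "padic_rel CARD('p) X X \<longleftrightarrow> padic_cauchy CARD('p) X" for X
    using padic_rel_refl [OF prime_card] by (auto simp: padic_rel_def)
  have Rep_abs: "Rep_padic (abs_padic X :: 'p padic) = {Y. padic_rel CARD('p) X Y}"
    if "padic_cauchy CARD('p) X" for X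
    unfolding abs_padic_def using that by (subst Abs_padic_inverse) auto
  have rep: "padic_cauchy CARD('p) (rep_padic x) \<and> Rep_padic x = {Y. padic_rel CARD('p) (rep_padic x) Y}"
    for x :: "'p padic"
  proof -
    obtain X where X: "padic_cauchy CARD('p) X" "Rep_padic x = {Y. padic_rel CARD('p) X Y}"
      using Rep_padic [of x] by blast
    then have "X \<in> Rep_padic x" by (simp add: refl)
    then have "rep_padic x \<in> Rep_padic x" unfolding rep_padic_def by (rule someI [of \<open>\<lambda>X. X \<in> Rep_padic x\<close>])
    then have r: "padic_rel CARD('p) X (rep_padic x)" using X by simp
    have "{Y. padic_rel CARD('p) X Y} = {Y. padic_rel CARD('p) (rep_padic x) Y}"
      using r sym trans by (blast dest: sympD transpD)
    then show ?thesis using r X by (simp add: padic_rel_def)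
  qed
  show ?thesis
  proof (rule QuotientI)
    show "abs_padic (rep_padic x) = x" for x :: "'p padic"
      using Rep_abs rep by (metis Rep_padic_inject)
    show "padic_rel CARD('p) (rep_padic x) (rep_padic x)" for x :: "'p padic"
      using rep refl by blast
    show "padic_rel CARD('p) X Y \<longleftrightarrow> padic_rel CARD('p) X X \<and> padic_rel CARD('p) Y Y
        \<and> (abs_padic X :: 'p padic) = abs_padic Y" for X Y
    proof
      assume XY: "padic_rel CARD('p) X Y"
      then have "{Z. padic_rel CARD('p) X Z} = {Z. padic_rel CARD('p) Y Z}"
        using sym trans by (blast dest: sympD transpD)
      then show "padic_rel CARD('p) X X \<and> padic_rel CARD('p) Y Y
          \<and> (abs_padic X :: 'p padic) = abs_padic Y"
        using XY by (simp add: abs_padic_def refl padic_rel_def [of _ X Y])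
    next
      assume *: "padic_rel CARD('p) X X \<and> padic_rel CARD('p) Y Y
          \<and> (abs_padic X :: 'p padic) = abs_padic Y"
      then have "{Z. padic_rel CARD('p) X Z} = {Z. padic_rel CARD('p) Y Z}"
        using Rep_abs refl by metis
      then show "padic_rel CARD('p) X Y" using * by blast
    qed
    show "cr_padic = (\<lambda>X x. padic_rel CARD('p) X X \<and> (abs_padic X :: 'p padic) = x)"
      by (intro ext) (simp add: cr_padic_def)
  qed
qed

setup_lifting Quotient_padic

instantiation padic :: (prime_card) field
begin

lift_definition zero_padic :: "'a padic" is "\<lambda>n. 0"
  by (simp add: padic_rel_refl padic_cauchy_const prime_card)

lift_definition one_padic :: "'a padic" is "\<lambda>n. 1"
  by (simp add: padic_rel_refl padic_cauchy_const prime_card)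

lift_definition plus_padic :: "'a padic \<Rightarrow> 'a padic \<Rightarrow> 'a padic" is "\<lambda>X Y n. X n + Y n"
  by (rule padic_rel_add [OF prime_card])

lift_definition uminus_padic :: "'a padic \<Rightarrow> 'a padic" is "\<lambda>X n. - X n"
  by (rule padic_rel_minus [OF prime_card])

lift_definition times_padic :: "'a padic \<Rightarrow> 'a padic \<Rightarrow> 'a padic" is "\<lambda>X Y n. X n * Y n"
  by (rule padic_rel_mult [OF prime_card])

lift_definition inverse_padic :: "'a padic \<Rightarrow> 'a padic"
  is "\<lambda>X. if padic_vanishes CARD('a) X then (\<lambda>n. 0) else (\<lambda>n. inverse (X n))"
  by (rule padic_rel_inverse [OF prime_card])

definition minus_padic :: "'a padic \<Rightarrow> 'a padic \<Rightarrow> 'a padic" where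
  "minus_padic x y = x + - y"

definition divide_padic :: "'a padic \<Rightarrow> 'a padic \<Rightarrow> 'a padic" where
  "divide_padic x y = x * inverse y"

instance
proof
  note P = prime_card [where 'a = 'a]
  note C = padic_cauchy_add [OF P] padic_cauchy_minus [OF P] padic_cauchy_mult [OF P]
    padic_cauchy_const [OF P] padic_vanishes_0 [OF P]
  fix a b c :: "'a padic"
  show "a + b = b + a"
    by transfer (simp add: ac_simps padic_rel_def C)
  show "(a + b) + c = a + (b + c)"
    by transfer (simp add: ac_simps padic_rel_def C)
  show "0 + a = a"
    by transfer (simp add: padic_rel_def C)
  show "- a + a = 0"
    by transfer (simp add: padic_rel_def C)
  show "a - b = a + - b"
    by (rule minus_padic_def)
  show "(a * b) * c = a * (b * c)"
    by transfer (simp add: ac_simps padic_rel_def C)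
  show "a * b = b * a"
    by transfer (simp add: ac_simps padic_rel_def C)
  show "1 * a = a"
    by transfer (simp add: padic_rel_def C)
  show "(a + b) * c = a * c + b * c"
    by transfer (simp add: distrib_right padic_rel_def C)
  show "(0::'a padic) \<noteq> 1"
    by transfer (simp add: padic_rel_def padic_vanishes_def P LIMSEQ_const_iff)
  show "inverse (0::'a padic) = 0"
    by transfer (simp add: padic_rel_def padic_cauchy_const padic_vanishes_0 P)
  show "a \<noteq> 0 \<Longrightarrow> inverse a * a = 1"
  proof transfer
    fix X assume rel: "padic_rel CARD('a) X X" and nz: "\<not> padic_rel CARD('a) X (\<lambda>n. 0)"
    have X: "padic_cauchy CARD('a) X" using rel by (simp add: padic_rel_def)
    have nv: "\<not> padic_vanishes CARD('a) X"
      using nz X by (simp add: padic_rel_def padic_cauchy_const P)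
    obtain b k where b: "0 < b" and k: "\<And>n. n \<ge> k \<Longrightarrow> b < padic_abs CARD('a) (X n)"
      by (rule padic_cauchy_not_vanishes [OF P X nv]) blast
    have "padic_abs CARD('a) (inverse (X n) * X n - 1) = 0" if "n \<ge> k" for n
      using k [OF that] b by (cases "X n = 0") auto
    then have "padic_vanishes CARD('a) (\<lambda>n. inverse (X n) * X n - 1)"
      unfolding padic_vanishes_def
      by (intro tendsto_eventually) (auto simp: eventually_sequentially)
    then show "padic_rel CARD('a)
        (\<lambda>n. (if padic_vanishes CARD('a) X then \<lambda>n. 0 else (\<lambda>n. inverse (X n))) n * X n) (\<lambda>n. 1)"
      using nv by (simp add: padic_rel_def padic_cauchy_mult padic_cauchy_inverse X padic_cauchy_const P)
  qed
  show "a div b = a * inverse b"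
    by (rule divide_padic_def)
qed

end

lift_definition padic_norm :: "'p::prime_card padic \<Rightarrow> real" is
  "\<lambda>X. lim (\<lambda>n. padic_abs CARD('p) (X n))"
  by (rule padic_rel_lim [OF prime_card])

lemma padic_abs_tendsto_lim:
  assumes "prime p" "padic_cauchy p X"
  shows "(\<lambda>n. padic_abs p (X n)) \<longlonglongrightarrow> lim (\<lambda>n. padic_abs p (X n))"
  using padic_cauchy_abs [OF assms] Cauchy_convergent convergent_LIMSEQ_iff by blast

lemma padic_norm_eq_0_iff: "padic_norm (x :: 'p::prime_card padic) = 0 \<longleftrightarrow> x = 0"
proof transfer
  fix X assume "padic_rel CARD('p) X X"
  then have X: "padic_cauchy CARD('p) X" by (simp add: padic_rel_def)
  have L: "(\<lambda>n. padic_abs CARD('p) (X n)) \<longlonglongrightarrow> lim (\<lambda>n. padic_abs CARD('p) (X n))"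
    by (rule padic_abs_tendsto_lim [OF prime_card X])
  have "lim (\<lambda>n. padic_abs CARD('p) (X n)) = 0 \<longleftrightarrow> padic_vanishes CARD('p) X"
    unfolding padic_vanishes_def using L limI by metis
  then show "lim (\<lambda>n. padic_abs CARD('p) (X n)) = 0 \<longleftrightarrow> padic_rel CARD('p) X (\<lambda>n. 0)"
    by (simp add: padic_rel_def X padic_cauchy_const prime_card)
qed

lemma padic_norm_minus: "padic_norm (- x :: 'p::prime_card padic) = padic_norm x"
  by transfer (simp add: prime_card)

lemma padic_norm_mult: "padic_norm (x * y :: 'p::prime_card padic) = padic_norm x * padic_norm y"
proof transfer
  fix X Y assume "padic_rel CARD('p) X X" "padic_rel CARD('p) Y Y"
  then have "padic_cauchy CARD('p) X" "padic_cauchy CARD('p) Y" by (simp_all add: padic_rel_def)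
  from tendsto_mult [OF this [THEN padic_abs_tendsto_lim [OF prime_card]]]
  show "lim (\<lambda>n. padic_abs CARD('p) (X n * Y n))
      = lim (\<lambda>n. padic_abs CARD('p) (X n)) * lim (\<lambda>n. padic_abs CARD('p) (Y n))"
    by (simp add: padic_abs_mult prime_card limI)
qed

lemma padic_norm_ultrametric: "padic_norm (x + y :: 'p::prime_card padic) \<le> max (padic_norm x) (padic_norm y)"
proof transfer
  fix X Y assume "padic_rel CARD('p) X X" "padic_rel CARD('p) Y Y"
  then have X: "padic_cauchy CARD('p) X" and Y: "padic_cauchy CARD('p) Y"
    by (simp_all add: padic_rel_def)
  show "lim (\<lambda>n. padic_abs CARD('p) (X n + Y n))
      \<le> max (lim (\<lambda>n. padic_abs CARD('p) (X n))) (lim (\<lambda>n. padic_abs CARD('p) (Y n)))"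
    using padic_abs_ultrametric [OF prime_card]
    by (intro LIMSEQ_le [OF padic_abs_tendsto_lim [OF prime_card padic_cauchy_add [OF prime_card X Y]]
          tendsto_max [OF padic_abs_tendsto_lim [OF prime_card X] padic_abs_tendsto_lim [OF prime_card Y]]])
      auto
qed

lemma padic_norm_nonneg: "0 \<le> padic_norm (x :: 'p::prime_card padic)"
  using padic_norm_ultrametric [of x "- x"] padic_norm_eq_0_iff [of "x + - x"]
  by (simp add: padic_norm_minus)

lemma padic_norm_of_rat:
  "padic_norm (of_int a / of_int b :: 'p::prime_card padic) = padic_abs CARD('p) (of_int a / of_int b)"
proof -
  have nat: "rel_fun (=) (pcr_padic) (\<lambda>k n. of_nat k) (of_nat :: nat \<Rightarrow> 'p padic)"
  proof
    fix k l :: nat assume "k = l"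
    moreover have "pcr_padic (\<lambda>n. of_nat k) (of_nat k :: 'p padic)"
    proof (induction k)
      case 0 show ?case using zero_padic.transfer by simp
    next
      case (Suc k)
      show ?case
        using plus_padic.transfer [THEN rel_funD, OF one_padic.transfer, THEN rel_funD, OF Suc] by simp
    qed
    ultimately show "pcr_padic (\<lambda>n. of_nat k) (of_nat l :: 'p padic)" by simp
  qed
  have int: "padic_norm (of_int c :: 'p padic) = padic_abs CARD('p) (of_int c)" for c
  proof -
    have *: "padic_norm (of_nat k :: 'p padic) = padic_abs CARD('p) (of_nat k)" for k
      using padic_norm.transfer [THEN rel_funD, OF nat [THEN rel_funD, OF refl, of k]] by simp
    show ?thesis
      by (cases c rule: int_cases2) (simp_all add: * padic_norm_minus prime_card)
  qed
  have inv: "padic_norm (inverse x) = inverse (padic_norm x)" for x :: "'p padic"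
  proof (cases "x = 0")
    case False
    then have "padic_norm x * padic_norm (inverse x) = padic_norm (1 :: 'p padic)"
      by (simp add: padic_norm_mult [symmetric])
    also have "\<dots> = 1" using int [of 1] by simp
    finally show ?thesis by (metis inverse_unique)
  qed (use padic_norm_eq_0_iff [of "0 :: 'p padic"] in simp)
  show ?thesis
    by (simp add: divide_inverse padic_norm_mult padic_abs_mult prime_card int inv padic_abs_inverse)
qed

instantiation padic :: (prime_card) metric_space
begin

definition dist_padic :: "'a padic \<Rightarrow> 'a padic \<Rightarrow> real" where
  "dist_padic x y = padic_norm (x - y)"

definition uniformity_padic :: "('a padic \<times> 'a padic) filter" where
  "uniformity_padic = (INF e\<in>{0 <..}. principal {(x, y). dist x y < e})"

definition open_padic :: "'a padic set \<Rightarrow> bool" where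
  "open_padic U \<longleftrightarrow> (\<forall>x\<in>U. eventually (\<lambda>(x', y). x' = x \<longrightarrow> y \<in> U) uniformity)"

instance
proof
  fix x y z :: "'a padic"
  show "dist x y = 0 \<longleftrightarrow> x = y"
    by (simp add: dist_padic_def padic_norm_eq_0_iff)
  show "dist x y \<le> dist x z + dist y z"
    using padic_norm_ultrametric [of "x - z" "z - y"] padic_norm_minus [of "y - z"]
      padic_norm_nonneg [of "x - z"] padic_norm_nonneg [of "y - z"]
    by (simp add: dist_padic_def)
qed (simp_all add: uniformity_padic_def open_padic_def)

end


section \<open>Haar measure, balls and the spaces \<open>\<H>\<^sub>B\<close>\<close>

text \<open>The translation invariant Borel measure with total mass 1 on the \<open>p\<close>-adic integers.\<close>

definition padic_haar :: "'p::prime_card padic measure" where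
  "padic_haar = (THE M. sets M = sets borel \<and>
                        (\<forall>a. distr M borel (\<lambda>x. a + x) = M) \<and>
                        emeasure M {x. padic_norm x \<le> 1} = 1)"

text \<open>The balls of radius \<open>p\<^sup>m\<close> are the closed metric balls \<open>cball x (p\<^sup>m)\<close>.\<close>

definition padic_balls :: "int \<Rightarrow> 'p::prime_card padic set set" where
  "padic_balls m = {cball x (real CARD('p) powi m) | x. True}"

definition ball_children :: "int \<Rightarrow> 'p::prime_card padic set \<Rightarrow> 'p padic set set" where
  "ball_children m B = {C \<in> padic_balls (m - 1). C \<subseteq> B}"

definition child_fun :: "'p::prime_card padic set \<Rightarrow> 'p padic set \<Rightarrow> 'p padic \<Rightarrow> real" where
  "child_fun B C x = 1 / measure padic_haar C * indicator C x
                     - 1 / measure padic_haar B * indicator B x"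

definition ball_space :: "int \<Rightarrow> 'p::prime_card padic set \<Rightarrow> ('p padic \<Rightarrow> real) set" where
  "ball_space m B =
    {f. \<exists>S c. finite S \<and> S \<subseteq> ball_children m B \<and> f = (\<lambda>x. \<Sum>C\<in>S. c C * child_fun B C x)}"


section \<open>Rotation invariant semigroups and Laplacians\<close>

text \<open>
  The library's convolution of measures is restricted to ordered Euclidean spaces; this is the
  same definition on \<open>\<rat>\<^sub>p\<close>.
\<close>

definition padic_convolution ::
    "'p::prime_card padic measure \<Rightarrow> 'p padic measure \<Rightarrow> 'p padic measure" where
  "padic_convolution M N = distr (M \<Otimes>\<^sub>M N) borel (\<lambda>(x, y). x + y)"

text \<open>Only the measures \<open>\<nu> t\<close> with \<open>t > 0\<close> matter; \<open>P\<^sub>0\<close> is the identity.\<close>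

definition symmetric_convolution_semigroup :: "(real \<Rightarrow> 'p::prime_card padic measure) \<Rightarrow> bool" where
  "symmetric_convolution_semigroup \<nu> \<longleftrightarrow>
     (\<forall>t>0. prob_space (\<nu> t) \<and> sets (\<nu> t) = sets borel \<and> distr (\<nu> t) borel uminus = \<nu> t) \<and>
     (\<forall>s>0. \<forall>t>0. padic_convolution (\<nu> s) (\<nu> t) = \<nu> (s + t)) \<and>
     (\<forall>f :: 'p padic \<Rightarrow> real. continuous_on UNIV f \<and> bounded (range f) \<longrightarrow>
        continuous_on {0<..} (\<lambda>t. \<integral>x. f x \<partial>\<nu> t) \<and>
        ((\<lambda>t. \<integral>x. f x \<partial>\<nu> t) \<longlongrightarrow> f 0) (at_right 0))"

definition rotation_invariant :: "(real \<Rightarrow> 'p::prime_card padic measure) \<Rightarrow> bool" where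
  "rotation_invariant \<nu> \<longleftrightarrow> (\<forall>t>0. \<forall>a. padic_norm a = 1 \<longrightarrow> distr (\<nu> t) borel (\<lambda>x. a * x) = \<nu> t)"

definition square_integrable :: "('p::prime_card padic \<Rightarrow> real) \<Rightarrow> bool" where
  "square_integrable f \<longleftrightarrow> f \<in> borel_measurable borel \<and> integrable padic_haar (\<lambda>x. (f x)\<^sup>2)"

definition semigroup_op ::
    "(real \<Rightarrow> 'p::prime_card padic measure) \<Rightarrow> real \<Rightarrow> ('p padic \<Rightarrow> real) \<Rightarrow> 'p padic \<Rightarrow> real" where
  "semigroup_op \<nu> t f x = (\<integral>y. f (x - y) \<partial>\<nu> t)"

text \<open>
  Elements of \<open>L\<^sup>2\<close> are given by representatives, and an (unbounded) operator by its graph, closed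
  under equality almost everywhere: \<open>(f, g)\<close> belongs to \<open>generator \<nu>\<close> iff \<open>f\<close> is in the domain
  and \<open>\<L> f = g\<close>. The sign is that of \<open>P\<^sub>t = exp (- t \<L>)\<close>, so \<open>\<L> f\<close> is the limit in \<open>L\<^sup>2\<close> of
  \<open>(f - P\<^sub>t f) / t\<close> as \<open>t\<close> decreases to 0. The squared norm is a nonnegative extended integral, so
  that a divergent integral does not count as 0.
\<close>

definition generator ::
    "(real \<Rightarrow> 'p::prime_card padic measure) \<Rightarrow> (('p padic \<Rightarrow> real) \<times> ('p padic \<Rightarrow> real)) set" where
  "generator \<nu> =
    {(f, g). square_integrable f \<and> square_integrable g \<and>
       ((\<lambda>t. \<integral>\<^sup>+x. ennreal (((f x - semigroup_op \<nu> t f x) / t - g x)\<^sup>2) \<partial>padic_haar)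
          \<longlongrightarrow> 0) (at_right 0)}"

text \<open>
  The identity semigroup (all measures are the point mass at 0, the generator is the zero operator)
  is excluded. This matches the condition \<open>a (- \<infinity>) > 0\<close>: the zero operator has \<open>\<lambda> = 0\<close>, which
  forces \<open>a = 0\<close>. A nonzero \<open>\<L>\<close> may still have a kernel (when \<open>a\<close> vanishes near \<open>+ \<infinity>\<close>), so
  ``positive definite'' means \<open>\<langle>\<L> f, f\<rangle> \<ge> 0\<close>, which is automatic for a symmetric semigroup.
\<close>

definition rotation_invariant_Laplacian ::
    "(('p::prime_card padic \<Rightarrow> real) \<times> ('p padic \<Rightarrow> real)) set \<Rightarrow> bool" where
  "rotation_invariant_Laplacian L \<longleftrightarrow>
     (\<exists>\<nu>. symmetric_convolution_semigroup \<nu> \<and> rotation_invariant \<nu> \<and>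
          (\<exists>t>0. \<nu> t \<noteq> return borel 0) \<and> L = generator \<nu>)"

end

theory Submission
  imports Defs
begin

text \<open>
  For a rotation invariant probability measure \<open>\<nu>\<close> put \<open>F m = \<nu> {x. \<parallel>x\<parallel> \<le> p\<^sup>m}\<close>. Rotation invariance
  spreads the mass of each sphere evenly over its subballs, so that convolution with \<open>\<nu>\<close> acts on
  \<open>\<H>\<^sub>B\<close>, for \<open>B\<close> of radius \<open>p\<^sup>m\<close>, as multiplication by \<open>\<phi> m = (p F (m - 1) - F m) / (p - 1)\<close>;
  conversely \<open>F m\<close> is the geometric average of the \<open>\<phi> (m + j)\<close>, \<open>j \<ge> 1\<close>, so \<open>\<phi>\<close> determines \<open>\<nu>\<close>.

  If \<open>\<lambda>\<close> is the spectrum of a Laplacian, then \<open>(1 - \<phi>\<^sub>t m) / t\<close> tends to \<open>\<lambda> m\<close>, and by dominated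
  convergence in the geometric average \<open>\<nu>\<^sub>t {x. \<parallel>x\<parallel> \<ge> p\<^sup>m} / t\<close> has a limit \<open>a m\<close>: the mass of
  \<open>{x. \<parallel>x\<parallel> \<ge> p\<^sup>m}\<close> under the jump measure. The estimate \<open>\<phi>\<^sub>1 m \<le> exp (- \<lambda> m)\<close> forces \<open>\<lambda>\<close>, and
  with it \<open>a\<close>, to vanish at \<open>+ \<infinity>\<close>.

  Conversely every admissible \<open>F\<close> belongs to a measure, namely the law of \<open>g(U) X\<close> where \<open>U\<close> is uniform
  on \<open>(0, 1)\<close>, \<open>X\<close> is uniform on the unit sphere and \<open>\<parallel>g(u)\<parallel>\<close> is the quantile function of \<open>F\<close>. So
  the set of symbols \<open>\<phi>\<close> is closed under products (convolution) and under pointwise limits. It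
  therefore contains \<open>exp (- t \<lambda>)\<close>, as a limit of \<open>(1 - t \<lambda> / n)\<^sup>n\<close> with truncated \<open>a\<close>.
\<close>

section \<open>The norm\<close>

text \<open>The obstacle in the converse is monotonicity. The candidate for \<open>F\<close> at time
  t is the geometric average of exp (- t \<lambda>), but \<lambda> need not be monotone, so the
  formula does not show that this average increases. That comes from the approximants, which are
  distribution functions of convolution powers, and it survives the limit. Truncation enters because
  \<open>a\<close> may be unbounded at minus infinity, while 1 - (t / n) a has to be nonnegative.
  The formula for \<lambda> is the formula for \<phi> read on tails: {norm \<ge> p^m} is the
  complement of the ball of radius p^(m-1), so G m = 1 - F (m - 1) satisfies 1 - \<phi> m = (p G m -
  G (m + 1)) / (p - 1). With S the shift, (p - S) / (p - 1) is inverted on bounded sequences by a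
  geometric series; every passage from symbols back to masses uses this inverse. Haar measure is
  given by a definite description and has to be constructed: independent uniform digits yield it on
  the unit ball, and coset representatives spread it over the field.\<close>

lemma padic_norm_zero [simp]: "padic_norm (0 :: 'p::prime_card padic) = 0"
  by (simp add: padic_norm_eq_0_iff)

lemma padic_norm_one [simp]: "padic_norm (1 :: 'p::prime_card padic) = 1"
  using padic_norm_of_rat[of 1 1, where 'p='p] by simp

lemma padic_norm_commute: "padic_norm (x - y :: 'p::prime_card padic) = padic_norm (y - x)"
  by (metis minus_diff_eq padic_norm_minus)

lemma padic_norm_inverse: "padic_norm (inverse x :: 'p::prime_card padic) = inverse (padic_norm x)"
proof (cases "x = 0")
  case False
  then have "padic_norm x * padic_norm (inverse x) = 1"
    by (simp add: padic_norm_mult [symmetric])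
  then show ?thesis by (metis inverse_unique)
qed simp

lemma padic_norm_divide: "padic_norm (x / y :: 'p::prime_card padic) = padic_norm x / padic_norm y"
  by (simp add: divide_inverse padic_norm_mult padic_norm_inverse)

lemma padic_norm_power: "padic_norm (x ^ n :: 'p::prime_card padic) = padic_norm x ^ n"
  by (induction n) (auto simp: padic_norm_mult)

lemma padic_norm_power_int: "padic_norm (x powi k :: 'p::prime_card padic) = padic_norm x powi k"
  by (simp add: power_int_def padic_norm_power padic_norm_inverse)

lemma card_prime_gt_1 [simp]: "1 < real CARD('p::prime_card)"
  using prime_gt_1_nat[OF prime_card[where 'a='p]] by simp

lemma Suc_0_less_card_prime [simp]: "Suc 0 < CARD('p::prime_card)"
  using prime_gt_1_nat[OF prime_card[where 'a='p]] by simp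

lemma card_prime_neq_1 [simp]: "CARD('p::prime_card) \<noteq> Suc 0"
  by (metis Suc_0_less_card_prime less_irrefl)

lemma card_prime_gt_0 [simp]: "0 < real CARD('p::prime_card)"
  using card_prime_gt_1[where 'p='p] by linarith

lemma padic_norm_of_int: "padic_norm (of_int a :: 'p::prime_card padic) = padic_abs CARD('p) (of_int a)"
  using padic_norm_of_rat[of a 1, where 'p='p] by simp

lemma padic_norm_of_int_le_1: "padic_norm (of_int a :: 'p::prime_card padic) \<le> 1"
proof (cases "a = 0")
  case False
  have "real CARD('p) powi (- int (multiplicity (int CARD('p)) a)) \<le> 1"
    by (metis add.inverse_neutral card_prime_gt_1 le_less neg_le_iff_le of_nat_0_le_iff power_int_0_right power_int_increasing)
  then show ?thesis
    using padic_abs_fract[OF prime_card[where 'a='p] False, of 1] by (simp add: padic_norm_of_int)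
qed simp

lemma padic_norm_of_int_eq_1:
  assumes "\<not> int CARD('p) dvd a"
  shows "padic_norm (of_int a :: 'p::prime_card padic) = 1"
proof -
  have "a \<noteq> 0" using assms by auto
  then show ?thesis
    using padic_abs_fract[OF prime_card[where 'a='p], of a 1] assms
    by (simp add: padic_norm_of_int not_dvd_imp_multiplicity_0)
qed

lemma padic_norm_of_int_dvd:
  assumes "int CARD('p) dvd a"
  shows "padic_norm (of_int a :: 'p::prime_card padic) < 1"
proof (cases "a = 0")
  case False
  have "1 \<le> multiplicity (int CARD('p)) a"
    using assms False prime_gt_1_nat[OF prime_card[where 'a='p]]
    by (intro multiplicity_geI) auto
  then have "real CARD('p) powi (- int (multiplicity (int CARD('p)) a)) < real CARD('p) powi 0"
    by (intro power_int_strict_increasing) auto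
  then show ?thesis
    using padic_abs_fract[OF prime_card[where 'a='p] False, of 1] by (simp add: padic_norm_of_int)
qed simp

lemma padic_norm_of_nat_card [simp]:
  "padic_norm (of_nat CARD('p) :: 'p::prime_card padic) = 1 / real CARD('p)"
proof -
  have "multiplicity (int CARD('p)) (int CARD('p)) = 1"
    using prime_gt_1_nat[OF prime_card[where 'a='p]] by (intro multiplicity_self) auto
  then show ?thesis
    using padic_norm_of_int[of "int CARD('p)", where 'p='p]
      padic_abs_fract[OF prime_card[where 'a='p], of "int CARD('p)" 1]
    by (simp add: power_int_minus divide_inverse)
qed

text \<open>The exponent is negated so that the index is that of the norm: multiplication by
  \<open>padic_unif k\<close> scales the unit ball to radius p^k.\<close>

definition padic_unif :: "int \<Rightarrow> 'p::prime_card padic" where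
  "padic_unif k = of_nat CARD('p) powi (- k)"

lemma padic_norm_unif [simp]: "padic_norm (padic_unif k :: 'p::prime_card padic) = real CARD('p) powi k"
  unfolding padic_unif_def padic_norm_power_int padic_norm_of_nat_card
  by (simp add: power_int_divide_distrib power_int_minus divide_inverse power_int_inverse)

lemma padic_norm_diff_le_max:
  "padic_norm (x - y :: 'p::prime_card padic) \<le> max (padic_norm x) (padic_norm y)"
  using padic_norm_ultrametric[of x "- y"] by (simp add: padic_norm_minus)

lemma padic_norm_add_eq:
  assumes "padic_norm x < padic_norm (y :: 'p::prime_card padic)"
  shows "padic_norm (x + y) = padic_norm y"
  using assms padic_norm_ultrametric[of x y] padic_norm_diff_le_max[of "x + y" x] by simp

section \<open>Rational approximation, value group and residue field\<close>

text \<open>Constant sequences represent the embedded rationals. The rational is kept as a quotient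
  of integers, the form in which \<open>padic_norm_of_rat\<close> gives its norm.\<close>

lemma padic_const_eq: "abs_padic (\<lambda>n. of_int a / of_int b) = (of_int a / of_int b :: 'p::prime_card padic)"
  if b: "b \<noteq> 0"
proof -
  note P = prime_card [where 'a = 'p]
  note C = padic_cauchy_const[OF P] padic_rel_refl[OF P]
  have abs_add: "abs_padic (\<lambda>n. r + s) = (abs_padic (\<lambda>n. r) + abs_padic (\<lambda>n. s) :: 'p padic)" for r s
    by (rule plus_padic.abs_eq[symmetric]) (simp_all add: C)
  have abs_uminus: "abs_padic (\<lambda>n. - r) = (- abs_padic (\<lambda>n. r) :: 'p padic)" for r
    by (rule uminus_padic.abs_eq[symmetric]) (simp_all add: C)
  have abs_mult: "abs_padic (\<lambda>n. r * s) = (abs_padic (\<lambda>n. r) * abs_padic (\<lambda>n. s) :: 'p padic)" for r s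
    by (rule times_padic.abs_eq[symmetric]) (simp_all add: C)
  have abs_nat: "abs_padic (\<lambda>n. of_nat k) = (of_nat k :: 'p padic)" for k
    by (induction k) (simp_all add: abs_add zero_padic.abs_eq[symmetric] one_padic.abs_eq[symmetric])
  have abs_int: "abs_padic (\<lambda>n. of_int k) = (of_int k :: 'p padic)" for k
    by (cases k rule: int_cases2) (simp_all add: abs_uminus abs_nat)
  have "padic_norm (of_int b :: 'p padic) \<noteq> 0"
    using b P by (simp add: padic_norm_of_int)
  then have nz: "(of_int b :: 'p padic) \<noteq> 0" by auto
  have "abs_padic (\<lambda>n. of_int b * (of_int a / of_int b)) = (of_int a :: 'p padic)"
    using b by (simp add: abs_int)
  then have "of_int b * abs_padic (\<lambda>n. of_int a / of_int b) = (of_int a :: 'p padic)"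
    unfolding abs_mult abs_int .
  then show ?thesis using nz by (simp add: field_simps)
qed

lemma padic_norm_abs_diff_le:
  assumes Y: "padic_cauchy CARD('p::prime_card) Y" and b: "b \<noteq> 0"
    and le: "\<And>m. m \<ge> k \<Longrightarrow> padic_abs CARD('p) (Y m - of_int a / of_int b) \<le> e"
  shows "padic_norm (abs_padic Y - of_int a / of_int b :: 'p padic) \<le> e"
proof -
  note P = prime_card [where 'a = 'p]
  let ?c = "of_int a / of_int b :: rat"
  have c2: "padic_cauchy CARD('p) (\<lambda>n. Y n + - ?c)"
    by (intro padic_cauchy_add padic_cauchy_const P Y)
  have "abs_padic Y - of_int a / of_int b = (abs_padic Y + - abs_padic (\<lambda>n. ?c) :: 'p padic)"
    using b by (simp add: padic_const_eq)
  also have "- abs_padic (\<lambda>n. ?c) = (abs_padic (\<lambda>n. - ?c) :: 'p padic)"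
    by (rule uminus_padic.abs_eq) (simp_all add: padic_rel_refl padic_cauchy_const P)
  also have "abs_padic Y + (abs_padic (\<lambda>n. - ?c) :: 'p padic) = abs_padic (\<lambda>n. Y n + - ?c)"
    by (rule plus_padic.abs_eq) (simp_all add: padic_rel_refl padic_cauchy_const P Y)
  finally have "padic_norm (abs_padic Y - of_int a / of_int b :: 'p padic)
      = lim (\<lambda>n. padic_abs CARD('p) (Y n + - ?c))"
    using padic_norm.abs_eq[of "\<lambda>n. Y n + - ?c", where 'p='p] c2 by (simp add: padic_rel_refl P)
  also have "\<dots> \<le> e"
    by (rule LIMSEQ_le_const2[OF padic_abs_tendsto_lim[OF P c2]]) (use le in \<open>auto intro!: exI[of _ k]\<close>)
  finally show ?thesis .
qed

text \<open>A late term of a representing Cauchy sequence is the approximation. Lowest terms are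
  recorded because \<open>padic_digit\<close> needs that p divides at most one of \<open>a\<close>
  and \<open>b\<close>.\<close>

lemma padic_rat_dense:
  fixes x :: "'p::prime_card padic"
  assumes "0 < e"
  obtains a b :: int where "b \<noteq> 0" "coprime a b" "padic_norm (x - of_int a / of_int b) < e"
proof -
  note P = prime_card [where 'a = 'p]
  have X: "padic_cauchy CARD('p) (rep_padic x)" "abs_padic (rep_padic x) = x"
    using Quotient_rep_reflp[OF Quotient_padic, of x] Quotient_abs_rep[OF Quotient_padic, of x]
    by (auto simp: padic_rel_def)
  define Y where "Y = rep_padic x"
  \<comment> \<open>Half of \<open>e\<close>, because the limit in
    \<open>padic_norm_abs_diff_le\<close> preserves only a non-strict bound.\<close>
  obtain k where k: "\<And>m n. m \<ge> k \<Longrightarrow> n \<ge> k \<Longrightarrow> padic_abs CARD('p) (Y m - Y n) < e / 2"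
    using X(1) assms unfolding padic_cauchy_def Y_def by (meson half_gt_zero)
  obtain a b where ab: "quotient_of (Y k) = (a, b)" by fastforce
  have b: "b > 0" "coprime a b" using quotient_of_denom_pos[OF ab] quotient_of_coprime[OF ab] by auto
  have Yk: "Y k = of_int a / of_int b" using quotient_of_div[OF ab] .
  have "padic_norm (abs_padic Y - of_int a / of_int b :: 'p padic) \<le> e / 2"
    by (rule padic_norm_abs_diff_le[of _ _ k])
       (use k[of _ k] X b Yk in \<open>auto simp: Y_def less_imp_le\<close>)
  also have "\<dots> < e" using assms by simp
  finally show thesis using b X(2) that[of b a] by (auto simp: Y_def)
qed

text \<open>A rational closer to \<open>x\<close> than the norm of \<open>x\<close> has the same
  norm by the ultrametric inequality, and norms of nonzero rationals are powers of p.\<close>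

lemma padic_norm_values:
  fixes x :: "'p::prime_card padic"
  assumes "x \<noteq> 0"
  obtains k where "padic_norm x = real CARD('p) powi k"
proof -
  have "0 < padic_norm x" using assms padic_norm_eq_0_iff[of x] padic_norm_nonneg[of x] by linarith
  then obtain a b where ab: "b \<noteq> 0" "padic_norm (x - of_int a / of_int b) < padic_norm x"
    using padic_rat_dense by metis
  let ?r = "of_int a / of_int b :: 'p padic"
  have "padic_norm x = padic_norm ?r"
  proof -
    have "padic_norm (- (x - ?r) + x) = padic_norm x"
      by (rule padic_norm_add_eq) (use ab in \<open>simp add: padic_norm_commute\<close>)
    then show ?thesis by simp
  qed
  also have "\<dots> = padic_abs CARD('p) (of_int a / of_int b)" by (rule padic_norm_of_rat)
  finally have "padic_norm x = padic_abs CARD('p) (of_int a / of_int b)" .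
  moreover have "a \<noteq> 0" using calculation assms padic_norm_eq_0_iff[of x] by auto
  ultimately show thesis
    using padic_abs_fract[OF prime_card[where 'a='p] _ ab(1), of a] that by metis
qed

text \<open>No norm lies strictly between p^(m-1) and p^m, so an open ball of radius p^m is a closed
  ball one step down. Strict estimates become membership in a child ball this way.\<close>

lemma padic_norm_less_iff:
  "padic_norm (x::'p::prime_card padic) < real CARD('p) powi m \<longleftrightarrow> padic_norm x \<le> real CARD('p) powi (m - 1)"
proof (cases "x = 0")
  case False
  then obtain k where k: "padic_norm x = real CARD('p) powi k" by (rule padic_norm_values)
  show ?thesis
  proof
    assume "padic_norm x < real CARD('p) powi m"
    then have "\<not> m \<le> k" using power_int_increasing[of m k "real CARD('p)"] k
      using card_prime_gt_1[where 'p='p] by linarith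
    then show "padic_norm x \<le> real CARD('p) powi (m - 1)"
      using power_int_increasing[of k "m - 1" "real CARD('p)"] k
      using card_prime_gt_1[where 'p='p] by linarith
  next
    assume "padic_norm x \<le> real CARD('p) powi (m - 1)"
    also have "\<dots> < real CARD('p) powi m" by (intro power_int_strict_increasing) auto
    finally show "padic_norm x < real CARD('p) powi m" .
  qed
qed auto

text \<open>The residue field is the integers mod p. A rational a/b near \<open>x\<close> has norm
  at most 1, so in lowest terms p does not divide b, and the digit is a times the inverse of b mod
  p.\<close>

lemma padic_digit:
  fixes x :: "'p::prime_card padic"
  assumes "padic_norm x \<le> 1"
  obtains i where "i < CARD('p)" "padic_norm (x - of_nat i) < 1"
proof -
  obtain a b where ab: "b \<noteq> 0" "coprime a b" "padic_norm (x - of_int a / of_int b) < 1"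
    using padic_rat_dense[of 1 x] by (metis zero_less_one)
  let ?p = "int CARD('p)" let ?r = "of_int a / of_int b :: 'p padic"
  have pp: "prime ?p" using prime_card[where 'a='p] by simp
  have r1: "padic_norm ?r \<le> 1"
    using padic_norm_diff_le_max[of x "x - ?r"] assms ab(3) by simp
  have nb: "\<not> ?p dvd b"
  proof
    assume "?p dvd b"
    then have "\<not> ?p dvd a" using ab(2) pp by (meson coprime_common_divisor not_prime_unit)
    moreover have "padic_norm (of_int b :: 'p padic) < 1" "padic_norm (of_int b :: 'p padic) > 0"
      using padic_norm_of_int_dvd[OF \<open>?p dvd b\<close>] ab(1) prime_card[where 'a='p]
      by (auto simp: padic_norm_of_int order_less_le)
    ultimately show False using r1 padic_norm_of_int_eq_1[of a, where 'p='p]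
      by (simp add: padic_norm_divide divide_le_eq)
  qed
  then have "coprime b ?p" using pp by (metis coprime_commute prime_imp_coprime)
  then obtain c where c: "[b * c = 1] (mod ?p)" using cong_solve_coprime_int by metis
  define i where "i = nat ((a * c) mod ?p)"
  have ic: "int i = (a * c) mod ?p" and il: "i < CARD('p)"
    using pp prime_gt_0_int[OF pp] by (auto simp: i_def nat_less_iff)
  have "[b * int i = b * (a * c)] (mod ?p)" unfolding ic by (simp add: cong_def mod_mult_right_eq)
  also have "b * (a * c) = a * (b * c)" by simp
  also have "[a * (b * c) = a * 1] (mod ?p)" using c by (rule cong_scalar_left)
  finally have "?p dvd a - b * int i" by (simp add: cong_iff_dvd_diff dvd_diff_commute)
  then have *: "padic_norm (of_int (a - b * int i) :: 'p padic) < 1"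
    by (rule padic_norm_of_int_dvd)
  have bn: "padic_norm (of_int b :: 'p padic) = 1" using padic_norm_of_int_eq_1[OF nb] .
  then have "(of_int b :: 'p padic) \<noteq> 0" by auto
  then have "?r - of_nat i = of_int (a - b * int i) / of_int b" by (simp add: field_simps)
  then have "padic_norm (?r - of_nat i) < 1" using * by (simp add: padic_norm_divide bn)
  then have "padic_norm ((x - ?r) + (?r - of_nat i)) < 1"
    using padic_norm_ultrametric[of "x - ?r" "?r - of_nat i"] ab(3) by simp
  then show thesis using that il by simp
qed

lemma padic_digit_unique:
  assumes "i < CARD('p)" "j < CARD('p)" "padic_norm (of_nat i - of_nat j :: 'p::prime_card padic) < 1"
  shows "i = j"
proof -
  have "padic_norm (of_int (int i - int j) :: 'p padic) < 1" using assms(3) by simp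
  then have "int CARD('p) dvd int i - int j" using padic_norm_of_int_eq_1 by fastforce
  then show ?thesis using assms(1,2)
    by (metis mod_eq_dvd_iff mod_less of_nat_eq_iff of_nat_mod)
qed


section \<open>Balls and topology\<close>

lemma dist_padic: "dist x y = padic_norm (y - x :: 'p::prime_card padic)"
  by (simp add: dist_padic_def padic_norm_commute)

lemma cball_padic_eq:
  assumes "padic_norm (y - x :: 'p::prime_card padic) \<le> r"
  shows "cball y r = cball x r"
proof -
  have "padic_norm (z - y) \<le> r \<longleftrightarrow> padic_norm (z - x) \<le> r" for z
    using assms padic_norm_ultrametric[of "z - y" "y - x"] padic_norm_diff_le_max[of "z - x" "y - x"]
    by auto
  then show ?thesis by (auto simp: dist_padic)
qed

text \<open>A common point is a centre of both balls once the smaller one is enlarged to radius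
  \<open>s\<close>.\<close>

lemma cball_padic_nested:
  assumes "r \<le> s" "cball (x::'p::prime_card padic) r \<inter> cball y s \<noteq> {}"
  shows "cball x r \<subseteq> cball y s"
proof -
  obtain z where z: "padic_norm (z - x) \<le> r" "padic_norm (z - y) \<le> s"
    using assms by (auto simp: dist_padic)
  have "cball x r \<subseteq> cball x s" using assms(1) by auto
  also have "cball x s = cball z s" using cball_padic_eq[of z x s] z assms(1) by simp
  also have "\<dots> = cball y s" using cball_padic_eq[of z y s] z by simp
  finally show ?thesis .
qed

lemma padic_exists_powi_less:
  assumes "0 < e"
  obtains n :: nat where "real CARD('p::prime_card) powi (- int n) < e"
proof -
  obtain n where "(1 / real CARD('p)) ^ n < e"
    using real_arch_pow_inv[OF assms, of "1 / real CARD('p)"] by auto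
  then show thesis using that[of n] by (simp add: power_int_minus power_divide divide_inverse power_inverse)
qed

lemma padic_exists_powi_ge:
  obtains n :: nat where "x \<le> real CARD('p::prime_card) powi int n"
  using real_arch_pow[of "real CARD('p)" x] that
  by (metis card_prime_gt_1 less_imp_le power_int_of_nat)

lemma open_cball_padic: "0 < r \<Longrightarrow> open (cball (x::'p::prime_card padic) r)"
  unfolding open_dist
  by (metis cball_padic_eq dist_padic_def less_imp_le mem_cball dist_commute)

text \<open>Dividing by \<open>padic_unif m\<close> turns the recentred ball into the unit ball and
  its children into the residue classes mod p, which \<open>padic_digit\<close> and
  \<open>padic_digit_unique\<close> enumerate without repetition.\<close>

lemma cball_padic_children:
  fixes c :: "'p::prime_card padic"
  shows "cball c (real CARD('p) powi m) =
    (\<Union>i<CARD('p). cball (c + of_nat i * padic_unif m) (real CARD('p) powi (m - 1)))" (is "?L = ?R")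
    and "disjoint_family_on (\<lambda>i. cball (c + of_nat i * padic_unif m) (real CARD('p) powi (m - 1)))
          {..<CARD('p)}"
proof -
  let ?u = "padic_unif m :: 'p padic"
  have u: "?u \<noteq> 0" using padic_norm_unif[of m, where 'p='p] by fastforce
  have pos: "0 < real CARD('p) powi m" by simp
  have le: "real CARD('p) powi (m - 1) \<le> real CARD('p) powi m"
    by (intro power_int_increasing) (auto intro: less_imp_le)
  have nat: "padic_norm (of_nat i :: 'p padic) \<le> 1" for i
    using padic_norm_of_int_le_1[of "int i"] by simp
  show "?L = ?R"
  proof (intro equalityI subsetI)
    fix y assume "y \<in> ?L"
    then have "padic_norm ((y - c) / ?u) \<le> 1" using pos by (simp add: dist_padic padic_norm_divide)
    then obtain i where i: "i < CARD('p)" "padic_norm ((y - c) / ?u - of_nat i) < 1"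
      by (rule padic_digit)
    have "y - (c + of_nat i * ?u) = ((y - c) / ?u - of_nat i) * ?u" using u by (simp add: field_simps)
    then have "padic_norm (y - (c + of_nat i * ?u)) < real CARD('p) powi m"
      using i pos by (simp add: padic_norm_mult)
    then show "y \<in> ?R" using i(1) unfolding padic_norm_less_iff by (auto simp: dist_padic)
  next
    fix y assume "y \<in> ?R"
    then obtain i where "padic_norm (y - (c + of_nat i * ?u)) \<le> real CARD('p) powi (m - 1)"
      by (auto simp: dist_padic)
    moreover have "padic_norm (of_nat i * ?u) \<le> real CARD('p) powi m"
      using mult_right_mono[OF nat[of i], of "real CARD('p) powi m"] pos by (simp add: padic_norm_mult)
    ultimately show "y \<in> ?L"
      using padic_norm_ultrametric[of "y - (c + of_nat i * ?u)" "of_nat i * ?u"] le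
      by (simp add: dist_padic)
  qed
  show "disjoint_family_on (\<lambda>i. cball (c + of_nat i * ?u) (real CARD('p) powi (m - 1))) {..<CARD('p)}"
  unfolding disjoint_family_on_def
  proof (intro ballI impI, rule ccontr)
    fix i j assume ij: "i \<in> {..<CARD('p)}" "j \<in> {..<CARD('p)}" "i \<noteq> j"
      "cball (c + of_nat i * ?u) (real CARD('p) powi (m - 1)) \<inter>
       cball (c + of_nat j * ?u) (real CARD('p) powi (m - 1)) \<noteq> {}"
    have "cball (c + of_nat i * ?u) (real CARD('p) powi (m - 1))
        \<subseteq> cball (c + of_nat j * ?u) (real CARD('p) powi (m - 1))"
      by (rule cball_padic_nested[OF order.refl ij(4)])
    then have "c + of_nat i * ?u \<in> cball (c + of_nat j * ?u) (real CARD('p) powi (m - 1))"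
      using pos by (auto simp: subset_iff)
    then have "padic_norm ((of_nat i - of_nat j) * ?u) < real CARD('p) powi m"
      unfolding padic_norm_less_iff by (simp add: dist_padic algebra_simps)
    then have "padic_norm (of_nat i - of_nat j :: 'p padic) < 1"
      using pos by (simp add: padic_norm_mult)
    then show False using padic_digit_unique ij by blast
  qed
qed

section \<open>Countable basis of balls and uniqueness of Borel measures\<close>

text \<open>Rational centres make the family countable, and radii at most 1 already give a basis. A
  pair with \<open>b = 0\<close> contributes a ball around 0, as division by zero is zero.\<close>

definition padic_basis :: "'p::prime_card padic set set" where
  "padic_basis = range (\<lambda>((a :: int, b :: int), n). cball (of_int a / of_int b) (real CARD('p) powi (- int n)))"

lemma countable_padic_basis: "countable padic_basis"
  unfolding padic_basis_def by (intro countable_image) simp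

lemma padic_basis_cover:
  fixes x :: "'p::prime_card padic"
  obtains a b :: int where "cball x (real CARD('p) powi k) = cball (of_int a / of_int b) (real CARD('p) powi k)"
proof -
  have "0 < real CARD('p) powi k" by simp
  then obtain a b :: int where "padic_norm (x - of_int a / of_int b) < real CARD('p) powi k"
    by (rule padic_rat_dense)
  then show thesis using that cball_padic_eq less_imp_le by blast
qed

lemma mem_padic_basis: "cball (x::'p::prime_card padic) (real CARD('p) powi (- int n)) \<in> padic_basis"
proof -
  obtain a b :: int where "cball x (real CARD('p) powi (- int n))
      = cball (of_int a / of_int b) (real CARD('p) powi (- int n))"
    by (rule padic_basis_cover)
  then show ?thesis unfolding padic_basis_def by (force intro!: image_eqI[of _ _ "((a, b), n)"])
qed

lemma padic_basisE:
  assumes "B \<in> padic_basis"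
  obtains x :: "'p::prime_card padic" and n :: nat where "B = cball x (real CARD('p) powi (- int n))"
  using assms unfolding padic_basis_def by auto

lemma topological_basis_padic: "topological_basis (padic_basis :: 'p::prime_card padic set set)"
proof (rule topological_basisI)
  show "open B" if "B \<in> padic_basis" for B :: "'p padic set"
    using that by (auto elim!: padic_basisE intro: open_cball_padic)
  fix U :: "'p padic set" and x assume "open U" "x \<in> U"
  then obtain e where e: "0 < e" "ball x e \<subseteq> U" by (meson openE)
  obtain n where "real CARD('p) powi (- int n) < e" using padic_exists_powi_less[OF e(1)] .
  then have "cball x (real CARD('p) powi (- int n)) \<subseteq> U" using e by auto
  then show "\<exists>B\<in>padic_basis. x \<in> B \<and> B \<subseteq> U"
    by (intro bexI[OF _ mem_padic_basis[of x n]]) auto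
qed

instance padic :: (prime_card) second_countable_topology
  using countable_padic_basis topological_basis_imp_subbasis[OF topological_basis_padic]
  by intro_classes blast

text \<open>Balls that meet are nested, so the basis together with the empty set is a pi-system
  generating the Borel sets. Countably many unit balls of finite measure cover the space.\<close>

lemma padic_measure_eqI:
  fixes M N :: "'p::prime_card padic measure"
  assumes sets: "sets M = sets borel" "sets N = sets borel"
    and eq: "\<And>c n. emeasure M (cball c (real CARD('p) powi (- int n))) = emeasure N (cball c (real CARD('p) powi (- int n)))"
    and fin: "\<And>c. emeasure M (cball c 1) \<noteq> \<infinity>"
  shows "M = N"
proof -
  let ?E = "insert {} (padic_basis :: 'p padic set set)"
  have "sigma_sets UNIV (padic_basis :: 'p padic set set) = sigma_sets UNIV ?E"
    by (rule sigma_sets_eqI) (auto intro: sigma_sets.Basic sigma_sets.Empty)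
  then have sb: "sets borel = sigma_sets UNIV ?E"
    by (subst borel_eq_countable_basis[OF countable_padic_basis topological_basis_padic])
      (simp add: sets_measure_of)
  \<comment> \<open>Enumerates the unit balls with rational centres, decoding n into numerator and
    denominator.\<close>
  define A :: "nat \<Rightarrow> 'p padic set" where
    "A n = (case prod_decode n of (a, b) \<Rightarrow> cball (of_int (int_decode a) / of_int (int_decode b)) 1)" for n
  show ?thesis
  proof (rule measure_eqI_generator_eq[where \<Omega>=UNIV and E="?E" and A=A])
    show "Int_stable ?E"
    proof (rule Int_stableI)
      fix a b :: "'p padic set" assume *: "a \<in> ?E" "b \<in> ?E"
      show "a \<inter> b \<in> ?E"
      proof (cases "a \<inter> b = {}")
        case False
        then have "a \<in> padic_basis" "b \<in> padic_basis" using * by auto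
        then obtain x r y s where xy: "a = cball x r" "b = cball y s" by (metis padic_basisE)
        have "a \<subseteq> b \<or> b \<subseteq> a"
          using cball_padic_nested[of r s x y] cball_padic_nested[of s r y x] False
          unfolding xy by (cases "r \<le> s") (auto simp: Int_commute)
        then show ?thesis using * by (metis Int_absorb1 Int_absorb2)
      qed simp
    qed
    show "emeasure M X = emeasure N X" if "X \<in> ?E" for X
      using that eq by (auto elim!: padic_basisE)
    show "(\<Union>i. A i) = UNIV"
    proof (intro equalityI subsetI UNIV_I)
      fix x :: "'p padic"
      obtain a b :: int where ab: "cball x (real CARD('p) powi 0) = cball (of_int a / of_int b) (real CARD('p) powi 0)"
        by (rule padic_basis_cover)
      have "x \<in> A (prod_encode (int_encode a, int_encode b))"
        using ab by (auto simp: A_def)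
      then show "x \<in> (\<Union>i. A i)" by blast
    qed
    have "A i \<in> ?E" for i
      using mem_padic_basis[of _ 0, where 'p='p] by (simp add: A_def split: prod.splits)
    then show "range A \<subseteq> ?E" by blast
    show "emeasure M (A i) \<noteq> \<infinity>" for i using fin by (auto simp: A_def split: prod.splits)
  qed (use sb sets in auto)
qed

section \<open>Continuity and measurability of the field operations\<close>

instance padic :: (prime_card) topological_group_add
proof
  fix a b :: "'a padic"
  show "((\<lambda>x. fst x + snd x) \<longlongrightarrow> a + b) (nhds a \<times>\<^sub>F nhds b)"
  proof (rule tendstoI)
    fix e :: real assume "0 < e"
    have "\<forall>\<^sub>F x in nhds a \<times>\<^sub>F nhds b. dist (fst x) a < e \<and> dist (snd x) b < e"
      using eventually_prod_filter by (force intro!: eventually_conj exI tendstoD[OF _ \<open>0<e\<close>] filterlim_fst filterlim_snd)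
    then show "\<forall>\<^sub>F x in nhds a \<times>\<^sub>F nhds b. dist (fst x + snd x) (a + b) < e"
    proof eventually_elim
      case (elim x)
      then show ?case
        using padic_norm_ultrametric[of "fst x - a" "snd x - b"]
        by (auto simp: dist_padic_def algebra_simps)
    qed
  qed
  show "(uminus \<longlongrightarrow> - a) (nhds a)"
  proof (rule tendstoI)
    fix e :: real assume "0 < e"
    have "\<forall>\<^sub>F x in nhds a. dist x a < e" using \<open>0 < e\<close> by (simp add: eventually_nhds_metric) blast
    then show "\<forall>\<^sub>F x in nhds a. dist (- x) (- a) < e"
      by eventually_elim (simp add: dist_padic_def padic_norm_commute)
  qed
qed

instance padic :: (prime_card) topological_semigroup_mult
proof
  fix a b :: "'a padic"
  let ?F = "nhds a \<times>\<^sub>F nhds b"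
  have l: "(fst \<longlongrightarrow> a) ?F" "(snd \<longlongrightarrow> b) ?F" by (rule filterlim_fst filterlim_snd)+
  have "((\<lambda>x. padic_norm a * dist (snd x) b + padic_norm b * dist (fst x) a + dist (fst x) a * dist (snd x) b) \<longlongrightarrow>
      padic_norm a * dist b b + padic_norm b * dist a a + dist a a * dist b b) ?F"
    by (intro tendsto_intros l)
  then have lim: "((\<lambda>x. padic_norm a * dist (snd x) b + padic_norm b * dist (fst x) a + dist (fst x) a * dist (snd x) b) \<longlongrightarrow> 0) ?F"
    by simp
  have "((\<lambda>x. dist (fst x * snd x) (a * b)) \<longlongrightarrow> 0) ?F"
  proof (rule tendsto_sandwich[OF _ _ tendsto_const lim])
    have "dist (x * y) (a * b) \<le> padic_norm a * dist y b + padic_norm b * dist x a + dist x a * dist y b" for x y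
    proof -
      \<comment> \<open>Expansion of the product around (a, b): two linear terms and a quadratic
        one, each tending to 0.\<close>
      have e: "x * y - a * b = (a * (y - b) + b * (x - a)) + (x - a) * (y - b)" by (simp add: algebra_simps)
      have "padic_norm (x * y - a * b) \<le> (padic_norm (a * (y - b)) + padic_norm (b * (x - a))) + padic_norm ((x - a) * (y - b))"
        using padic_norm_ultrametric[of "a * (y - b)" "b * (x - a)"]
          padic_norm_ultrametric[of "a * (y - b) + b * (x - a)" "(x - a) * (y - b)"]
          padic_norm_nonneg[of "a * (y - b)"] padic_norm_nonneg[of "b * (x - a)"]
          padic_norm_nonneg[of "(x - a) * (y - b)"]
        unfolding e by linarith
      then show ?thesis by (simp add: dist_padic_def padic_norm_mult)
    qed
    then show "\<forall>\<^sub>F x in ?F. dist (fst x * snd x) (a * b) \<le> padic_norm a * dist (snd x) b + padic_norm b * dist (fst x) a + dist (fst x) a * dist (snd x) b"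
      by simp
  qed simp
  then show "((\<lambda>x. fst x * snd x) \<longlongrightarrow> a * b) ?F" by (rule tendsto_dist_iff[THEN iffD2])
qed

lemma padic_add_measurable [measurable]:
  assumes [measurable]: "f \<in> borel_measurable M" "g \<in> borel_measurable M"
  shows "(\<lambda>x. f x + g x :: 'p::prime_card padic) \<in> borel_measurable M"
  by (rule borel_measurable_continuous_Pair[OF assms]) (intro continuous_intros)

lemma padic_mult_measurable [measurable]:
  assumes [measurable]: "f \<in> borel_measurable M" "g \<in> borel_measurable M"
  shows "(\<lambda>x. f x * g x :: 'p::prime_card padic) \<in> borel_measurable M"
  by (rule borel_measurable_continuous_Pair[OF assms]) (intro continuous_intros)

lemma padic_uminus_measurable [measurable]:
  assumes [measurable]: "f \<in> borel_measurable M"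
  shows "(\<lambda>x. - f x :: 'p::prime_card padic) \<in> borel_measurable M"
  by (rule borel_measurable_continuous_on[OF _ assms]) (intro continuous_intros)

lemma padic_diff_measurable [measurable]:
  assumes [measurable]: "f \<in> borel_measurable M" "g \<in> borel_measurable M"
  shows "(\<lambda>x. f x - g x :: 'p::prime_card padic) \<in> borel_measurable M"
  by (rule borel_measurable_continuous_Pair[OF assms]) (intro continuous_intros)


section \<open>Haar measure\<close>

lemma padic_norm_of_int_power_dvd:
  assumes "int CARD('p) ^ n dvd a"
  shows "padic_norm (of_int a :: 'p::prime_card padic) \<le> real CARD('p) powi (- int n)"
proof -
  obtain k where k: "a = int CARD('p) ^ n * k" using assms by (elim dvdE)
  show ?thesis
    using mult_left_mono[OF padic_norm_of_int_le_1[where 'p='p, of k], of "(1 / real CARD('p)) ^ n"]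
    by (simp add: k padic_norm_mult padic_norm_power power_int_minus power_divide divide_inverse power_inverse)
qed

definition padic_partial :: "(nat \<Rightarrow> nat) \<Rightarrow> nat \<Rightarrow> 'p::prime_card padic" where
  "padic_partial w n = (\<Sum>i<n. of_nat (w i) * of_nat CARD('p) ^ i)"

text \<open>Partial sums are integers, and p^n divides the difference of any two from index n on.
  They are therefore Cauchy, and the bound p^(-n) passes to the limit.\<close>

lemma padic_digits_converge:
  "\<exists>x :: 'p::prime_card padic. \<forall>n. padic_norm (x - padic_partial w n) \<le> real CARD('p) powi (- int n)"
proof -
  define S where "S n = (\<Sum>i<n. int (w i) * int CARD('p) ^ i)" for n
  have dvd: "int CARD('p) ^ n dvd S m - S n" if "n \<le> m" for m n
  proof -
    have "S m = S n + (\<Sum>i=n..<m. int (w i) * int CARD('p) ^ i)"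
      unfolding S_def lessThan_atLeast0 using that by (simp add: sum.atLeastLessThan_concat)
    then show ?thesis by (auto intro!: dvd_sum dvd_mult le_imp_power_dvd)
  qed
  have abs_le: "padic_abs CARD('p) (of_int (S m) - of_int (S n)) \<le> real CARD('p) powi (- int n)"
    if "n \<le> m" for m n
    using padic_norm_of_int_power_dvd[OF dvd[OF that]] by (metis of_int_diff padic_norm_of_int)
  define X where "X n = (of_int (S n) :: rat)" for n
  have X: "padic_cauchy CARD('p) X"
    unfolding padic_cauchy_def
  proof (intro allI impI)
    fix r :: real assume "0 < r"
    then obtain k where k: "real CARD('p) powi (- int k) < r" by (rule padic_exists_powi_less)
    have "padic_abs CARD('p) (X m - X n) < r" if mn: "m \<ge> k" "n \<ge> k" for m n
    proof -
      have e: "X m - X n = (X m - X k) + (X k - X n)" by simp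
      show ?thesis
        using padic_abs_ultrametric[OF prime_card[where 'a='p], of "X m - X k" "X k - X n"]
          abs_le[OF mn(1)] abs_le[OF mn(2)] k padic_abs_minus_commute[OF prime_card[where 'a='p], of "X k" "X n"]
        unfolding e unfolding X_def by linarith
    qed
    then show "\<exists>k. \<forall>m\<ge>k. \<forall>n\<ge>k. padic_abs CARD('p) (X m - X n) < r" by blast
  qed
  have "padic_norm (abs_padic X - padic_partial w n :: 'p padic) \<le> real CARD('p) powi (- int n)" for n
  proof -
    have "padic_norm (abs_padic X - of_int (S n) / of_int 1 :: 'p padic) \<le> real CARD('p) powi (- int n)"
      by (rule padic_norm_abs_diff_le[OF X, of _ n]) (use abs_le in \<open>auto simp: X_def\<close>)
    moreover have "(of_int (S n) :: 'p padic) = padic_partial w n"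
      by (simp add: S_def padic_partial_def)
    ultimately show ?thesis by simp
  qed
  then show ?thesis by blast
qed

text \<open>The bounds for all n determine the point, so the choice operator returns the sum of the
  digit series.\<close>

definition padic_of_digits :: "(nat \<Rightarrow> nat) \<Rightarrow> 'p::prime_card padic" where
  "padic_of_digits w = (SOME x. \<forall>n. padic_norm (x - padic_partial w n) \<le> real CARD('p) powi (- int n))"

lemma padic_of_digits_approx:
  "padic_norm (padic_of_digits w - padic_partial w n :: 'p::prime_card padic) \<le> real CARD('p) powi (- int n)"
  using someI_ex[OF padic_digits_converge[where 'p='p, of w]] unfolding padic_of_digits_def by blast

text \<open>The next digit names the child ball that contains \<open>c\<close>.\<close>

lemma padic_digits_exist:
  fixes c :: "'p::prime_card padic"
  assumes "padic_norm c \<le> 1"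
  shows "\<exists>d. (\<forall>i<n. d i < CARD('p)) \<and> padic_norm (c - padic_partial d n) \<le> real CARD('p) powi (- int n)"
proof (induction n)
  case 0
  then show ?case using assms by (simp add: padic_partial_def)
next
  case (Suc n)
  then obtain d where d: "\<forall>i<n. d i < CARD('p)" "padic_norm (c - padic_partial d n) \<le> real CARD('p) powi (- int n)"
    by blast
  have nu: "padic_unif (- int n) = (of_nat CARD('p) ^ n :: 'p padic)"
    by (simp add: padic_unif_def)
  have "c \<in> cball (padic_partial d n) (real CARD('p) powi (- int n))"
    using d by (simp add: dist_padic)
  then obtain i where i: "i < CARD('p)"
    "padic_norm (c - (padic_partial d n + of_nat i * of_nat CARD('p) ^ n)) \<le> real CARD('p) powi (- int n - 1)"
    unfolding cball_padic_children(1)[of "padic_partial d n" "- int n"] by (auto simp: dist_padic nu)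
  have "padic_partial (d(n := i)) n = (padic_partial d n :: 'p padic)"
    unfolding padic_partial_def by (intro sum.cong) auto
  then have "padic_partial (d(n := i)) (Suc n) = (padic_partial d n + of_nat i * of_nat CARD('p) ^ n :: 'p padic)"
    unfolding padic_partial_def by simp
  moreover have "- int (Suc n) = - int n - 1" by simp
  ultimately have "padic_norm (c - padic_partial (d(n := i)) (Suc n)) \<le> real CARD('p) powi (- int (Suc n))"
    using i(2) by presburger
  moreover have "\<forall>j<Suc n. (d(n := i)) j < CARD('p)" using d i by (auto simp: less_Suc_eq)
  ultimately show ?case by blast
qed

text \<open>Dropping the last digit changes the sums by at most p^(-n), which is the precision of
  the induction hypothesis. Once the earlier digits agree, the remaining difference forces the last
  digits to be congruent mod p.\<close>

lemma padic_digits_unique: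
  assumes "\<And>i. i < n \<Longrightarrow> d i < CARD('p)" "\<And>i. i < n \<Longrightarrow> w i < CARD('p)"
    and "padic_norm (padic_partial w n - padic_partial d n :: 'p::prime_card padic) \<le> real CARD('p) powi (- int n)"
  shows "\<forall>i<n. w i = d i"
  using assms
proof (induction n)
  case (Suc n)
  let ?P = "padic_partial :: _ \<Rightarrow> _ \<Rightarrow> 'p padic"
  let ?q = "of_nat CARD('p) :: 'p padic"
  have nq: "padic_norm (?q ^ n) = real CARD('p) powi (- int n)"
    by (simp add: padic_norm_power power_int_minus power_divide divide_inverse power_inverse)
  have le: "real CARD('p) powi (- int (Suc n)) \<le> real CARD('p) powi (- int n)"
    by (intro power_int_increasing) (auto intro: less_imp_le)
  have e: "?P w (Suc n) - ?P d (Suc n) = (?P w n - ?P d n) + (of_nat (w n) - of_nat (d n)) * ?q ^ n"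
    by (simp add: padic_partial_def algebra_simps)
  have "padic_norm (of_int (int (w n) - int (d n)) :: 'p padic) \<le> 1" by (rule padic_norm_of_int_le_1)
  then have "padic_norm ((of_nat (w n) - of_nat (d n)) * ?q ^ n) \<le> real CARD('p) powi (- int n)"
    using mult_right_mono[of "padic_norm (of_nat (w n) - of_nat (d n) :: 'p padic)" 1 "real CARD('p) powi (- int n)"]
    by (simp add: padic_norm_mult nq)
  then have "padic_norm (?P w n - ?P d n) \<le> real CARD('p) powi (- int n)"
    using padic_norm_diff_le_max[of "?P w (Suc n) - ?P d (Suc n)" "(of_nat (w n) - of_nat (d n)) * ?q ^ n"] Suc.prems(3) le
    unfolding e by simp
  then have IH: "\<forall>i<n. w i = d i" using Suc by simp
  then have "?P w n = ?P d n" by (simp add: padic_partial_def)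
  then have e': "?P w (Suc n) - ?P d (Suc n) = (of_nat (w n) - of_nat (d n)) * ?q ^ n" using e by simp
  have s: "- int (Suc n) = - int n - 1" by simp
  have "padic_norm ((of_nat (w n) - of_nat (d n)) * ?q ^ n) \<le> real CARD('p) powi (- int n - 1)"
    using Suc.prems(3) unfolding e' s .
  then have "padic_norm ((of_nat (w n) - of_nat (d n)) * ?q ^ n) < real CARD('p) powi (- int n)"
    unfolding padic_norm_less_iff .
  then have "padic_norm (of_nat (w n) - of_nat (d n) :: 'p padic) < 1"
    by (simp add: padic_norm_mult nq)
  then have "w n = d n" using padic_digit_unique Suc.prems by blast
  then show ?case using IH by (auto simp: less_Suc_eq)
qed simp

section \<open>Uniform digits and the Haar probability of the unit ball\<close>

text \<open>The law of independent uniform digits. Its image under \<open>padic_of_digits\<close> is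
  the normalized Haar measure of the compact group of p-adic integers.\<close>

definition digit_measure :: "nat \<Rightarrow> (nat \<Rightarrow> nat) measure" where
  "digit_measure p = PiM UNIV (\<lambda>_. uniform_count_measure {..<p})"

lemma space_digit_measure: "space (digit_measure p) = (UNIV \<rightarrow> {..<p})"
  by (simp add: digit_measure_def space_PiM PiE_UNIV_domain space_uniform_count_measure)

lemma padic_of_digits_measurable [measurable]:
  "padic_of_digits \<in> digit_measure CARD('p) \<rightarrow>\<^sub>M (borel :: 'p::prime_card padic measure)"
proof (rule borel_measurable_LIMSEQ_metric)
  fix n
  have [measurable]: "(\<lambda>w. w i) \<in> digit_measure CARD('p) \<rightarrow>\<^sub>M count_space {..<CARD('p)}" for i
  proof -
    have "(\<lambda>w. w i) \<in> digit_measure CARD('p) \<rightarrow>\<^sub>M uniform_count_measure {..<CARD('p)}"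
      unfolding digit_measure_def by (rule measurable_component_singleton) simp
    then show ?thesis by (simp add: measurable_cong_sets[OF refl sets_uniform_count_measure_count_space])
  qed
  have c: "(\<lambda>k. of_nat k * of_nat CARD('p) ^ i :: 'p padic) \<in> count_space {..<CARD('p)} \<rightarrow>\<^sub>M borel" for i by simp
  have t: "(\<lambda>w. of_nat (w i) * of_nat CARD('p) ^ i :: 'p padic) \<in> borel_measurable (digit_measure CARD('p))" for i
    by (rule measurable_compose[OF _ c]) simp
  show "(\<lambda>w. padic_partial w n :: 'p padic) \<in> borel_measurable (digit_measure CARD('p))"
  proof (induction n)
    case (Suc n)
    then show ?case using padic_add_measurable[OF Suc t[of n]] by (simp add: padic_partial_def)
  qed (simp add: padic_partial_def)
next
  fix w
  show "(\<lambda>n. padic_partial w n :: 'p padic) \<longlonglongrightarrow> padic_of_digits w"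
  proof (rule metric_LIMSEQ_I)
    fix r :: real assume "0 < r"
    then obtain k where k: "real CARD('p) powi (- int k) < r" by (rule padic_exists_powi_less)
    have "dist (padic_partial w n) (padic_of_digits w :: 'p padic) < r" if "n \<ge> k" for n
    proof -
      have "real CARD('p) powi (- int n) \<le> real CARD('p) powi (- int k)"
        using that by (intro power_int_increasing) (auto intro: less_imp_le)
      then show ?thesis using padic_of_digits_approx[where 'p='p, of w n] k by (simp add: dist_padic)
    qed
    then show "\<exists>no. \<forall>n\<ge>no. dist (padic_partial w n) (padic_of_digits w :: 'p padic) < r" by blast
  qed
qed

definition padic_int_measure :: "'p::prime_card padic measure" where
  "padic_int_measure = distr (digit_measure CARD('p)) borel padic_of_digits"

lemma padic_norm_of_digits: "padic_norm (padic_of_digits w :: 'p::prime_card padic) \<le> 1"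
  using padic_of_digits_approx[where 'p='p, of w 0] by (simp add: padic_partial_def)

lemma prob_space_padic_int_measure: "prob_space (padic_int_measure :: 'p::prime_card padic measure)"
proof -
  have "prob_space (digit_measure CARD('p))"
    unfolding digit_measure_def by (intro prob_space_PiM prob_space_uniform_count_measure) (auto simp: lessThan_empty_iff)
  then show ?thesis unfolding padic_int_measure_def by (rule prob_space.prob_space_distr) simp
qed

text \<open>For a centre in the unit ball, membership prescribes exactly the first n digits, an
  event of probability p^(-n). For a centre outside, the ball misses the unit ball because its
  radius is at most 1.\<close>

lemma emeasure_padic_int_measure_cball:
  fixes c :: "'p::prime_card padic"
  shows "emeasure padic_int_measure (cball c (real CARD('p) powi (- int n))) =
    (if padic_norm c \<le> 1 then ennreal (real CARD('p) powi (- int n)) else 0)"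
proof -
  let ?D = "digit_measure CARD('p)" let ?r = "real CARD('p) powi (- int n)"
  have r1: "?r \<le> 1" using power_int_increasing[of "- int n" 0 "real CARD('p)"]
    by (simp add: less_imp_le)
  have *: "emeasure padic_int_measure (cball c ?r)
      = emeasure ?D {w \<in> space ?D. padic_norm (padic_of_digits w - c) \<le> ?r}"
    unfolding padic_int_measure_def
    by (subst emeasure_distr) (auto intro!: arg_cong[where f="emeasure ?D"] simp: dist_padic)
  show ?thesis
  proof (cases "padic_norm c \<le> 1")
    case False
    have "padic_norm (padic_of_digits w - c) = padic_norm c" for w
      using padic_norm_add_eq[of "padic_of_digits w" "- c"] padic_norm_of_digits[where 'p='p, of w] False
      by (simp add: padic_norm_minus)
    then show ?thesis using False r1 unfolding * by simp
  next
    case True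
    obtain d where d: "\<forall>i<n. d i < CARD('p)" "padic_norm (c - padic_partial d n) \<le> ?r"
      using padic_digits_exist[OF True] by blast
    have "padic_norm (padic_of_digits w - c) \<le> ?r \<longleftrightarrow> (\<forall>i\<in>{..<n}. w i \<in> {d i})"
      if "w \<in> space ?D" for w
    proof -
      have w: "w i < CARD('p)" for i using that by (auto simp: space_digit_measure)
      let ?x = "padic_of_digits w :: 'p padic"
      note a = padic_of_digits_approx[where 'p='p, of w n]
      show ?thesis
      proof
        assume h: "padic_norm (?x - c) \<le> ?r"
        have e: "padic_partial w n - padic_partial d n = ((?x - c) + (c - padic_partial d n)) - (?x - padic_partial w n)"
          by simp
        have "padic_norm (padic_partial w n - padic_partial d n :: 'p padic) \<le> ?r"
          using padic_norm_diff_le_max[of "(?x - c) + (c - padic_partial d n)" "?x - padic_partial w n"]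
            padic_norm_ultrametric[of "?x - c" "c - padic_partial d n"] h a d(2)
          unfolding e by linarith
        then have "\<forall>i<n. w i = d i" using padic_digits_unique d(1) w by blast
        then show "\<forall>i\<in>{..<n}. w i \<in> {d i}" by simp
      next
        assume "\<forall>i\<in>{..<n}. w i \<in> {d i}"
        then have "padic_partial w n = (padic_partial d n :: 'p padic)" by (simp add: padic_partial_def)
        then show "padic_norm (?x - c) \<le> ?r"
          using padic_norm_diff_le_max[of "?x - padic_partial w n" "c - padic_partial d n"] a d(2) by simp
      qed
    qed
    then have "emeasure padic_int_measure (cball c ?r) = emeasure ?D {w \<in> space ?D. \<forall>i\<in>{..<n}. w i \<in> {d i}}"
      unfolding * by (intro arg_cong[where f="emeasure ?D"]) blast
    also have "\<dots> = (\<Prod>i<n. emeasure (uniform_count_measure {..<CARD('p)}) {d i})"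
    proof -
      interpret product_prob_space "\<lambda>_::nat. uniform_count_measure {..<CARD('p)}" UNIV
        by (intro product_prob_spaceI prob_space_uniform_count_measure) (auto simp: lessThan_empty_iff)
      show ?thesis unfolding digit_measure_def
        by (rule emeasure_PiM_Collect) (use d in \<open>auto simp: sets_uniform_count_measure\<close>)
    qed
    also have "\<dots> = (\<Prod>i<n. ennreal (1 / real CARD('p)))"
      using d(1) by (intro prod.cong refl) (simp add: emeasure_uniform_count_measure ennreal_divide_numeral)
    also have "\<dots> = ennreal ?r"
      by (simp add: ennreal_power power_int_minus power_divide divide_inverse power_inverse)
    finally show ?thesis using True by simp
  qed
qed

section \<open>Existence and uniqueness of Haar measure\<close>

text \<open>One point from each coset of the unit ball. The choice is made from the ball as a set,
  so equal balls receive the same representative.\<close>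

definition padic_reps :: "'p::prime_card padic set" where
  "padic_reps = (\<lambda>B. SOME y. y \<in> B) ` {cball x 1 | x. True}"

lemma padic_reps_unique:
  obtains r where "r \<in> padic_reps" "\<And>s. s \<in> padic_reps \<Longrightarrow> padic_norm (c - s :: 'p::prime_card padic) \<le> 1 \<longleftrightarrow> s = r"
proof -
  have ex: "(SOME y. y \<in> cball x 1) \<in> cball x 1" for x :: "'p padic"
    by (rule someI[of "\<lambda>y. y \<in> cball x 1" x]) simp
  define r where "r = (SOME y. y \<in> cball c 1)"
  have r: "padic_norm (c - r) \<le> 1" using ex[of c] unfolding r_def by (simp add: dist_padic padic_norm_commute)
  have "s = r" if "s \<in> padic_reps" "padic_norm (c - s) \<le> 1" for s
  proof -
    obtain x where x: "s = (SOME y. y \<in> cball x 1)" using \<open>s \<in> padic_reps\<close> unfolding padic_reps_def by blast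
    have "cball s 1 = cball x 1" using ex[of x] x by (intro cball_padic_eq) (simp add: dist_padic)
    moreover have "cball c 1 = cball s 1" by (rule cball_padic_eq) (rule that)
    ultimately show ?thesis using x r_def by simp
  qed
  moreover have "r \<in> padic_reps" unfolding padic_reps_def r_def by blast
  ultimately show thesis using that r by blast
qed

lemma emeasure_cball_children:
  fixes M :: "'p::prime_card padic measure"
  assumes "sets M = sets borel"
  shows "emeasure M (cball c (real CARD('p) powi m)) =
    (\<Sum>i<CARD('p). emeasure M (cball (c + of_nat i * padic_unif m) (real CARD('p) powi (m - 1))))"
  unfolding cball_padic_children(1)[of c m]
  by (rule sum_emeasure[symmetric]) (use cball_padic_children(2) assms in auto)

lemma distr_plus_cball:
  fixes M :: "'p::prime_card padic measure"
  assumes "sets M = sets borel"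
  shows "emeasure (distr M borel (\<lambda>x. a + x)) (cball c r) = emeasure M (cball (c - a) r)"
proof -
  have "(\<lambda>x. a + x) -` cball c r = cball (c - a) r" by (auto simp: dist_padic algebra_simps)
  moreover have "(\<lambda>x. a + x) \<in> borel_measurable M"
    using assms by (simp cong: measurable_cong_sets)
  ultimately show ?thesis
    using sets_eq_imp_space_eq[OF assms] by (simp add: emeasure_distr)
qed

text \<open>A ball is the union of p translates of a ball one step smaller, so its mass is
  multiplied by p at each step. Induction runs in both directions from the unit ball. This gives
  uniqueness of Haar measure as well as its values on balls.\<close>

lemma translation_invariant_cball:
  fixes M :: "'p::prime_card padic measure"
  assumes "sets M = sets borel" "\<And>a. distr M borel (\<lambda>x. a + x) = M" "emeasure M (cball 0 1) = 1"
  shows "emeasure M (cball c (real CARD('p) powi m)) = ennreal (real CARD('p) powi m)"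
proof -
  have tr: "emeasure M (cball c r) = emeasure M (cball 0 r)" for c r
    using distr_plus_cball[OF assms(1), of c c r] assms(2)[of c] by simp
  have step: "emeasure M (cball 0 (real CARD('p) powi m)) = of_nat CARD('p) * emeasure M (cball 0 (real CARD('p) powi (m - 1)))" for m
  proof -
    have "(\<Sum>i<CARD('p). emeasure M (cball (0 + of_nat i * padic_unif m) (real CARD('p) powi (m - 1))))
        = (\<Sum>i<CARD('p). emeasure M (cball 0 (real CARD('p) powi (m - 1))))"
      by (intro sum.cong refl tr)
    then show ?thesis unfolding emeasure_cball_children[OF assms(1), of 0 m] by simp
  qed
  have q: "of_nat CARD('p) = ennreal (real CARD('p))" by (simp add: ennreal_of_nat_eq_real_of_nat)
  have "emeasure M (cball 0 (real CARD('p) powi m)) = ennreal (real CARD('p) powi m)"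
  proof (induction m rule: int_induct[where k=0])
    case base then show ?case using assms(3) by simp
  next
    case (step1 i)
    then show ?case using step[of "i + 1"]
      by (simp add: q power_int_add ennreal_mult[symmetric] mult.commute)
  next
    case (step2 i)
    have "ennreal (real CARD('p)) * ennreal (real CARD('p) powi (i - 1)) = ennreal (real CARD('p) powi i)"
      by (simp add: power_int_diff ennreal_mult[symmetric])
    then have "ennreal (real CARD('p)) * emeasure M (cball 0 (real CARD('p) powi (i - 1)))
        = ennreal (real CARD('p)) * ennreal (real CARD('p) powi (i - 1))"
      using step[of i] step2 by (simp add: q)
    then show ?case by (subst (asm) ennreal_mult_cancel_left) simp
  qed
  then show ?thesis by (simp only: tr[of c])
qed

text \<open>The sum, over the cosets of the unit ball, of the Haar probability moved to the
  representative of the coset.\<close>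

definition padic_haar_construction :: "'p::prime_card padic measure" where
  "padic_haar_construction = distr (count_space padic_reps \<Otimes>\<^sub>M padic_int_measure) borel (\<lambda>(r, x). r + x)"

lemma emeasure_padic_haar_construction:
  "emeasure padic_haar_construction (cball c (real CARD('p) powi (- int n)) :: 'p::prime_card padic set)
    = ennreal (real CARD('p) powi (- int n))"
proof -
  let ?r = "real CARD('p) powi (- int n)" let ?R = "padic_reps :: 'p padic set"
  interpret Z: prob_space "padic_int_measure :: 'p padic measure" by (rule prob_space_padic_int_measure)
  have r1: "?r \<le> 1" using power_int_increasing[of "- int n" 0 "real CARD('p)"] by (simp add: less_imp_le)
  have sZ: "sets (padic_int_measure :: 'p padic measure) = sets borel" by (simp add: padic_int_measure_def)
  have [measurable]: "(\<lambda>(r, x). r + x) \<in> count_space ?R \<Otimes>\<^sub>M (padic_int_measure :: 'p padic measure) \<rightarrow>\<^sub>M borel"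
  proof -
    have "(\<lambda>r. r) \<in> count_space ?R \<rightarrow>\<^sub>M borel" by simp
    from measurable_compose[OF measurable_fst this]
    have [measurable]: "fst \<in> count_space ?R \<Otimes>\<^sub>M (padic_int_measure :: 'p padic measure) \<rightarrow>\<^sub>M borel" .
    have "(\<lambda>x. x :: 'p padic) \<in> padic_int_measure \<rightarrow>\<^sub>M borel" by (rule measurable_ident_sets[OF sZ])
    from measurable_compose[OF measurable_snd this]
    have [measurable]: "snd \<in> count_space ?R \<Otimes>\<^sub>M (padic_int_measure :: 'p padic measure) \<rightarrow>\<^sub>M borel" .
    show ?thesis unfolding case_prod_beta by measurable
  qed
  obtain r where r: "r \<in> ?R" "\<And>s. s \<in> ?R \<Longrightarrow> padic_norm (c - s) \<le> 1 \<longleftrightarrow> s = r"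
    using padic_reps_unique[of c] by metis
  let ?P = "(\<lambda>(r, x). r + x) -` cball c ?r \<inter> space (count_space ?R \<Otimes>\<^sub>M padic_int_measure)"
  have "emeasure padic_haar_construction (cball c ?r) = emeasure (count_space ?R \<Otimes>\<^sub>M padic_int_measure) ?P"
    unfolding padic_haar_construction_def by (rule emeasure_distr) auto
  also have "\<dots> = (\<integral>\<^sup>+s. emeasure padic_int_measure (Pair s -` ?P) \<partial>count_space ?R)"
    by (rule Z.emeasure_pair_measure_alt) measurable
  \<comment> \<open>The radius is at most 1, so the ball lies in a single coset and only its
    representative \<open>r\<close> contributes.\<close>
  also have "\<dots> = (\<integral>\<^sup>+s. ennreal ?r * indicator {r} s \<partial>count_space ?R)"
  proof (rule nn_integral_cong)
    fix s assume s: "s \<in> space (count_space ?R)"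
    have "Pair s -` ?P = cball (c - s) ?r"
      using s sets_eq_imp_space_eq[OF sZ] by (auto simp: space_pair_measure dist_padic algebra_simps)
    then show "emeasure padic_int_measure (Pair s -` ?P) = ennreal ?r * indicator {r} s"
      using r(2)[of s] s by (simp add: emeasure_padic_int_measure_cball indicator_def)
  qed
  also have "\<dots> = ennreal ?r" using r(1) by (simp add: nn_integral_cmult)
  finally show ?thesis .
qed

lemma distr_plus_padic_haar_construction: "distr padic_haar_construction borel (\<lambda>x. a + x) = (padic_haar_construction :: 'p::prime_card padic measure)"
proof -
  have s: "sets padic_haar_construction = sets (borel :: 'p padic measure)" by (simp add: padic_haar_construction_def)
  show ?thesis
    by (rule padic_measure_eqI)
       (use emeasure_padic_haar_construction[where 'p='p, of _ 0] in
         \<open>simp_all add: s distr_plus_cball emeasure_padic_haar_construction\<close>)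
qed

lemma unit_ball_eq_cball: "{x :: 'p::prime_card padic. padic_norm x \<le> 1} = cball 0 1"
  by (auto simp: dist_padic)

text \<open>Resolves the definite description. Any competitor has prescribed masses on all balls by
  \<open>translation_invariant_cball\<close>, and these determine a Borel measure.\<close>

lemma padic_haar_eq: "padic_haar = (padic_haar_construction :: 'p::prime_card padic measure)"
  unfolding padic_haar_def unit_ball_eq_cball
proof (rule the_equality)
  have s: "sets padic_haar_construction = sets (borel :: 'p padic measure)" by (simp add: padic_haar_construction_def)
  show "sets padic_haar_construction = sets (borel :: 'p padic measure) \<and> (\<forall>a :: 'p padic. distr padic_haar_construction borel (\<lambda>x. a + x) = padic_haar_construction) \<and>
      emeasure padic_haar_construction (cball 0 1 :: 'p padic set) = 1"
    using s distr_plus_padic_haar_construction[where 'p='p] emeasure_padic_haar_construction[where 'p='p, of 0 0] by simp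
  fix M :: "'p padic measure"
  assume M: "sets M = sets borel \<and> (\<forall>a. distr M borel (\<lambda>x. a + x) = M) \<and> emeasure M (cball 0 1) = 1"
  have "emeasure M (cball c (real CARD('p) powi m)) = ennreal (real CARD('p) powi m)" for c m
    using M by (intro translation_invariant_cball) auto
  then show "M = padic_haar_construction"
    using M s translation_invariant_cball[of M _ 0]
    by (intro padic_measure_eqI) (simp_all add: emeasure_padic_haar_construction)
qed

lemma sets_padic_haar [simp, measurable_cong]: "sets padic_haar = sets (borel :: 'p::prime_card padic measure)"
  unfolding padic_haar_eq by (simp add: padic_haar_construction_def)

lemma space_padic_haar [simp]: "space padic_haar = (UNIV :: 'p::prime_card padic set)"
  using sets_eq_imp_space_eq[OF sets_padic_haar] by simp

lemma emeasure_padic_haar_cball: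
  "emeasure padic_haar (cball c (real CARD('p) powi m) :: 'p::prime_card padic set) = ennreal (real CARD('p) powi m)"
proof (rule translation_invariant_cball)
  show "distr padic_haar borel (\<lambda>x. a + x) = padic_haar" for a :: "'p padic"
    unfolding padic_haar_eq by (rule distr_plus_padic_haar_construction)
  show "emeasure padic_haar (cball 0 1 :: 'p padic set) = 1"
    using emeasure_padic_haar_construction[where 'p='p, of 0 0] by (simp add: padic_haar_eq)
qed simp

lemma measure_padic_haar_cball:
  "measure padic_haar (cball c (real CARD('p) powi m) :: 'p::prime_card padic set) = real CARD('p) powi m"
  by (simp add: measure_def emeasure_padic_haar_cball)

lemma vimage_times_cball:
  assumes "padic_norm a = 1"
  shows "(\<lambda>x. a * x) -` cball c r = (cball (c / a) r :: 'p::prime_card padic set)"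
proof -
  have "a \<noteq> 0" using assms by auto
  then have "a * x - c = a * (x - c / a)" for x by (simp add: field_simps)
  then show ?thesis using assms by (auto simp: dist_padic padic_norm_mult)
qed

lemma distr_times_cball:
  fixes M :: "'p::prime_card padic measure"
  assumes "sets M = sets borel" "padic_norm a = 1"
  shows "emeasure (distr M borel (\<lambda>x. a * x)) (cball c r) = emeasure M (cball (c / a) r)"
proof -
  have "(\<lambda>x. a * x) \<in> borel_measurable M"
    using assms by (simp cong: measurable_cong_sets)
  then show ?thesis
    using sets_eq_imp_space_eq[OF assms(1)] vimage_times_cball[OF assms(2)] by (simp add: emeasure_distr)
qed

text \<open>The preimage of a ball under a rotation is a ball of the same radius, and Haar mass
  depends only on the radius.\<close>

lemma padic_haar_rotation:
  fixes a :: "'p::prime_card padic"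
  assumes "padic_norm a = 1"
  shows "distr padic_haar borel (\<lambda>x. a * x) = padic_haar"
  by (rule padic_measure_eqI)
     (use assms emeasure_padic_haar_cball[where 'p='p, of _ 0] in \<open>simp_all add: distr_times_cball emeasure_padic_haar_cball\<close>)


section \<open>Rotation invariant probability measures\<close>

definition rotation_invariant_prob :: "'p::prime_card padic measure \<Rightarrow> bool" where
  "rotation_invariant_prob N \<longleftrightarrow> prob_space N \<and> sets N = sets borel \<and>
     (\<forall>a. padic_norm a = 1 \<longrightarrow> distr N borel (\<lambda>x. a * x) = N)"

definition ball_mass :: "'p::prime_card padic measure \<Rightarrow> int \<Rightarrow> real" where
  "ball_mass N m = measure N (cball 0 (real CARD('p) powi m))"

text \<open>For rotation invariant \<open>N\<close> this is the Fourier transform at frequencies of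
  norm p^(1-m): such a character is 1 on the ball of radius p^(m-1), averages to -1/(p-1) on the
  sphere of radius p^m and to 0 on larger spheres.\<close>

definition ball_char :: "'p::prime_card padic measure \<Rightarrow> int \<Rightarrow> real" where
  "ball_char N m = (real CARD('p) * ball_mass N (m - 1) - ball_mass N m) / (real CARD('p) - 1)"

text \<open>The Neumann series of (q - S) / (q - 1), with S the shift. The terms telescope, and
  boundedness of \<open>f\<close> kills the remainder f (m + j) / q^j.\<close>

lemma sums_geometric_resolvent:
  fixes f :: "int \<Rightarrow> real" and q :: real
  assumes q: "1 < q" and bdd: "\<And>m. \<bar>f m\<bar> \<le> C"
  shows "(\<lambda>j. (q - 1) / q ^ Suc j * ((q * f (m + int j) - f (m + int j + 1)) / (q - 1))) sums f m"
proof -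
  have lim: "(\<lambda>j. f (m + int j) / q ^ j) \<longlonglongrightarrow> 0"
  proof (rule Lim_null_comparison)
    show "\<forall>\<^sub>F j in sequentially. norm (f (m + int j) / q ^ j) \<le> C * (1 / q) ^ j"
      using q bdd by (auto simp: power_divide divide_right_mono)
    have "(\<lambda>j. C * (1 / q) ^ j) \<longlonglongrightarrow> C * 0"
      using q by (intro tendsto_mult_left LIMSEQ_power_zero) simp
    then show "(\<lambda>j. C * (1 / q) ^ j) \<longlonglongrightarrow> 0" by simp
  qed
  have "(\<lambda>j. f (m + int j) / q ^ j - f (m + int (Suc j)) / q ^ Suc j) sums (f (m + int 0) / q ^ 0 - 0)"
    by (rule telescope_sums'[OF lim])
  moreover have "f (m + int j) / q ^ j - f (m + int (Suc j)) / q ^ Suc j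
      = (q - 1) / q ^ Suc j * ((q * f (m + int j) - f (m + int j + 1)) / (q - 1))" for j
  proof -
    have "(q - 1) / q ^ Suc j * ((q * f (m + int j) - f (m + int j + 1)) / (q - 1))
        = (q * f (m + int j) - f (m + int j + 1)) / q ^ Suc j" using q by simp
    also have "\<dots> = f (m + int j) / q ^ j - f (m + int (Suc j)) / q ^ Suc j"
      using q by (simp add: diff_divide_distrib add.assoc add.commute[of 1])
    finally show ?thesis by simp
  qed
  ultimately show ?thesis by simp
qed

lemma filterlim_int_diff_at_top: "filterlim (\<lambda>m :: int. m - k) at_top at_top"
  unfolding filterlim_at_top
proof
  fix Z :: int
  show "\<forall>\<^sub>F m in at_top. Z \<le> m - k" by (rule eventually_at_top_linorderI[of "Z + k"]) simp
qed

locale rot_inv =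
  fixes N :: "'p::prime_card padic measure"
  assumes rot_inv: "rotation_invariant_prob N"
begin

sublocale prob_space N
  using rot_inv by (simp add: rotation_invariant_prob_def)

lemma sets_N [simp, measurable_cong]: "sets N = sets borel"
  using rot_inv by (simp add: rotation_invariant_prob_def)

lemma space_N [simp]: "space N = UNIV"
  using sets_eq_imp_space_eq[OF sets_N] by simp

text \<open>Multiplication by c/d is a rotation that takes one centre to the other and preserves
  \<open>N\<close>.\<close>

lemma prob_cball_cong:
  assumes "padic_norm c = padic_norm d"
  shows "prob (cball c r) = prob (cball d r)"
proof (cases "c = 0")
  case True
  then show ?thesis using assms padic_norm_eq_0_iff[of d] by simp
next
  case False
  then have d: "d \<noteq> 0" using assms padic_norm_eq_0_iff[of c] by auto
  have "padic_norm (c / d) = 1" using assms False padic_norm_eq_0_iff[of c] by (simp add: padic_norm_divide)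
  then have "distr N borel (\<lambda>x. c / d * x) = N"
    using rot_inv unfolding rotation_invariant_prob_def by blast
  then have "emeasure N (cball c r) = emeasure N (cball (c / (c / d)) r)"
    using distr_times_cball[OF sets_N, of "c / d" c r] \<open>padic_norm (c / d) = 1\<close> by simp
  also have "c / (c / d) = d" using False d by simp
  finally show ?thesis by (simp add: measure_def)
qed

lemma prob_cball_children:
  "prob (cball c (real CARD('p) powi m)) =
    (\<Sum>i<CARD('p). prob (cball (c + of_nat i * padic_unif m) (real CARD('p) powi (m - 1))))"
  unfolding cball_padic_children(1)[of c m]
  by (rule finite_measure_finite_Union) (use cball_padic_children(2) in auto)

lemma norm_of_nat_times_unif_le: "padic_norm (of_nat i * padic_unif m :: 'p padic) \<le> real CARD('p) powi m"
  using mult_right_mono[OF padic_norm_of_int_le_1[of "int i", where 'p='p], of "real CARD('p) powi m"]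
  by (simp add: padic_norm_mult)

text \<open>In a ball that misses 0 all points have the same norm, so its p children have equal
  mass.\<close>

lemma prob_cball_off_origin:
  assumes "real CARD('p) powi m < padic_norm c"
  shows "prob (cball c (real CARD('p) powi m)) = real CARD('p) * prob (cball c (real CARD('p) powi (m - 1)))"
proof -
  have "padic_norm (c + of_nat i * padic_unif m) = padic_norm c" for i
    using padic_norm_add_eq[of "of_nat i * padic_unif m" c] norm_of_nat_times_unif_le[of i m] assms
    by (simp add: add.commute)
  then have "prob (cball (c + of_nat i * padic_unif m) r) = prob (cball c r)" for i r
    by (rule prob_cball_cong)
  then show ?thesis unfolding prob_cball_children[of c m] by simp
qed

text \<open>The sphere of radius p^m consists of the p - 1 noncentral children of the ball around 0,
  and these have equal mass.\<close>

lemma prob_cball_in_sphere: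
  assumes "padic_norm c = real CARD('p) powi m"
  shows "prob (cball c (real CARD('p) powi (m - 1))) = (ball_mass N m - ball_mass N (m - 1)) / (real CARD('p) - 1)"
proof -
  have "prob (cball (of_nat i * padic_unif m) (real CARD('p) powi (m - 1))) = prob (cball c (real CARD('p) powi (m - 1)))"
    if "i \<in> {1..<CARD('p)}" for i
  proof (rule prob_cball_cong)
    have "\<not> int CARD('p) dvd int i" using that by (auto dest: nat_dvd_not_less)
    then have "padic_norm (of_nat i :: 'p padic) = 1" using padic_norm_of_int_eq_1[of "int i", where 'p='p] by simp
    then show "padic_norm (of_nat i * padic_unif m :: 'p padic) = padic_norm c" using assms by (simp add: padic_norm_mult)
  qed
  then have s: "(\<Sum>i\<in>{1..<CARD('p)}. prob (cball (of_nat i * padic_unif m) (real CARD('p) powi (m - 1))))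
      = (real CARD('p) - 1) * prob (cball c (real CARD('p) powi (m - 1)))"
    by (simp add: of_nat_diff)
  have "{..<CARD('p)} = insert 0 {1..<CARD('p)}" by (auto simp: lessThan_atLeast0)
  then have "ball_mass N m = ball_mass N (m - 1) + (real CARD('p) - 1) * prob (cball c (real CARD('p) powi (m - 1)))"
    using prob_cball_children[of 0 m] s by (simp add: ball_mass_def)
  then show ?thesis using card_prime_gt_1[where 'p='p] by (simp add: field_simps)
qed

lemma ball_mass_eq: "padic_norm c \<le> real CARD('p) powi m \<Longrightarrow> prob (cball c (real CARD('p) powi m)) = ball_mass N m"
  unfolding ball_mass_def by (subst cball_padic_eq[of c 0]) auto

lemma ball_mass_mono: "m \<le> n \<Longrightarrow> ball_mass N m \<le> ball_mass N n"
  unfolding ball_mass_def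
  by (intro finite_measure_mono subset_cball power_int_increasing) (auto intro: less_imp_le)

lemma ball_mass_nonneg: "0 \<le> ball_mass N m" and ball_mass_le_1: "ball_mass N m \<le> 1"
  by (simp_all add: ball_mass_def)

lemma ball_mass_tendsto: "(ball_mass N \<longlongrightarrow> 1) at_top"
proof -
  have U: "(\<Union>n::nat. cball (0::'p padic) (real CARD('p) powi int n)) = UNIV"
  proof (intro equalityI subsetI UNIV_I)
    fix x :: "'p padic"
    obtain n where "padic_norm x \<le> real CARD('p) powi int n" by (rule padic_exists_powi_ge)
    then show "x \<in> (\<Union>n::nat. cball (0::'p padic) (real CARD('p) powi int n))" by (auto simp: dist_padic)
  qed
  have "(\<lambda>n. prob (cball 0 (real CARD('p) powi int n))) \<longlonglongrightarrow> prob (\<Union>n::nat. cball 0 (real CARD('p) powi int n))"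
    by (rule finite_Lim_measure_incseq)
       (auto intro!: incseq_SucI subset_cball power_int_increasing simp: less_imp_le)
  then have L: "(\<lambda>n. ball_mass N (int n)) \<longlonglongrightarrow> 1"
    unfolding U ball_mass_def[symmetric] using prob_space by simp
  show ?thesis
  proof (rule order_tendstoI)
    fix a :: real assume "a < 1"
    then have "\<forall>\<^sub>F n in sequentially. a < ball_mass N (int n)" by (rule order_tendstoD(1)[OF L])
    then obtain n where "a < ball_mass N (int n)" unfolding eventually_sequentially by blast
    then show "\<forall>\<^sub>F m in at_top. a < ball_mass N m"
      using ball_mass_mono[of "int n"] by (intro eventually_at_top_linorderI[of "int n"]) (meson less_le_trans)
  next
    fix a :: real assume "1 < a"
    then have "ball_mass N m < a" for m using ball_mass_le_1[of m] by simp
    then show "\<forall>\<^sub>F m in at_top. ball_mass N m < a" by simp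
  qed
qed

lemma ball_char_eq: "ball_char N m = ball_mass N (m - 1) - (ball_mass N m - ball_mass N (m - 1)) / (real CARD('p) - 1)"
  using card_prime_gt_1[where 'p='p] by (simp add: ball_char_def field_simps)

lemma ball_char_le: "ball_char N m \<le> ball_mass N (m - 1)"
  using ball_mass_mono[of "m - 1" m] card_prime_gt_1[where 'p='p] by (simp add: ball_char_eq)

text \<open>Uses p - 1 \<ge> 1. The resulting bound 2 F (m - 1) - F m \<ge> -1 gives the lower half
  of \<open>abs_ball_char_le_1\<close>.\<close>

lemma ball_char_ge: "ball_mass N (m - 1) - (ball_mass N m - ball_mass N (m - 1)) \<le> ball_char N m"
proof -
  have "(ball_mass N m - ball_mass N (m - 1)) / (real CARD('p) - 1) \<le> (ball_mass N m - ball_mass N (m - 1)) / 1"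
    using ball_mass_mono[of "m - 1" m] prime_ge_2_nat[OF prime_card[where 'a='p]]
    by (intro divide_left_mono) auto
  then show ?thesis by (simp add: ball_char_eq)
qed

lemma abs_ball_char_le_1: "\<bar>ball_char N m\<bar> \<le> 1"
  using ball_char_le[of m] ball_char_ge[of m] ball_mass_le_1[of m] ball_mass_le_1[of "m - 1"]
    ball_mass_nonneg[of m] ball_mass_nonneg[of "m - 1"] by linarith

lemma ball_char_tendsto: "(ball_char N \<longlongrightarrow> 1) at_top"
proof -
  have "((\<lambda>m. ball_mass N (m - 1)) \<longlongrightarrow> 1) at_top"
    by (rule filterlim_compose[OF ball_mass_tendsto]) (rule filterlim_int_diff_at_top)
  then have "((\<lambda>m. (real CARD('p) * ball_mass N (m - 1) - ball_mass N m) / (real CARD('p) - 1)) \<longlongrightarrow>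
      (real CARD('p) * 1 - 1) / (real CARD('p) - 1)) at_top"
    using card_prime_gt_1[where 'p='p] by (intro tendsto_intros ball_mass_tendsto) auto
  then show ?thesis using card_prime_gt_1[where 'p='p] by (simp add: ball_char_def[abs_def])
qed

lemma ball_mass_sums:
  "(\<lambda>j. (real CARD('p) - 1) / real CARD('p) ^ Suc j * ball_char N (m + int j + 1)) sums ball_mass N m"
proof -
  have e: "ball_char N (m + int j + 1)
      = (real CARD('p) * ball_mass N (m + int j) - ball_mass N (m + int j + 1)) / (real CARD('p) - 1)" for j
    by (simp add: ball_char_def)
  show ?thesis
    unfolding e
    by (rule sums_geometric_resolvent[where C=1]) (simp_all add: ball_mass_nonneg ball_mass_le_1)
qed

end

section \<open>Ball masses and symbols determine the measure\<close>

text \<open>Masses of balls around 0 give the masses of the largest balls inside each sphere; every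
  smaller ball off the origin arises from these by repeated division into p equal parts.\<close>

lemma rotation_invariant_prob_eqI:
  fixes M N :: "'p::prime_card padic measure"
  assumes M: "rotation_invariant_prob M" and N: "rotation_invariant_prob N"
    and eq: "\<And>m. ball_mass M m = ball_mass N m"
  shows "M = N"
proof -
  interpret M: rot_inv M by unfold_locales (rule M)
  interpret N: rot_inv N by unfold_locales (rule N)
  have off: "M.prob (cball c (real CARD('p) powi (j - 1 - int n))) = N.prob (cball c (real CARD('p) powi (j - 1 - int n)))"
    if "padic_norm c = real CARD('p) powi j" for c j n
  proof (induction n)
    case 0
    then show ?case using M.prob_cball_in_sphere[OF that] N.prob_cball_in_sphere[OF that] eq by simp
  next
    case (Suc n)
    have "real CARD('p) powi (j - 1 - int n) < padic_norm c"
      unfolding that by (intro power_int_strict_increasing) auto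
    from M.prob_cball_off_origin[OF this] N.prob_cball_off_origin[OF this] Suc
    show ?case by (simp add: algebra_simps)
  qed
  have all: "M.prob (cball c (real CARD('p) powi m)) = N.prob (cball c (real CARD('p) powi m))" for c m
  proof (cases "padic_norm c \<le> real CARD('p) powi m")
    case True
    then show ?thesis using M.ball_mass_eq N.ball_mass_eq eq by simp
  next
    case False
    then have "c \<noteq> 0" by auto
    then obtain j where j: "padic_norm c = real CARD('p) powi j" by (rule padic_norm_values)
    have "m < j"
    proof (rule ccontr)
      assume "\<not> m < j"
      then have "real CARD('p) powi j \<le> real CARD('p) powi m"
        by (intro power_int_increasing) (auto intro: less_imp_le)
      then show False using False j by simp
    qed
    \<comment> \<open>A largest ball in the sphere of radius p^j has radius p^(j-1); the exponent m
      is reached after j - 1 - m subdivisions.\<close>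
    then have "m = j - 1 - int (nat (j - 1 - m))" by simp
    then show ?thesis using off[OF j, of "nat (j - 1 - m)"] by metis
  qed
  show ?thesis
    by (rule padic_measure_eqI) (use all in \<open>auto simp: M.emeasure_eq_measure N.emeasure_eq_measure\<close>)
qed

lemma ball_char_eqI:
  fixes M N :: "'p::prime_card padic measure"
  assumes M: "rotation_invariant_prob M" and N: "rotation_invariant_prob N"
    and eq: "\<And>m. ball_char M m = ball_char N m"
  shows "M = N"
proof (rule rotation_invariant_prob_eqI[OF M N])
  interpret M: rot_inv M by unfold_locales (rule M)
  interpret N: rot_inv N by unfold_locales (rule N)
  show "ball_mass M m = ball_mass N m" for m
    using M.ball_mass_sums[of m] N.ball_mass_sums[of m] by (simp add: eq sums_unique2)
qed

section \<open>Convolution acting on the spaces \<open>ball_space\<close>\<close>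

text \<open>Any centre of the child is also a centre of the parent. The common centre is the normal
  form in which \<open>child_fun\<close> is evaluated.\<close>

lemma padic_balls_childrenE:
  fixes B :: "'p::prime_card padic set"
  assumes "B \<in> padic_balls m" "C \<in> ball_children m B"
  obtains c where "C = cball c (real CARD('p) powi (m - 1))" "B = cball c (real CARD('p) powi m)"
proof -
  have "C \<in> padic_balls (m - 1)" "C \<subseteq> B" using assms(2) unfolding ball_children_def by blast+
  then obtain c where c: "C = cball c (real CARD('p) powi (m - 1))" unfolding padic_balls_def by blast
  obtain b where b: "B = cball b (real CARD('p) powi m)" using assms(1) unfolding padic_balls_def by blast
  have "c \<in> C" unfolding c by simp
  then have "c \<in> B" using \<open>C \<subseteq> B\<close> by blast
  then have "padic_norm (c - b) \<le> real CARD('p) powi m" unfolding b by (simp add: dist_padic)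
  then have "cball c (real CARD('p) powi m) = B" unfolding b by (rule cball_padic_eq)
  then show thesis using that[OF c] by simp
qed

lemma child_fun_cball:
  "child_fun (cball c (real CARD('p) powi m)) (cball c (real CARD('p) powi (m - 1))) x =
    (real CARD('p) * indicator (cball c (real CARD('p) powi (m - 1))) x
      - indicator (cball c (real CARD('p) powi m)) x) / real CARD('p) powi m"
  for c :: "'p::prime_card padic"
proof -
  have e: "1 / real CARD('p) powi (m - 1) = real CARD('p) / real CARD('p) powi m"
    by (simp add: power_int_diff)
  show ?thesis
    unfolding child_fun_def measure_padic_haar_cball e by (simp only: diff_divide_distrib times_divide_eq_left mult_1)
qed

lemma child_fun_measurable [measurable]:
  fixes B :: "'p::prime_card padic set"
  assumes "B \<in> padic_balls m" "C \<in> ball_children m B"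
  shows "child_fun B C \<in> borel_measurable borel"
proof -
  obtain c where c: "C = cball c (real CARD('p) powi (m - 1))" "B = cball c (real CARD('p) powi m)"
    by (rule padic_balls_childrenE[OF assms])
  have "(indicator C :: 'p padic \<Rightarrow> real) \<in> borel_measurable borel"
    "(indicator B :: 'p padic \<Rightarrow> real) \<in> borel_measurable borel"
    unfolding c by (auto intro!: borel_measurable_indicator)
  then show ?thesis unfolding child_fun_def[abs_def] by measurable
qed

lemma child_fun_bounded:
  fixes B :: "'p::prime_card padic set"
  shows "\<bar>child_fun B C x\<bar> \<le> 1 / measure padic_haar C + 1 / measure padic_haar B"
proof -
  have "0 \<le> 1 / measure padic_haar C" "0 \<le> 1 / measure padic_haar B" by simp_all
  then show ?thesis unfolding child_fun_def by (auto simp: indicator_def abs_le_iff)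
qed

text \<open>Convolving an indicator gives the mass of the ball around x - c. For \<open>x\<close> in
  the child both balls contain 0; for \<open>x\<close> elsewhere in the parent the smaller one
  carries 1/(p - 1) of a sphere; farther out the two terms cancel, since a ball off the origin has p
  times the mass of its child.\<close>

lemma (in rot_inv) integral_child_fun:
  assumes B: "B \<in> padic_balls m" "C \<in> ball_children m B"
  shows "(\<integral>y. child_fun B C (x - y) \<partial>N) = ball_char N m * child_fun B C x"
proof -
  let ?q = "real CARD('p)"
  have q: "1 < ?q" by simp
  have qm: "0 < ?q powi m" by simp
  obtain c where c: "C = cball c (?q powi (m - 1))" "B = cball c (?q powi m)"
    by (rule padic_balls_childrenE[OF B])
  have ind: "indicator (cball c r) (x - y) = (indicator (cball (x - c) r) y :: real)" for r y
  proof -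
    have "padic_norm (y - (x - c)) = padic_norm (x - y - c)"
      using padic_norm_minus[of "x - y - c"] by (simp add: algebra_simps)
    then show ?thesis
      by (simp add: indicator_def dist_padic)
  qed
  have int: "(\<integral>y. child_fun B C (x - y) \<partial>N)
      = (?q * prob (cball (x - c) (?q powi (m - 1))) - prob (cball (x - c) (?q powi m))) / ?q powi m"
    unfolding c child_fun_cball ind by (simp add: emeasure_eq_measure)
  have ind2: "indicator (cball c r) x = (if padic_norm (x - c) \<le> r then 1 else 0 :: real)" for r
    by (auto simp: indicator_def dist_padic)
  have le: "?q powi (m - 1) < ?q powi m" by (intro power_int_strict_increasing) auto
  consider "padic_norm (x - c) \<le> ?q powi (m - 1)"
    | "padic_norm (x - c) = ?q powi m"
    | "?q powi m < padic_norm (x - c)"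
    using padic_norm_less_iff[of "x - c" m] by linarith
  then show ?thesis
  proof cases
    case 1
    then have 2: "padic_norm (x - c) \<le> ?q powi m" using le by linarith
    show ?thesis
      unfolding int unfolding c child_fun_cball ind2 ball_mass_eq[OF 1] ball_mass_eq[OF 2]
      using 1 2 q by (simp add: ball_char_def)
  next
    case 2
    then have 3: "padic_norm (x - c) \<le> ?q powi m" "\<not> padic_norm (x - c) \<le> ?q powi (m - 1)" using le by linarith+
    show ?thesis
      unfolding int unfolding c child_fun_cball ind2 prob_cball_in_sphere[OF 2] ball_mass_eq[OF 3(1)]
      using 3 q qm by (simp add: ball_char_def divide_simps) (simp add: algebra_simps)
  next
    case 3
    then have "\<not> padic_norm (x - c) \<le> ?q powi m" "\<not> padic_norm (x - c) \<le> ?q powi (m - 1)" using le by linarith+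
    then show ?thesis
      unfolding int unfolding c child_fun_cball ind2 prob_cball_off_origin[OF 3] by simp
  qed
qed

lemma ball_space_measurable:
  fixes B :: "'p::prime_card padic set"
  assumes "B \<in> padic_balls m" "f \<in> ball_space m B"
  shows "f \<in> borel_measurable borel"
  using assms unfolding ball_space_def
  by (auto intro!: borel_measurable_sum borel_measurable_times child_fun_measurable)

lemma (in rot_inv) integral_ball_space:
  assumes B: "B \<in> padic_balls m" and f: "f \<in> ball_space m B"
  shows "(\<integral>y. f (x - y) \<partial>N) = ball_char N m * f x"
proof -
  obtain S k where S: "finite S" "S \<subseteq> ball_children m B" and fe: "f = (\<lambda>x. \<Sum>C\<in>S. k C * child_fun B C x)"
    using f by (auto simp: ball_space_def)
  have "integrable N (\<lambda>y. child_fun B C (x - y))" if "C \<in> S" for C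
  proof (rule integrable_const_bound)
    show "AE y in N. norm (child_fun B C (x - y)) \<le> 1 / measure padic_haar C + 1 / measure padic_haar B"
      using child_fun_bounded[of B C] by simp
    have [measurable]: "child_fun B C \<in> borel_measurable borel"
      using that S by (intro child_fun_measurable[OF B]) auto
    show "(\<lambda>y. child_fun B C (x - y)) \<in> borel_measurable N" by measurable
  qed
  then have "(\<integral>y. f (x - y) \<partial>N) = (\<Sum>C\<in>S. k C * (\<integral>y. child_fun B C (x - y) \<partial>N))"
    unfolding fe by (subst Bochner_Integration.integral_sum) auto
  also have "\<dots> = (\<Sum>C\<in>S. k C * (ball_char N m * child_fun B C x))"
    using S by (intro sum.cong refl) (auto simp: integral_child_fun[OF B])
  also have "\<dots> = ball_char N m * f x" by (simp add: fe sum_distrib_left mult.left_commute)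
  finally show ?thesis .
qed

text \<open>A test function with a nonzero value at 0, so that an eigenvalue can be read off by
  evaluation at one point.\<close>

definition std_child_fun :: "int \<Rightarrow> 'p::prime_card padic \<Rightarrow> real" where
  "std_child_fun m = child_fun (cball 0 (real CARD('p) powi m)) (cball 0 (real CARD('p) powi (m - 1)))"

lemma std_ball:
  "cball 0 (real CARD('p) powi m) \<in> (padic_balls m :: 'p::prime_card padic set set)"
  "cball 0 (real CARD('p) powi (m - 1)) \<in> ball_children m (cball (0 :: 'p::prime_card padic) (real CARD('p) powi m))"
proof -
  show "cball 0 (real CARD('p) powi m) \<in> (padic_balls m :: 'p padic set set)"
    unfolding padic_balls_def by blast
  have "cball (0 :: 'p padic) (real CARD('p) powi (m - 1)) \<subseteq> cball 0 (real CARD('p) powi m)"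
    by (intro subset_cball power_int_increasing) (auto intro: less_imp_le)
  then show "cball 0 (real CARD('p) powi (m - 1)) \<in> ball_children m (cball (0 :: 'p padic) (real CARD('p) powi m))"
    unfolding ball_children_def padic_balls_def by blast
qed

lemma std_child_fun_in_ball_space:
  "(std_child_fun m :: 'p::prime_card padic \<Rightarrow> real) \<in> ball_space m (cball 0 (real CARD('p) powi m))"
  unfolding ball_space_def std_child_fun_def
  by (intro CollectI exI[of _ "{cball 0 (real CARD('p) powi (m - 1))}"] exI[of _ "\<lambda>_. 1"]) (use std_ball in auto)

lemma std_child_fun_0: "std_child_fun m (0 :: 'p::prime_card padic) = (real CARD('p) - 1) / real CARD('p) powi m"
  unfolding std_child_fun_def child_fun_cball by simp

lemma std_child_fun_0_neq: "std_child_fun m (0 :: 'p::prime_card padic) \<noteq> 0"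
  unfolding std_child_fun_0 by simp

text \<open>Rotations are additive, hence commute with the sum map. Fubini lets the two measures act
  on a test function one after the other, so their eigenvalues multiply; evaluation at 0 extracts
  the product.\<close>

lemma rotation_invariant_convolution:
  fixes M N :: "'p::prime_card padic measure"
  assumes M: "rotation_invariant_prob M" and N: "rotation_invariant_prob N"
  shows "rotation_invariant_prob (padic_convolution M N)"
    and "ball_char (padic_convolution M N) m = ball_char M m * ball_char N m"
proof -
  interpret M: rot_inv M by unfold_locales (rule M)
  interpret N: rot_inv N by unfold_locales (rule N)
  interpret MN: pair_prob_space M N ..
  have [measurable]: "(\<lambda>(x, y). x + y) \<in> borel_measurable (M \<Otimes>\<^sub>M N)" by measurable
  have ri: "distr (padic_convolution M N) borel (\<lambda>x. a * x) = padic_convolution M N"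
    if a: "padic_norm a = 1" for a
  proof -
    have Ma: "distr M borel (\<lambda>x. a * x) = M" and Na: "distr N borel (\<lambda>x. a * x) = N"
      using M N a unfolding rotation_invariant_prob_def by auto
    have "padic_convolution M N = distr (distr M borel (\<lambda>x. a * x) \<Otimes>\<^sub>M distr N borel (\<lambda>x. a * x)) borel (\<lambda>(x, y). x + y)"
      by (simp add: padic_convolution_def Ma Na)
    also have "distr M borel (\<lambda>x. a * x) \<Otimes>\<^sub>M distr N borel (\<lambda>x. a * x)
        = distr (M \<Otimes>\<^sub>M N) (borel \<Otimes>\<^sub>M borel) (\<lambda>(x, y). (a * x, a * y))"
      by (rule pair_measure_distr) (simp_all add: Na N.sigma_finite_measure_axioms)
    also have "distr \<dots> borel (\<lambda>(x, y). x + y) = distr (M \<Otimes>\<^sub>M N) borel (\<lambda>z. a * (case z of (x, y) \<Rightarrow> x + y))"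
      by (subst distr_distr) (auto intro!: distr_cong simp: algebra_simps)
    also have "\<dots> = distr (padic_convolution M N) borel (\<lambda>x. a * x)"
      unfolding padic_convolution_def by (subst distr_distr) (auto intro!: distr_cong simp: comp_def)
    finally show ?thesis by simp
  qed
  show C: "rotation_invariant_prob (padic_convolution M N)"
    unfolding rotation_invariant_prob_def using ri
    by (auto simp: padic_convolution_def intro!: MN.prob_space_distr)
  interpret C: rot_inv "padic_convolution M N" by unfold_locales (rule C)
  let ?f = "std_child_fun m :: 'p padic \<Rightarrow> real"
  have [measurable]: "?f \<in> borel_measurable borel"
    by (rule ball_space_measurable[OF std_ball(1) std_child_fun_in_ball_space])
  have bd: "\<bar>?f x\<bar> \<le> 1 / measure padic_haar (cball 0 (real CARD('p) powi (m - 1)) :: 'p padic set)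
      + 1 / measure padic_haar (cball 0 (real CARD('p) powi m) :: 'p padic set)" for x
    unfolding std_child_fun_def by (rule child_fun_bounded)
  have "ball_char (padic_convolution M N) m * ?f 0 = (\<integral>z. ?f (0 - z) \<partial>padic_convolution M N)"
    by (rule C.integral_ball_space[OF std_ball(1) std_child_fun_in_ball_space, symmetric])
  also have "\<dots> = (\<integral>z. ?f (0 - (case z of (x, y) \<Rightarrow> x + y)) \<partial>(M \<Otimes>\<^sub>M N))"
    unfolding padic_convolution_def by (subst integral_distr) auto
  also have "\<dots> = (\<integral>z. (case z of (x, y) \<Rightarrow> ?f ((0 - x) - y)) \<partial>(M \<Otimes>\<^sub>M N))"
    by (intro Bochner_Integration.integral_cong) (auto simp: algebra_simps)
  also have "\<dots> = (\<integral>x. (\<integral>y. ?f ((0 - x) - y) \<partial>N) \<partial>M)"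
  proof -
    have "integrable (M \<Otimes>\<^sub>M N) (\<lambda>z. case z of (x, y) \<Rightarrow> ?f ((0 - x) - y))"
      by (rule MN.integrable_const_bound[OF AE_I2]) (use bd in \<open>auto split: prod.split\<close>)
    from MN.integral_fst'[OF this] show ?thesis by simp
  qed
  also have "\<dots> = (\<integral>x. ball_char N m * ?f (0 - x) \<partial>M)"
    by (subst N.integral_ball_space[OF std_ball(1) std_child_fun_in_ball_space]) simp
  also have "\<dots> = ball_char N m * (ball_char M m * ?f 0)"
    by (subst Bochner_Integration.integral_mult_right_zero)
       (subst M.integral_ball_space[OF std_ball(1) std_child_fun_in_ball_space], simp)
  finally show "ball_char (padic_convolution M N) m = ball_char M m * ball_char N m"
    using std_child_fun_0_neq[of m, where 'p='p] by simp
qed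


section \<open>Rotation invariant measures with prescribed ball masses\<close>

lemma padic_norm_measurable [measurable]:
  "padic_norm \<in> borel_measurable (borel :: 'p::prime_card padic measure)"
proof -
  have e: "padic_norm = (\<lambda>x :: 'p padic. dist 0 x)" by (rule ext) (simp add: dist_padic)
  show ?thesis unfolding e by (rule borel_measurable_dist) simp_all
qed

lemma padic_sphere_borel [measurable]: "{x :: 'p::prime_card padic. padic_norm x = 1} \<in> sets borel"
  using measurable_sets_borel[OF padic_norm_measurable, of "{1}"] by (simp add: vimage_def)

section \<open>The uniform law on the unit sphere\<close>

definition padic_sphere_measure :: "'p::prime_card padic measure" where
  "padic_sphere_measure = uniform_measure padic_haar {x. padic_norm x = 1}"

lemma sets_padic_sphere_measure [simp, measurable_cong]:
  "sets padic_sphere_measure = sets (borel :: 'p::prime_card padic measure)"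
  by (simp add: padic_sphere_measure_def)

lemma space_padic_sphere_measure [simp]: "space padic_sphere_measure = (UNIV :: 'p::prime_card padic set)"
  by (simp add: padic_sphere_measure_def)

text \<open>The sphere contains the ball of radius 1/p around 1 and is contained in the unit
  ball.\<close>

lemma emeasure_padic_sphere:
  "emeasure padic_haar {x :: 'p::prime_card padic. padic_norm x = 1} \<noteq> 0"
  "emeasure padic_haar {x :: 'p::prime_card padic. padic_norm x = 1} \<noteq> \<infinity>"
proof -
  let ?S = "{x :: 'p padic. padic_norm x = 1}"
  have S: "?S \<in> sets padic_haar" by simp
  have "?S \<subseteq> cball 0 (real CARD('p) powi 0)" by (auto simp: dist_padic)
  then have "emeasure padic_haar ?S \<le> emeasure padic_haar (cball (0 :: 'p padic) (real CARD('p) powi 0))"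
    by (intro emeasure_mono) auto
  then show "emeasure padic_haar ?S \<noteq> \<infinity>"
    unfolding emeasure_padic_haar_cball by (auto simp: top_unique)
  have "padic_norm (x - 1) \<le> real CARD('p) powi - 1 \<Longrightarrow> padic_norm x = 1" for x :: "'p padic"
    using padic_norm_less_iff[of "x - 1" 0] padic_norm_add_eq[of "x - 1" 1] by simp
  then have "cball 1 (real CARD('p) powi - 1) \<subseteq> ?S" by (auto simp: dist_padic)
  then have "emeasure padic_haar (cball (1 :: 'p padic) (real CARD('p) powi - 1)) \<le> emeasure padic_haar ?S"
    using S by (intro emeasure_mono)
  moreover have "0 < emeasure padic_haar (cball (1 :: 'p padic) (real CARD('p) powi - 1))"
    unfolding emeasure_padic_haar_cball by simp
  ultimately show "emeasure padic_haar ?S \<noteq> 0" by auto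
qed

lemma prob_space_padic_sphere_measure: "prob_space (padic_sphere_measure :: 'p::prime_card padic measure)"
  unfolding padic_sphere_measure_def using emeasure_padic_sphere by (rule prob_space_uniform_measure)

lemma AE_padic_sphere_measure: "AE x in padic_sphere_measure. padic_norm (x :: 'p::prime_card padic) = 1"
  unfolding padic_sphere_measure_def by (rule AE_uniform_measureI) simp_all

text \<open>The sphere is stable under rotations, so the invariance of Haar measure restricts to
  it.\<close>

lemma padic_sphere_measure_rotation:
  fixes a :: "'p::prime_card padic"
  assumes a: "padic_norm a = 1"
  shows "distr padic_sphere_measure borel (\<lambda>x. a * x) = padic_sphere_measure"
proof (rule measure_eqI)
  fix A assume "A \<in> sets (distr padic_sphere_measure borel (\<lambda>x. a * x))"
  then have [measurable]: "A \<in> sets borel" by simp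
  let ?S = "{x :: 'p padic. padic_norm x = 1}"
  have "(\<lambda>x. a * x) \<in> borel_measurable borel" by measurable
  from measurable_sets[OF this, of A] have [measurable]: "(\<lambda>x. a * x) -` A \<in> sets borel" by simp
  have e: "?S \<inter> (\<lambda>x. a * x) -` A = (\<lambda>x. a * x) -` (?S \<inter> A)" using a by (auto simp: padic_norm_mult)
  have "emeasure padic_haar ((\<lambda>x. a * x) -` (?S \<inter> A)) = emeasure (distr padic_haar borel (\<lambda>x. a * x)) (?S \<inter> A)"
    by (subst emeasure_distr) auto
  also have "\<dots> = emeasure padic_haar (?S \<inter> A)" by (simp add: padic_haar_rotation[OF a])
  finally show "emeasure (distr padic_sphere_measure borel (\<lambda>x. a * x)) A = emeasure padic_sphere_measure A"
    unfolding padic_sphere_measure_def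
    by (subst emeasure_distr) (auto simp: emeasure_uniform_measure e)
qed simp

section \<open>Distribution functions on the value group and their quantiles\<close>

text \<open>The limit at minus infinity is left free: it is the mass of the atom at 0.\<close>

definition ball_cdf :: "(int \<Rightarrow> real) \<Rightarrow> bool" where
  "ball_cdf F \<longleftrightarrow> mono F \<and> (\<forall>m. 0 \<le> F m) \<and> (F \<longlongrightarrow> 1) at_top"

lemma ball_cdf_le_1:
  assumes "ball_cdf F" shows "F m \<le> 1"
proof (rule tendsto_lowerbound[of F 1 at_top])
  show "\<forall>\<^sub>F n in at_top. F m \<le> F n"
    using assms by (intro eventually_at_top_linorderI[of m]) (auto simp: ball_cdf_def mono_def)
qed (use assms in \<open>auto simp: ball_cdf_def\<close>)

text \<open>For u < 1 the value \<open>None\<close> occurs exactly when \<open>u\<close> is at most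
  every value of \<open>F\<close>, that is, inside the atom at 0; \<open>quantile\<close>
  accordingly turns it into 0.\<close>

definition quantile_index :: "(int \<Rightarrow> real) \<Rightarrow> real \<Rightarrow> int option" where
  "quantile_index F u =
    (if \<exists>m. F (m - 1) < u \<and> u \<le> F m then Some (SOME m. F (m - 1) < u \<and> u \<le> F m) else None)"

definition quantile :: "(int \<Rightarrow> real) \<Rightarrow> real \<Rightarrow> 'p::prime_card padic" where
  "quantile F u = (case quantile_index F u of None \<Rightarrow> 0 | Some m \<Rightarrow> padic_unif m)"

lemma quantile_index_eq_Some_iff:
  assumes "mono F"
  shows "quantile_index F u = Some m \<longleftrightarrow> F (m - 1) < u \<and> u \<le> F m"
proof -
  have uniq: "m = n" if mn: "F (m - 1) < u \<and> u \<le> F m" "F (n - 1) < u \<and> u \<le> F n" for m n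
  proof (rule ccontr)
    assume "m \<noteq> n"
    then have "m \<le> n - 1 \<or> n \<le> m - 1" by linarith
    then have "F m \<le> F (n - 1) \<or> F n \<le> F (m - 1)" using assms by (auto simp: mono_def)
    then show False using mn by linarith
  qed
  show ?thesis
  proof
    assume *: "quantile_index F u = Some m"
    then have ex: "\<exists>m. F (m - 1) < u \<and> u \<le> F m" unfolding quantile_index_def by (meson option.distinct(1))
    then have "m = (SOME m. F (m - 1) < u \<and> u \<le> F m)" using * by (simp add: quantile_index_def)
    then show "F (m - 1) < u \<and> u \<le> F m" using someI_ex[OF ex] by blast
  next
    assume *: "F (m - 1) < u \<and> u \<le> F m"
    then have "(SOME m. F (m - 1) < u \<and> u \<le> F m) = m"
      by (intro some_equality) (use uniq in blast)+
    then show "quantile_index F u = Some m" using * unfolding quantile_index_def by auto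
  qed
qed

lemma quantile_eq:
  assumes "mono F" "F (m - 1) < u" "u \<le> F m"
  shows "quantile F u = (padic_unif m :: 'p::prime_card padic)"
  using quantile_index_eq_Some_iff[OF assms(1), of u m] assms by (simp add: quantile_def)

lemma quantile_cases:
  assumes F: "ball_cdf F" and u: "u < 1"
  obtains m where "F (m - 1) < u" "u \<le> F m"
  | "\<And>m. u \<le> F m" "quantile F u = (0 :: 'p::prime_card padic)"
proof (cases "\<exists>m. F (m - 1) < u \<and> u \<le> F m")
  case True
  then show ?thesis using that by blast
next
  case False
  have m: "mono F" using F by (simp add: ball_cdf_def)
  have "\<forall>\<^sub>F m in at_top. u < F m" using F u by (intro order_tendstoD(1)) (auto simp: ball_cdf_def)
  then obtain M where M: "u < F M" by (metis eventually_at_top_linorder order_refl)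
  \<comment> \<open>Downwards from \<open>M\<close>: if u \<le> F i but F (i - 1) < u, the index i
    would catch \<open>u\<close>.\<close>
  have "u \<le> F k" for k
  proof (cases "k \<le> M")
    case True
    then show ?thesis
    proof (induction k rule: int_le_induct)
      case base then show ?case using M by simp
    next
      case (step i) then show ?case using False by (meson not_less)
    qed
  next
    case k: False
    then show ?thesis using M m by (meson less_imp_le mono_def not_le order_trans)
  qed
  moreover have "quantile F u = (0 :: 'p padic)" 
    unfolding quantile_def quantile_index_def if_not_P[OF False] by simp
  ultimately show ?thesis using that(2) by blast
qed

lemma powi_card_le_iff: "real CARD('p::prime_card) powi m \<le> real CARD('p) powi n \<longleftrightarrow> m \<le> n"
  using power_int_strict_increasing[of n m "real CARD('p)"] power_int_increasing[of m n "real CARD('p)"]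
  by (metis card_prime_gt_1 less_imp_le not_le)

text \<open>The Galois connection between a distribution function and its quantile function; it
  turns membership in a ball into an event about the uniform variable.\<close>

lemma norm_quantile_le_iff:
  assumes F: "ball_cdf F" and u: "u < 1"
  shows "padic_norm (quantile F u :: 'p::prime_card padic) \<le> real CARD('p) powi m \<longleftrightarrow> u \<le> F m"
proof (rule quantile_cases[OF F u, where 'p='p])
  fix k assume 1: "F (k - 1) < u" "u \<le> F k"
  have mono: "mono F" using F by (simp add: ball_cdf_def)
  have "k \<le> m \<longleftrightarrow> u \<le> F m"
  proof
    assume "k \<le> m" then show "u \<le> F m" using 1 monoD[OF mono, of k m] by simp
  next
    assume "u \<le> F m"
    show "k \<le> m"
    proof (rule ccontr)
      assume "\<not> k \<le> m"
      then have "F m \<le> F (k - 1)" using monoD[OF mono, of m "k - 1"] by simp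
      then show False using 1 \<open>u \<le> F m\<close> by linarith
    qed
  qed
  then show ?thesis using quantile_eq[OF mono 1, where 'p='p] by (simp add: powi_card_le_iff)
next
  assume 2: "\<And>m. u \<le> F m" "quantile F u = (0 :: 'p padic)"
  then show ?thesis by simp
qed

lemma quantile_index_measurable:
  assumes "mono F"
  shows "quantile_index F \<in> borel \<rightarrow>\<^sub>M count_space UNIV"
proof (rule measurable_count_space_eq2_countable[THEN iffD2])
  have S: "quantile_index F -` {Some m} \<inter> space borel = {u. F (m - 1) < u \<and> u \<le> F m}" for m
    using quantile_index_eq_Some_iff[OF assms] by auto
  have N: "quantile_index F -` {None} \<inter> space borel = {u. \<forall>m. \<not> (F (m - 1) < u \<and> u \<le> F m)}"
    by (auto simp: quantile_index_def split: if_splits)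
  have "quantile_index F -` {a} \<inter> space borel \<in> sets borel" for a
    by (cases a) (simp_all only: S N, measurable)
  then show "quantile_index F \<in> space borel \<rightarrow> UNIV \<and> (\<forall>a\<in>UNIV. quantile_index F -` {a} \<inter> space borel \<in> sets borel)"
    by simp
qed

lemma quantile_measurable:
  assumes "mono F"
  shows "quantile F \<in> borel_measurable borel"
  unfolding quantile_def[abs_def]
  by (rule measurable_compose[OF quantile_index_measurable[OF assms]]) simp

text \<open>Off the range of \<open>F\<close> the inequalities for \<open>u\<close> are strict and
  pass to \<open>G n\<close>. If \<open>u\<close> lies in a gap of \<open>F\<close>, the quantiles
  are eventually equal; if it lies below all values, the quantile of \<open>G n\<close> eventually
  enters every ball around 0.\<close>

lemma quantile_tendsto:
  assumes F: "ball_cdf F" and G: "\<And>n. ball_cdf (G n)" and lim: "\<And>m. (\<lambda>n. G n m) \<longlonglongrightarrow> F m"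
    and u: "u < 1" "u \<notin> range F"
  shows "(\<lambda>n. quantile (G n) u) \<longlonglongrightarrow> (quantile F u :: 'p::prime_card padic)"
proof (rule quantile_cases[OF F u(1), where 'p='p])
  fix m assume 1: "F (m - 1) < u" "u \<le> F m"
  have mono: "mono F" "\<And>n. mono (G n)" using F G by (auto simp: ball_cdf_def)
  have "u < F m" using 1 u(2) by (metis order_le_less rangeI)
  have "\<forall>\<^sub>F n in sequentially. G n (m - 1) < u \<and> u < G n m"
    using order_tendstoD(2)[OF lim 1(1)] order_tendstoD(1)[OF lim \<open>u < F m\<close>] by (rule eventually_conj)
  then have "\<forall>\<^sub>F n in sequentially. quantile (G n) u = (quantile F u :: 'p padic)"
    by eventually_elim (use quantile_eq[OF mono(1) 1, where 'p='p] in \<open>auto intro!: quantile_eq mono\<close>)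
  then show ?thesis by (rule tendsto_eventually)
next
  assume 2: "\<And>m. u \<le> F m" "quantile F u = (0 :: 'p padic)"
  show ?thesis
  proof (rule tendstoI)
    fix e :: real assume "0 < e"
    then obtain k where k: "real CARD('p) powi (- int k) < e" by (rule padic_exists_powi_less)
    have "u < F (- int k)" using 2(1)[of "- int k"] u(2) by (metis order_le_less rangeI)
    then have "\<forall>\<^sub>F n in sequentially. u < G n (- int k)" by (rule order_tendstoD(1)[OF lim])
    then show "\<forall>\<^sub>F n in sequentially. dist (quantile (G n) u) (quantile F u :: 'p padic) < e"
    proof eventually_elim
      case (elim n)
      then have "padic_norm (quantile (G n) u :: 'p padic) \<le> real CARD('p) powi (- int k)"
        using norm_quantile_le_iff[OF G u(1), where 'p='p] by simp
      then show ?case using k 2(2) by (simp add: dist_padic padic_norm_minus)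
    qed
  qed
qed

definition unit_uniform :: "real measure" where
  "unit_uniform = uniform_measure lborel {0<..<1}"

lemma sets_unit_uniform [simp, measurable_cong]: "sets unit_uniform = sets borel"
  and space_unit_uniform [simp]: "space unit_uniform = UNIV"
  by (simp_all add: unit_uniform_def)

lemma prob_space_unit_uniform: "prob_space unit_uniform"
  unfolding unit_uniform_def by (rule prob_space_uniform_measure) simp_all

lemma AE_unit_uniform:
  assumes "countable A"
  shows "AE u in unit_uniform. u < 1 \<and> u \<notin> A"
  unfolding unit_uniform_def
proof (rule AE_uniform_measureI)
  have "AE u in lborel. u \<notin> A" using countable_imp_null_set_lborel[OF assms] by (rule AE_not_in)
  then show "AE u in lborel. u \<in> {0<..<1} \<longrightarrow> u < 1 \<and> u \<notin> A" by eventually_elim auto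
qed simp

lemma measure_unit_uniform:
  assumes "0 \<le> a" "a \<le> 1"
  shows "measure unit_uniform {..a} = a"
proof -
  have "measure unit_uniform {..a} = measure lborel ({0<..<1} \<inter> {..a}) / measure lborel {0<..<1::real}"
    unfolding unit_uniform_def by (rule measure_uniform_measure) simp_all
  also have "{0<..<1} \<inter> {..a} = (if a = 1 then {0<..<1} else {0<..a})" using assms by auto
  also have "measure lborel \<dots> = a" using assms by simp
  finally show ?thesis by simp
qed

section \<open>The radial law with given ball masses\<close>

definition radial_prob :: "(int \<Rightarrow> real) \<Rightarrow> 'p::prime_card padic measure" where
  "radial_prob F = distr (unit_uniform \<Otimes>\<^sub>M padic_sphere_measure) borel (\<lambda>(u, x). quantile F u * x)"

context
  fixes F :: "int \<Rightarrow> real"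
  assumes F: "ball_cdf F"
begin

lemma mono_cdf: "mono F"
  using F by (simp add: ball_cdf_def)

lemma radial_map_measurable [measurable]:
  "(\<lambda>(u, x). quantile F u * x :: 'p::prime_card padic) \<in> borel_measurable (unit_uniform \<Otimes>\<^sub>M padic_sphere_measure)"
proof -
  have [measurable]: "(quantile F :: real \<Rightarrow> 'p padic) \<in> borel_measurable borel" by (rule quantile_measurable[OF mono_cdf])
  show ?thesis by measurable
qed

lemma prob_space_radial_prob: "prob_space (radial_prob F :: 'p::prime_card padic measure)"
proof -
  interpret U: prob_space unit_uniform by (rule prob_space_unit_uniform)
  interpret S: prob_space "padic_sphere_measure :: 'p padic measure" by (rule prob_space_padic_sphere_measure)
  interpret P: pair_prob_space unit_uniform "padic_sphere_measure :: 'p padic measure" ..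
  show ?thesis unfolding radial_prob_def by (rule P.prob_space_distr) (rule radial_map_measurable)
qed

lemma integral_radial_prob:
  fixes f :: "'p::prime_card padic \<Rightarrow> real"
  assumes [measurable]: "f \<in> borel_measurable borel" and bd: "\<And>x. \<bar>f x\<bar> \<le> C"
  shows "(\<integral>x. f x \<partial>radial_prob F) = (\<integral>u. (\<integral>x. f (quantile F u * x) \<partial>padic_sphere_measure) \<partial>unit_uniform)"
proof -
  interpret U: prob_space unit_uniform by (rule prob_space_unit_uniform)
  interpret S: prob_space "padic_sphere_measure :: 'p padic measure" by (rule prob_space_padic_sphere_measure)
  interpret P: pair_prob_space unit_uniform "padic_sphere_measure :: 'p padic measure" ..
  have [measurable]: "(quantile F :: real \<Rightarrow> 'p padic) \<in> borel_measurable borel" by (rule quantile_measurable[OF mono_cdf])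
  have "(\<integral>x. f x \<partial>radial_prob F) = (\<integral>z. f (case z of (u, x) \<Rightarrow> quantile F u * x) \<partial>(unit_uniform \<Otimes>\<^sub>M padic_sphere_measure))"
    unfolding radial_prob_def by (rule integral_distr[OF radial_map_measurable]) simp
  also have "\<dots> = (\<integral>u. (\<integral>x. f (case (u, x) of (u, x) \<Rightarrow> quantile F u * x) \<partial>padic_sphere_measure) \<partial>unit_uniform)"
    by (rule P.integral_fst'[symmetric], rule P.integrable_const_bound[OF AE_I2]) (use bd in auto)
  finally show ?thesis by simp
qed

text \<open>Almost surely the second factor has norm 1, so by \<open>norm_quantile_le_iff\<close>
  the event is that the uniform variable is at most F m.\<close>

lemma ball_mass_radial_prob: "ball_mass (radial_prob F :: 'p::prime_card padic measure) m = F m"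
proof -
  interpret U: prob_space unit_uniform by (rule prob_space_unit_uniform)
  interpret S: prob_space "padic_sphere_measure :: 'p padic measure" by (rule prob_space_padic_sphere_measure)
  have [measurable]: "(quantile F :: real \<Rightarrow> 'p padic) \<in> borel_measurable borel" by (rule quantile_measurable[OF mono_cdf])
  let ?B = "cball 0 (real CARD('p) powi m) :: 'p padic set"
  have [measurable]: "?B \<in> sets borel" by simp
  have "ball_mass (radial_prob F :: 'p padic measure) m = (\<integral>x. indicator ?B x \<partial>radial_prob F)"
    unfolding ball_mass_def by (simp add: radial_prob_def)
  also have "\<dots> = (\<integral>u. (\<integral>x. indicator ?B (quantile F u * x) \<partial>padic_sphere_measure) \<partial>unit_uniform)"
    by (rule integral_radial_prob[where C=1]) (auto simp: indicator_def)
  also have "\<dots> = (\<integral>u. indicator {..F m} u \<partial>unit_uniform)"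
  proof (rule integral_cong_AE)
    show "AE u in unit_uniform. (\<integral>x. indicator ?B (quantile F u * x) \<partial>padic_sphere_measure) = indicat_real {..F m} u"
      using AE_unit_uniform[OF countable_empty]
    proof eventually_elim
      case (elim u)
      have "(\<integral>x. indicator ?B (quantile F u * x) \<partial>padic_sphere_measure)
          = (\<integral>x. indicat_real {..F m} u \<partial>(padic_sphere_measure :: 'p padic measure))"
      proof (rule integral_cong_AE)
        show "AE x in padic_sphere_measure. indicator ?B (quantile F u * x) = indicat_real {..F m} u"
          using AE_padic_sphere_measure
        proof eventually_elim
          case (elim x)
          then show ?case using norm_quantile_le_iff[OF F, of u m, where 'p='p] \<open>u < 1 \<and> u \<notin> {}\<close>
            by (auto simp: indicator_def dist_padic padic_norm_mult)
        qed
      qed simp_all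
      then show ?case using S.prob_space by simp
    qed
  qed measurable
  also have "\<dots> = F m"
    using measure_unit_uniform[of "F m"] F ball_cdf_le_1[OF F] by (simp add: ball_cdf_def)
  finally show ?thesis .
qed

text \<open>A rotation can be moved onto the spherical factor, whose law it preserves.\<close>

lemma rotation_invariant_radial_prob: "rotation_invariant_prob (radial_prob F :: 'p::prime_card padic measure)"
proof -
  let ?S = "padic_sphere_measure :: 'p padic measure"
  interpret S: prob_space ?S by (rule prob_space_padic_sphere_measure)
  have [measurable]: "(quantile F :: real \<Rightarrow> 'p padic) \<in> borel_measurable borel" by (rule quantile_measurable[OF mono_cdf])
  have "distr (radial_prob F) borel (\<lambda>x. a * x) = radial_prob F" if a: "padic_norm a = 1" for a :: "'p padic"
  proof -
    have Ua: "distr unit_uniform borel (\<lambda>u. u) = unit_uniform" by (rule distr_id2) simp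
    have Sa: "distr ?S borel (\<lambda>x. a * x) = ?S" by (rule padic_sphere_measure_rotation[OF a])
    let ?f = "\<lambda>(u, x). quantile F u * x :: 'p padic" and ?g = "\<lambda>(u, x). (u, a * x)"
    have pair: "unit_uniform \<Otimes>\<^sub>M ?S = distr (unit_uniform \<Otimes>\<^sub>M ?S) (borel \<Otimes>\<^sub>M borel) ?g"
      using pair_measure_distr[of "\<lambda>u. u" unit_uniform borel "\<lambda>x. a * x" ?S borel] S.sigma_finite_measure_axioms
      by (simp add: Ua Sa)
    have 1: "radial_prob F = distr (distr (unit_uniform \<Otimes>\<^sub>M ?S) (borel \<Otimes>\<^sub>M borel) ?g) borel ?f"
      unfolding radial_prob_def pair[symmetric] ..
    have 2: "distr (distr (unit_uniform \<Otimes>\<^sub>M ?S) (borel \<Otimes>\<^sub>M borel) ?g) borel ?f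
        = distr (unit_uniform \<Otimes>\<^sub>M ?S) borel (?f \<circ> ?g)"
      by (rule distr_distr) measurable
    have 3: "?f \<circ> ?g = (\<lambda>x. a * x) \<circ> ?f"
      by (auto simp: fun_eq_iff mult.left_commute)
    have 4: "distr (radial_prob F) borel (\<lambda>x. a * x) = distr (unit_uniform \<Otimes>\<^sub>M ?S) borel ((\<lambda>x. a * x) \<circ> ?f)"
      unfolding radial_prob_def by (rule distr_distr) measurable
    show ?thesis unfolding 4 3[symmetric] 2[symmetric] by (rule 1[symmetric])
  qed
  then show ?thesis
    using prob_space_radial_prob unfolding rotation_invariant_prob_def by (auto simp: radial_prob_def)
qed

end

lemma ball_char_radial_prob:
  assumes "ball_cdf F"
  shows "ball_char (radial_prob F :: 'p::prime_card padic measure) m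
    = (real CARD('p) * F (m - 1) - F m) / (real CARD('p) - 1)"
  by (simp add: ball_char_def ball_mass_radial_prob[OF assms])

text \<open>A Skorokhod coupling: all laws are images of the same pair of variables, so weak
  convergence becomes convergence for almost every \<open>u\<close>, the exceptional set being the
  countable range of \<open>F\<close>. Dominated convergence is applied on the sphere and then in
  \<open>u\<close>.\<close>

lemma radial_prob_tendsto:
  fixes f :: "'p::prime_card padic \<Rightarrow> real"
  assumes F: "ball_cdf F" and G: "\<And>n. ball_cdf (G n)" and lim: "\<And>m. (\<lambda>n. G n m) \<longlonglongrightarrow> F m"
    and f: "continuous_on UNIV f" "bounded (range f)"
  shows "(\<lambda>n. \<integral>x. f x \<partial>radial_prob (G n)) \<longlonglongrightarrow> (\<integral>x. f x \<partial>radial_prob F)"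
proof -
  interpret U: prob_space unit_uniform by (rule prob_space_unit_uniform)
  interpret S: prob_space "padic_sphere_measure :: 'p padic measure" by (rule prob_space_padic_sphere_measure)
  obtain C where C: "\<And>x. \<bar>f x\<bar> \<le> C" using f(2) unfolding bounded_iff by auto
  have [measurable]: "f \<in> borel_measurable borel" using f(1) by (rule borel_measurable_continuous_onI)
  have [measurable]: "(quantile F :: real \<Rightarrow> 'p padic) \<in> borel_measurable borel"
    "(quantile (G n) :: real \<Rightarrow> 'p padic) \<in> borel_measurable borel" for n
    using F G by (auto intro!: quantile_measurable simp: ball_cdf_def)
  define h where "h H u = (\<integral>x. f (quantile H u * x) \<partial>padic_sphere_measure)" for H u
  have bd: "\<bar>h H u\<bar> \<le> C" for H u
  proof -
    have "\<bar>h H u\<bar> \<le> (\<integral>x. \<bar>f (quantile H u * x)\<bar> \<partial>padic_sphere_measure)" unfolding h_def by (rule integral_abs_bound)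
    also have "\<dots> \<le> (\<integral>x. C \<partial>(padic_sphere_measure :: 'p padic measure))"
      by (rule integral_mono) (use C in \<open>auto intro!: S.integrable_const_bound[OF AE_I2]\<close>)
    finally show ?thesis using S.prob_space by simp
  qed
  have cF: "countable (range F)" by (rule countable_image) simp
  have "(\<lambda>n. \<integral>u. h (G n) u \<partial>unit_uniform) \<longlonglongrightarrow> (\<integral>u. h F u \<partial>unit_uniform)"
  proof (rule integral_dominated_convergence[where w="\<lambda>_. C"])
    show "AE u in unit_uniform. (\<lambda>n. h (G n) u) \<longlonglongrightarrow> h F u"
      using AE_unit_uniform[OF cF]
    proof eventually_elim
      case (elim u)
      then have q: "(\<lambda>n. quantile (G n) u) \<longlonglongrightarrow> (quantile F u :: 'p padic)"
        by (intro quantile_tendsto[OF F G lim]) auto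
      show ?case unfolding h_def
      proof (rule integral_dominated_convergence[where w="\<lambda>_. C"])
        have "(\<lambda>n. f (quantile (G n) u * x)) \<longlonglongrightarrow> f (quantile F u * x)" for x
          by (rule continuous_on_tendsto_compose[OF f(1)]) (auto intro!: tendsto_mult[OF q])
        then show "AE x in padic_sphere_measure. (\<lambda>n. f (quantile (G n) u * x)) \<longlonglongrightarrow> f (quantile F u * x)" by simp
      qed (use C in auto)
    qed
    show "h F \<in> borel_measurable unit_uniform" "h (G n) \<in> borel_measurable unit_uniform" for n
      unfolding h_def[abs_def] by measurable
  qed (use bd in auto)
  then show ?thesis
    unfolding h_def integral_radial_prob[OF F \<open>f \<in> borel_measurable borel\<close> C]
      integral_radial_prob[OF G \<open>f \<in> borel_measurable borel\<close> C] .
qed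


section \<open>Eigenvalues, limits of convolution powers and generators\<close>

text \<open>Tannery's theorem: the weights are summable, so a bound \<open>C\<close> uniform in
  \<open>k\<close> dominates. The general filter serves both sequences of symbols and t decreasing
  to 0.\<close>

lemma tendsto_geometric_suminf:
  fixes x :: "'a \<Rightarrow> nat \<Rightarrow> real" and q :: real
  assumes q: "1 < q" and F: "F \<noteq> bot" and lim: "\<And>k. ((\<lambda>n. x n k) \<longlongrightarrow> y k) F"
    and bd: "\<forall>\<^sub>F n in F. \<forall>k. \<bar>x n k\<bar> \<le> C"
  shows "((\<lambda>n. \<Sum>k. (q - 1) / q ^ Suc k * x n k) \<longlongrightarrow> (\<Sum>k. (q - 1) / q ^ Suc k * y k)) F"
proof -
  have b: "\<forall>\<^sub>F (k, n) in at_top \<times>\<^sub>F F. norm ((q - 1) / q ^ Suc k * x n k) \<le> (q - 1) / q ^ Suc k * C"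
    unfolding eventually_prod_filter
  proof (intro exI conjI)
    show "\<forall>\<^sub>F k in at_top. (\<lambda>k::nat. True) k" by simp
    show "\<forall>\<^sub>F n in F. (\<lambda>n. \<forall>k. \<bar>x n k\<bar> \<le> C) n" by (rule bd)
    have "norm ((q - 1) / q ^ Suc k * x n k) \<le> (q - 1) / q ^ Suc k * C" if "\<forall>k. \<bar>x n k\<bar> \<le> C" for k n
    proof -
      have "0 \<le> (q - 1) / q ^ Suc k" using q by simp
      moreover have "norm ((q - 1) / q ^ Suc k * x n k) = (q - 1) / q ^ Suc k * \<bar>x n k\<bar>"
        using calculation by (simp only: real_norm_def abs_mult abs_of_nonneg)
      ultimately show ?thesis using that by (simp only: mult_left_mono)
    qed
    then show "\<forall>k n. True \<longrightarrow> (\<forall>k. \<bar>x n k\<bar> \<le> C) \<longrightarrow>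
        (case (k, n) of (k, n) \<Rightarrow> norm ((q - 1) / q ^ Suc k * x n k) \<le> (q - 1) / q ^ Suc k * C)"
      by simp
  qed
  have s: "summable (\<lambda>k. (q - 1) / q ^ Suc k * C)"
  proof -
    have "summable (\<lambda>k. (1 / q) ^ k)" using q by (intro summable_geometric) simp
    then have "summable (\<lambda>k. (q - 1) / q * C * (1 / q) ^ k)" by (rule summable_mult)
    moreover have "(q - 1) / q * C * (1 / q) ^ k = (q - 1) / q ^ Suc k * C" for k by (simp add: power_divide)
    ultimately show ?thesis by (simp only:)
  qed
  show ?thesis
    by (rule tannerys_theorem[OF _ b s F, THEN conjunct2, THEN conjunct2]) (intro tendsto_mult_left lim)
qed

section \<open>Symbols of distribution functions: products and limits\<close>

text \<open>\<open>ball_char\<close> as an operation on functions of the radius exponent, so that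
  limits of symbols can be formed before any measure is attached to them.\<close>

definition cdf_char :: "real \<Rightarrow> (int \<Rightarrow> real) \<Rightarrow> int \<Rightarrow> real" where
  "cdf_char q F m = (q * F (m - 1) - F m) / (q - 1)"

lemma cdf_char_sums:
  assumes "1 < q" "ball_cdf F"
  shows "(\<lambda>j. (q - 1) / q ^ Suc j * cdf_char q F (m + int j + 1)) sums F m"
proof -
  have e: "cdf_char q F (m + int j + 1) = (q * F (m + int j) - F (m + int j + 1)) / (q - 1)" for j
    by (simp add: cdf_char_def)
  have "\<bar>F m\<bar> \<le> 1" for m using assms(2) ball_cdf_le_1[OF assms(2), of m] by (simp add: ball_cdf_def)
  then show ?thesis unfolding e by (rule sums_geometric_resolvent[OF assms(1)])
qed

lemma cdf_char_inj:
  assumes "1 < q" "ball_cdf F" "ball_cdf G" "\<And>m. cdf_char q F m = cdf_char q G m"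
  shows "F = G"
proof
  fix m show "F m = G m"
    using cdf_char_sums[OF assms(1,2), of m] cdf_char_sums[OF assms(1,3), of m]
    by (simp only: assms(4) sums_unique2)
qed

text \<open>A crude bound independent of \<open>F\<close> and \<open>m\<close>; it supplies the
  domination in \<open>cdf_char_limit\<close>.\<close>

lemma abs_cdf_char_le:
  assumes q: "1 < q" and F: "ball_cdf F"
  shows "\<bar>cdf_char q F m\<bar> \<le> (q + 1) / (q - 1)"
proof -
  have b: "0 \<le> F k \<and> F k \<le> 1" for k using F ball_cdf_le_1[OF F, of k] by (simp add: ball_cdf_def)
  have "\<bar>q * F (m - 1) - F m\<bar> \<le> q + 1"
    using b[of m] b[of "m - 1"] q mult_left_le[of "F (m - 1)" q] mult_nonneg_nonneg[of q "F (m - 1)"] by linarith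
  then show ?thesis using q by (simp add: cdf_char_def abs_divide divide_right_mono)
qed

text \<open>The continuity theorem for radial Fourier transforms. Convergence of \<phi> to 1 at
  infinity plays the part of tightness: it keeps mass from escaping, so that the limit has total
  mass 1.\<close>

lemma cdf_char_limit:
  assumes q: "1 < q" and F: "\<And>n :: nat. ball_cdf (F n)"
    and lim: "\<And>m. (\<lambda>n. cdf_char q (F n) m) \<longlonglongrightarrow> \<phi> m" and top: "(\<phi> \<longlongrightarrow> 1) at_top"
  obtains G where "ball_cdf G" "\<And>m. cdf_char q G m = \<phi> m" "\<And>m. (\<lambda>n. F n m) \<longlonglongrightarrow> G m"
proof -
  define G where "G m = (\<Sum>j. (q - 1) / q ^ Suc j * \<phi> (m + int j + 1))" for m
  have FG: "(\<lambda>n. F n m) \<longlonglongrightarrow> G m" for m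
  proof -
    have "F n m = (\<Sum>j. (q - 1) / q ^ Suc j * cdf_char q (F n) (m + int j + 1))" for n
      by (rule sums_unique[OF cdf_char_sums[OF q F]])
    moreover have "(\<lambda>n. \<Sum>j. (q - 1) / q ^ Suc j * cdf_char q (F n) (m + int j + 1)) \<longlonglongrightarrow> G m"
      unfolding G_def
      by (rule tendsto_geometric_suminf[OF q _ lim, where C = "(q + 1) / (q - 1)"])
         (simp_all add: abs_cdf_char_le[OF q F])
    ultimately show ?thesis by simp
  qed
  have b: "0 \<le> F n k" "F n k \<le> 1" "F n (k - 1) \<le> F n k" for n k
    using F[of n] ball_cdf_le_1[OF F] by (simp_all add: ball_cdf_def mono_def)
  have G01: "0 \<le> G m" "G m \<le> 1" for m
    using b by (auto intro: LIMSEQ_le_const[OF FG] LIMSEQ_le_const2[OF FG])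
  have Gc: "cdf_char q G m = \<phi> m" for m
  proof (rule LIMSEQ_unique[OF _ lim])
    show "(\<lambda>n. cdf_char q (F n) m) \<longlonglongrightarrow> cdf_char q G m"
      unfolding cdf_char_def using q by (intro tendsto_intros FG) simp
  qed
  have mono: "mono G"
  proof (rule monoI)
    fix m n :: int assume mn: "m \<le> n"
    show "G m \<le> G n"
      by (rule LIMSEQ_le[OF FG FG]) (use F mn in \<open>auto simp: ball_cdf_def mono_def\<close>)
  qed
  have "(G \<longlongrightarrow> 1) at_top"
  proof (rule tendsto_sandwich[OF _ _ _ tendsto_const])
    \<comment> \<open>Since G (m + 1) \<ge> G m, the quotient defining the symbol at m + 1 is at
      most G m.\<close>
    have "\<phi> (m + 1) \<le> G m" for m
    proof -
      have "cdf_char q G (m + 1) \<le> G m"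
        using monoD[OF mono, of m "m + 1"] q by (simp add: cdf_char_def divide_le_eq algebra_simps)
      then show ?thesis by (simp add: Gc)
    qed
    then show "\<forall>\<^sub>F m in at_top. \<phi> (m + 1) \<le> G m" by simp
    show "((\<lambda>m. \<phi> (m + 1)) \<longlongrightarrow> 1) at_top"
      using filterlim_compose[OF top filterlim_int_diff_at_top[of "- 1"]] by simp
  qed (use G01 in simp)
  then have "ball_cdf G" using mono G01 by (simp add: ball_cdf_def)
  then show thesis using that Gc FG by blast
qed

lemma ball_cdf_ball_mass:
  assumes "rotation_invariant_prob N" shows "ball_cdf (ball_mass N)"
proof -
  interpret rot_inv N by unfold_locales (rule assms)
  show ?thesis unfolding ball_cdf_def using ball_mass_nonneg ball_mass_tendsto ball_mass_mono by (simp add: mono_def)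
qed

lemma cdf_char_ball_mass: "cdf_char (real CARD('p)) (ball_mass N) m = ball_char (N :: 'p::prime_card padic measure) m"
  by (simp add: cdf_char_def ball_char_def)

lemma ball_char_radial_prob_eq:
  assumes "ball_cdf F"
  shows "ball_char (radial_prob F :: 'p::prime_card padic measure) m = cdf_char (real CARD('p)) F m"
  by (simp add: ball_char_radial_prob[OF assms] cdf_char_def)

text \<open>The product is recognized as a symbol by passing to radial laws, convolving them, and
  taking ball masses of the result.\<close>

lemma cdf_char_mult:
  assumes "ball_cdf F" "ball_cdf G"
  obtains H where "ball_cdf H"
    "\<And>m. cdf_char (real CARD('p::prime_card)) H m = cdf_char (real CARD('p)) F m * cdf_char (real CARD('p)) G m"
proof -
  let ?M = "radial_prob F :: 'p padic measure" and ?N = "radial_prob G :: 'p padic measure"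
  note R = rotation_invariant_radial_prob[OF assms(1), where 'p='p] rotation_invariant_radial_prob[OF assms(2), where 'p='p]
  show thesis
  proof (rule that)
    show "ball_cdf (ball_mass (padic_convolution ?M ?N))"
      by (rule ball_cdf_ball_mass[OF rotation_invariant_convolution(1)[OF R]])
    show "cdf_char (real CARD('p)) (ball_mass (padic_convolution ?M ?N)) m
        = cdf_char (real CARD('p)) F m * cdf_char (real CARD('p)) G m" for m
      by (simp only: cdf_char_ball_mass rotation_invariant_convolution(2)[OF R] ball_char_radial_prob_eq assms)
  qed
qed

lemma ball_cdf_one: "ball_cdf (\<lambda>_. 1)"
  by (simp add: ball_cdf_def mono_def)

lemma cdf_char_one: "1 < q \<Longrightarrow> cdf_char q (\<lambda>_. 1) m = 1"
  by (simp add: cdf_char_def)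

lemma cdf_char_power:
  assumes "ball_cdf F"
  shows "\<exists>H. ball_cdf H \<and> (\<forall>m. cdf_char (real CARD('p::prime_card)) H m = cdf_char (real CARD('p)) F m ^ n)"
proof (induction n)
  case 0
  then show ?case using ball_cdf_one by (intro exI[of _ "\<lambda>_. 1"]) (simp add: cdf_char_one)
next
  case (Suc n)
  then obtain H where H: "ball_cdf H" "\<And>m. cdf_char (real CARD('p)) H m = cdf_char (real CARD('p)) F m ^ n" by blast
  obtain K where "ball_cdf K"
    "\<And>m. cdf_char (real CARD('p)) K m = cdf_char (real CARD('p)) F m * cdf_char (real CARD('p)) H m"
    using cdf_char_mult[OF assms H(1), where 'p='p] by metis
  then show ?case using H(2) by (intro exI[of _ K]) simp
qed

section \<open>The symbols exp (- t \<lambda>)\<close>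

text \<open>One minus the symbol of F m = 1 - a (m + 1). The shift is there because a m is a mass of
  {norm \<ge> p^m}, the complement of the ball of radius p^(m-1). \<open>jump_eigenvalue_eq\<close>
  gives the form used in the theorem.\<close>

definition jump_eigenvalue :: "real \<Rightarrow> (int \<Rightarrow> real) \<Rightarrow> int \<Rightarrow> real" where
  "jump_eigenvalue q a m = (q * a m - a (m + 1)) / (q - 1)"

lemma jump_eigenvalue_tendsto:
  assumes "1 < q" "(a \<longlongrightarrow> 0) at_top"
  shows "(jump_eigenvalue q a \<longlongrightarrow> 0) at_top"
proof -
  have "((\<lambda>m. a (m + 1)) \<longlongrightarrow> 0) at_top"
    using filterlim_compose[OF assms(2) filterlim_int_diff_at_top[of "- 1"]] by simp
  then have "((\<lambda>m. (q * a m - a (m + 1)) / (q - 1)) \<longlongrightarrow> (q * 0 - 0) / (q - 1)) at_top"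
    using assms by (intro tendsto_intros) auto
  then show ?thesis by (simp add: jump_eigenvalue_def[abs_def])
qed

lemma antimono_int:
  fixes a :: "int \<Rightarrow> real"
  assumes "\<And>m. a (m + 1) \<le> a m"
  shows "antimono a"
proof (rule antimonoI)
  fix m n :: int assume "m \<le> n"
  then show "a n \<le> a m"
  proof (induction n rule: int_ge_induct)
    case (step i) then show ?case using assms[of i] by linarith
  qed simp
qed

lemma antimono_tendsto_0_nonneg:
  fixes a :: "int \<Rightarrow> real"
  assumes "antimono a" "(a \<longlongrightarrow> 0) at_top"
  shows "0 \<le> a m"
proof (rule tendsto_upperbound[OF assms(2)])
  show "\<forall>\<^sub>F n in at_top. a n \<le> a m"
    using assms(1) by (intro eventually_at_top_linorderI[of m]) (auto simp: antimono_def)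
qed simp

text \<open>Compound Poisson case: \<open>1 - (t / n) \<lambda>\<close> is the symbol of a probability measure as soon as
  \<open>n\<close> dominates \<open>t W\<close>, and its \<open>n\<close>-th convolution powers converge.\<close>

lemma cdf_char_exp_bounded:
  fixes a :: "int \<Rightarrow> real"
  assumes a: "antimono a" "(a \<longlongrightarrow> 0) at_top" and W: "\<And>m. a m \<le> W" and t: "0 \<le> t"
  obtains G where "ball_cdf G"
    "\<And>m. cdf_char (real CARD('p::prime_card)) G m = exp (- t * jump_eigenvalue (real CARD('p)) a m)"
proof -
  let ?q = "real CARD('p)"
  obtain n0 :: nat where n0: "t * W < real n0" using reals_Archimedean2 by blast
  define N where "N n = Suc (n + n0)" for n
  have Npos: "0 < real (N n)" for n by (simp add: N_def)
  define F where "F n m = 1 - t / real (N n) * a (m + 1)" for n m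
  have F: "ball_cdf (F n)" for n
    unfolding ball_cdf_def
  proof (intro conjI allI monoI)
    fix m k :: int assume "m \<le> k"
    then have "a (k + 1) \<le> a (m + 1)" using a(1) by (simp add: antimono_def)
    then have "t / real (N n) * a (k + 1) \<le> t / real (N n) * a (m + 1)" using t by (intro mult_left_mono) auto
    then show "F n m \<le> F n k" by (simp add: F_def)
  next
    fix m
    have "t * a (m + 1) \<le> t * W" using W t by (intro mult_left_mono) auto
    also have "\<dots> \<le> real (N n)" using n0 by (simp add: N_def)
    finally show "0 \<le> F n m" using Npos[of n] by (simp add: F_def divide_le_eq)
  next
    have "((\<lambda>m. a (m + 1)) \<longlongrightarrow> 0) at_top"
      using filterlim_compose[OF a(2) filterlim_int_diff_at_top[of "- 1"]] by simp
    then have "((\<lambda>m. 1 - t / real (N n) * a (m + 1)) \<longlongrightarrow> 1 - t / real (N n) * 0) at_top"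
      by (intro tendsto_intros)
    then show "(F n \<longlongrightarrow> 1) at_top" by (simp add: F_def[abs_def])
  qed
  have char: "cdf_char ?q (F n) m = 1 + (- t * jump_eigenvalue ?q a m) / real (N n)" for n m
    using Npos[of n] card_prime_gt_1[where 'p='p]
    by (simp add: cdf_char_def F_def jump_eigenvalue_def field_simps)
  have "\<exists>H. ball_cdf H \<and> (\<forall>m. cdf_char ?q H m = cdf_char ?q (F n) m ^ N n)" for n
    by (rule cdf_char_power[OF F])
  then obtain H where H: "\<And>n. ball_cdf (H n)" "\<And>n m. cdf_char ?q (H n) m = cdf_char ?q (F n) m ^ N n"
    by metis
  have lim: "(\<lambda>n. cdf_char ?q (H n) m) \<longlonglongrightarrow> exp (- t * jump_eigenvalue ?q a m)" for m
    unfolding H(2) char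
    using LIMSEQ_ignore_initial_segment[OF tendsto_exp_limit_sequentially[of "- t * jump_eigenvalue ?q a m"], of "Suc n0"]
    by (simp add: N_def)
  have top: "((\<lambda>m. exp (- t * jump_eigenvalue ?q a m)) \<longlongrightarrow> 1) at_top"
    using tendsto_exp[OF tendsto_mult_left[OF jump_eigenvalue_tendsto[OF card_prime_gt_1[where 'p='p] a(2)], of "- t"]]
    by simp
  obtain K where "ball_cdf K" "\<And>m. cdf_char ?q K m = exp (- t * jump_eigenvalue ?q a m)"
    "\<And>m. (\<lambda>n. H n m) \<longlonglongrightarrow> K m"
    by (rule cdf_char_limit[OF card_prime_gt_1[where 'p='p] H(1) lim top]) blast
  then show thesis using that by blast
qed

text \<open>Freezing \<open>a\<close> below -n makes it bounded by a (-n). The eigenvalue at m is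
  unchanged as soon as m \<ge> -n, so each symbol value is eventually constant in n and the
  continuity theorem applies.\<close>

lemma cdf_char_exp:
  fixes a :: "int \<Rightarrow> real"
  assumes a: "antimono a" "(a \<longlongrightarrow> 0) at_top" and t: "0 \<le> t"
  obtains G where "ball_cdf G"
    "\<And>m. cdf_char (real CARD('p::prime_card)) G m = exp (- t * jump_eigenvalue (real CARD('p)) a m)"
proof -
  let ?q = "real CARD('p)"
  define b where "b n m = a (max m (- int n))" for n :: nat and m
  have "\<exists>G. ball_cdf G \<and> (\<forall>m. cdf_char ?q G m = exp (- t * jump_eigenvalue ?q (b n) m))" for n
  proof -
    have 1: "antimono (b n)" using a(1) by (auto simp: b_def antimono_def)
    have "\<forall>\<^sub>F m in at_top. a m = b n m"
      by (intro eventually_at_top_linorderI[of "- int n"]) (simp add: b_def max_def)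
    then have 2: "(b n \<longlongrightarrow> 0) at_top" using a(2) by (rule Lim_transform_eventually[rotated])
    have 3: "b n m \<le> a (- int n)" for m using a(1) by (simp add: b_def antimono_def)
    show ?thesis using cdf_char_exp_bounded[OF 1 2 3 t, where 'p='p] by metis
  qed
  then obtain G where G: "\<And>n. ball_cdf (G n)" "\<And>n m. cdf_char ?q (G n) m = exp (- t * jump_eigenvalue ?q (b n) m)"
    by metis
  have lim: "(\<lambda>n. cdf_char ?q (G n) m) \<longlonglongrightarrow> exp (- t * jump_eigenvalue ?q a m)" for m
  proof (rule tendsto_eventually, rule eventually_sequentiallyI[of "nat (- m)"])
    fix n assume "nat (- m) \<le> n"
    then have "max m (- int n) = m" "max (m + 1) (- int n) = m + 1" by auto
    then show "cdf_char ?q (G n) m = exp (- t * jump_eigenvalue ?q a m)"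
      by (simp only: G(2) b_def jump_eigenvalue_def)
  qed
  have top: "((\<lambda>m. exp (- t * jump_eigenvalue ?q a m)) \<longlongrightarrow> 1) at_top"
    using tendsto_exp[OF tendsto_mult_left[OF jump_eigenvalue_tendsto[OF card_prime_gt_1[where 'p='p] a(2)], of "- t"]]
    by simp
  obtain K where "ball_cdf K" "\<And>m. cdf_char ?q K m = exp (- t * jump_eigenvalue ?q a m)"
    "\<And>m. (\<lambda>n. G n m) \<longlonglongrightarrow> K m"
    by (rule cdf_char_limit[OF card_prime_gt_1[where 'p='p] G(1) lim top]) blast
  then show thesis using that by blast
qed

section \<open>Eigenfunctions and the graph of the generator\<close>

lemma ball_space_bounded:
  fixes B :: "'p::prime_card padic set"
  assumes "f \<in> ball_space m B"
  shows "\<exists>K. \<forall>x. \<bar>f x\<bar> \<le> K" and "x \<notin> B \<Longrightarrow> f x = 0"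
proof -
  obtain S k where S: "finite S" "S \<subseteq> ball_children m B" and fe: "f = (\<lambda>x. \<Sum>C\<in>S. k C * child_fun B C x)"
    using assms by (auto simp: ball_space_def)
  have "\<bar>f x\<bar> \<le> (\<Sum>C\<in>S. \<bar>k C\<bar> * (1 / measure padic_haar C + 1 / measure padic_haar B))" for x
    unfolding fe by (rule order_trans[OF sum_abs]) (auto intro!: sum_mono mult_left_mono child_fun_bounded simp: abs_mult)
  then show "\<exists>K. \<forall>x. \<bar>f x\<bar> \<le> K" by blast
  assume x: "x \<notin> B"
  have "child_fun B C x = 0" if "C \<in> S" for C
  proof -
    have "C \<subseteq> B" using S that unfolding ball_children_def by blast
    then have "x \<notin> C" using x by blast
    then show ?thesis using x by (simp add: child_fun_def)
  qed
  then show "f x = 0" by (simp add: fe)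
qed

lemma square_integrable_ball_space:
  fixes B :: "'p::prime_card padic set"
  assumes B: "B \<in> padic_balls m" and f: "f \<in> ball_space m B"
  shows "square_integrable f"
proof -
  have [measurable]: "f \<in> borel_measurable borel" by (rule ball_space_measurable[OF B f])
  obtain K where K: "\<And>x. \<bar>f x\<bar> \<le> K" using ball_space_bounded(1)[OF f] by blast
  obtain c where c: "B = cball c (real CARD('p) powi m)" using B unfolding padic_balls_def by blast
  have "integrable padic_haar (\<lambda>x. (f x)\<^sup>2)"
  proof (rule integrableI_bounded_set[where A=B and B="K\<^sup>2"])
    show "B \<in> sets padic_haar" by (simp add: c)
    show "emeasure padic_haar B < \<infinity>" unfolding c emeasure_padic_haar_cball by simp
    show "AE x in padic_haar. x \<in> B \<longrightarrow> norm ((f x)\<^sup>2) \<le> K\<^sup>2"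
      using K abs_le_square_iff[of "f _" K] order_trans[OF abs_ge_zero K] by (auto intro!: AE_I2 simp: abs_le_square_iff[symmetric])
    show "AE x in padic_haar. x \<notin> B \<longrightarrow> (f x)\<^sup>2 = 0" using ball_space_bounded(2)[OF f] by simp
  qed simp
  then show ?thesis by (simp add: square_integrable_def)
qed

lemma nn_integral_square_finite:
  assumes "square_integrable f"
  shows "(\<integral>\<^sup>+x. ennreal ((f x)\<^sup>2) \<partial>padic_haar) < \<infinity>"
  using assms unfolding square_integrable_def integrable_iff_bounded by simp

text \<open>The function is constant and nonzero on the central child, a ball of positive Haar
  mass.\<close>

lemma nn_integral_std_child_fun_pos:
  "0 < (\<integral>\<^sup>+x. ennreal ((std_child_fun m x)\<^sup>2) \<partial>(padic_haar :: 'p::prime_card padic measure))"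
proof -
  let ?v = "std_child_fun m (0 :: 'p padic)" and ?C = "cball 0 (real CARD('p) powi (m - 1)) :: 'p padic set"
  have sub: "?C \<subseteq> cball 0 (real CARD('p) powi m)"
    using std_ball(2)[of m, where 'p='p] unfolding ball_children_def by blast
  have le: "ennreal (?v\<^sup>2) * indicator ?C x \<le> ennreal ((std_child_fun m x)\<^sup>2)" for x
  proof (cases "x \<in> ?C")
    case True
    then have "x \<in> cball 0 (real CARD('p) powi m)" using sub by blast
    then have "std_child_fun m x = ?v" using True by (simp add: std_child_fun_def child_fun_cball indicator_def)
    then show ?thesis by (simp add: indicator_def)
  qed simp
  have le_I: "(\<integral>\<^sup>+x. ennreal (?v\<^sup>2) * indicator ?C x \<partial>padic_haar) \<le> (\<integral>\<^sup>+x. ennreal ((std_child_fun m x)\<^sup>2) \<partial>(padic_haar :: 'p padic measure))"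
    by (rule nn_integral_mono) (rule le)
  have eq_I: "(\<integral>\<^sup>+x. ennreal (?v\<^sup>2) * indicator ?C x \<partial>padic_haar) = ennreal (?v\<^sup>2) * ennreal (real CARD('p) powi (m - 1))"
    by (subst nn_integral_cmult_indicator) (simp_all only: emeasure_padic_haar_cball sets_padic_haar, simp)
  have pos: "0 < ennreal (?v\<^sup>2) * ennreal (real CARD('p) powi (m - 1))"
    using std_child_fun_0_neq[of m, where 'p='p] by (simp add: ennreal_zero_less_mult_iff)
  show ?thesis by (rule less_le_trans[OF pos[folded eq_I] le_I])
qed

text \<open>As \<open>f\<close> is an eigenfunction of convolution, the defect is a scalar multiple
  of \<open>f\<close>. Convergence in the graph of the generator thus reduces to convergence of real
  numbers.\<close>

lemma nn_integral_difference_quotient: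
  fixes \<nu> :: "real \<Rightarrow> 'p::prime_card padic measure"
  assumes N: "rotation_invariant_prob (\<nu> t)" and B: "B \<in> padic_balls m" and f: "f \<in> ball_space m B"
  shows "(\<integral>\<^sup>+x. ennreal (((f x - semigroup_op \<nu> t f x) / t - l * f x)\<^sup>2) \<partial>padic_haar)
    = ennreal (((1 - ball_char (\<nu> t) m) / t - l)\<^sup>2) * (\<integral>\<^sup>+x. ennreal ((f x)\<^sup>2) \<partial>padic_haar)"
proof -
  interpret rot_inv "\<nu> t" by unfold_locales (rule N)
  have [measurable]: "f \<in> borel_measurable borel" by (rule ball_space_measurable[OF B f])
  have "(f x - semigroup_op \<nu> t f x) / t - l * f x = ((1 - ball_char (\<nu> t) m) / t - l) * f x" for x
    unfolding semigroup_op_def integral_ball_space[OF B f] by (simp add: left_diff_distrib)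
  then have "ennreal (((f x - semigroup_op \<nu> t f x) / t - l * f x)\<^sup>2)
      = ennreal (((1 - ball_char (\<nu> t) m) / t - l)\<^sup>2) * ennreal ((f x)\<^sup>2)" for x
    by (simp add: power_mult_distrib ennreal_mult)
  then show ?thesis by (simp add: nn_integral_cmult)
qed

lemma generator_ball_spaceI:
  fixes \<nu> :: "real \<Rightarrow> 'p::prime_card padic measure"
  assumes N: "\<And>t. 0 < t \<Longrightarrow> rotation_invariant_prob (\<nu> t)" and B: "B \<in> padic_balls m" and f: "f \<in> ball_space m B"
    and lim: "((\<lambda>t. (1 - ball_char (\<nu> t) m) / t) \<longlongrightarrow> l) (at_right 0)"
  shows "(f, \<lambda>x. l * f x) \<in> generator \<nu>"
proof -
  have sf: "square_integrable f" by (rule square_integrable_ball_space[OF B f])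
  then have sg: "square_integrable (\<lambda>x. l * f x)"
    unfolding square_integrable_def by (auto simp: power_mult_distrib)
  let ?I = "\<integral>\<^sup>+x. ennreal ((f x)\<^sup>2) \<partial>padic_haar"
  have "((\<lambda>t. ((1 - ball_char (\<nu> t) m) / t - l)\<^sup>2) \<longlongrightarrow> (l - l)\<^sup>2) (at_right 0)"
    by (intro tendsto_intros lim)
  then have "((\<lambda>t. ennreal (((1 - ball_char (\<nu> t) m) / t - l)\<^sup>2)) \<longlongrightarrow> ennreal ((l - l)\<^sup>2)) (at_right 0)"
    by (rule tendsto_ennrealI)
  then have "((\<lambda>t. ?I * ennreal (((1 - ball_char (\<nu> t) m) / t - l)\<^sup>2)) \<longlongrightarrow> ?I * ennreal ((l - l)\<^sup>2)) (at_right 0)"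
    using nn_integral_square_finite[OF sf] by (intro ennreal_tendsto_cmult) auto
  then have *: "((\<lambda>t. ?I * ennreal (((1 - ball_char (\<nu> t) m) / t - l)\<^sup>2)) \<longlongrightarrow> 0) (at_right 0)" by simp
  have ev: "\<forall>\<^sub>F t in at_right 0. ?I * ennreal (((1 - ball_char (\<nu> t) m) / t - l)\<^sup>2)
      = (\<integral>\<^sup>+x. ennreal (((f x - semigroup_op \<nu> t f x) / t - l * f x)\<^sup>2) \<partial>padic_haar)"
    using eventually_at_right_less[of "0::real"]
    by eventually_elim (simp add: nn_integral_difference_quotient[OF N B f] mult.commute)
  show ?thesis
    unfolding generator_def using sf sg Lim_transform_eventually[OF * ev] by simp
qed

text \<open>The squared norm of the test function is finite and positive, so dividing by it turns
  convergence in mean square into convergence of the scalar quotient.\<close>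

lemma generator_eigenvalue_limit:
  fixes \<nu> :: "real \<Rightarrow> 'p::prime_card padic measure"
  assumes N: "\<And>t. 0 < t \<Longrightarrow> rotation_invariant_prob (\<nu> t)"
    and gen: "(std_child_fun m, \<lambda>x. l * std_child_fun m x) \<in> generator \<nu>"
  shows "((\<lambda>t. (1 - ball_char (\<nu> t) m) / t) \<longlongrightarrow> l) (at_right 0)"
proof -
  let ?f = "std_child_fun m :: 'p padic \<Rightarrow> real"
  note B = std_ball(1)[of m, where 'p='p] and f = std_child_fun_in_ball_space[of m, where 'p='p]
  let ?I = "\<integral>\<^sup>+x. ennreal ((?f x)\<^sup>2) \<partial>padic_haar"
  let ?c = "\<lambda>t. (1 - ball_char (\<nu> t) m) / t - l"
  obtain r where r: "?I = ennreal r" "0 < r"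
    using nn_integral_square_finite[OF square_integrable_ball_space[OF B f]] nn_integral_std_child_fun_pos[of m, where 'p='p]
    by (cases ?I) auto
  have ev: "\<forall>\<^sub>F t in at_right 0. (\<integral>\<^sup>+x. ennreal (((?f x - semigroup_op \<nu> t ?f x) / t - l * ?f x)\<^sup>2) \<partial>padic_haar)
      = ennreal ((?c t)\<^sup>2 * r)"
    using eventually_at_right_less[of "0::real"]
    by eventually_elim (simp add: nn_integral_difference_quotient[OF N B f] r(1) ennreal_mult[OF zero_le_power2 less_imp_le[OF r(2)]])
  have "((\<lambda>t. \<integral>\<^sup>+x. ennreal (((?f x - semigroup_op \<nu> t ?f x) / t - l * ?f x)\<^sup>2) \<partial>padic_haar) \<longlongrightarrow> 0) (at_right 0)"
    using gen unfolding generator_def by simp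
  then have "((\<lambda>t. ennreal ((?c t)\<^sup>2 * r)) \<longlongrightarrow> ennreal 0) (at_right 0)"
    using Lim_transform_eventually[OF _ ev] by simp
  then have "((\<lambda>t. (?c t)\<^sup>2 * r) \<longlongrightarrow> 0) (at_right 0)"
    by (rule tendsto_ennrealD) (use r in auto)
  then have "((\<lambda>t. (?c t)\<^sup>2 * r / r) \<longlongrightarrow> 0 / r) (at_right 0)" by (rule tendsto_divide) (use r in auto)
  then have "((\<lambda>t. sqrt ((?c t)\<^sup>2)) \<longlongrightarrow> sqrt 0) (at_right 0)" using r(2) by (intro tendsto_real_sqrt) simp
  then have "(?c \<longlongrightarrow> 0) (at_right 0)" by (simp add: tendsto_rabs_zero_iff)
  then show ?thesis by (simp add: LIM_zero_iff)
qed

section \<open>Multiplicative families with a derivative at 0\<close>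

text \<open>Write \<phi> t as the (n+1)-th power of \<phi> (t / (n+1)). Bernoulli's inequality
  bounds the power below, 1 + x \<le> exp x bounds it above, and both bounds converge because only
  the behaviour of \<phi> near 0 enters.\<close>

lemma multiplicative_bounds:
  fixes \<phi> :: "real \<Rightarrow> real"
  assumes mult: "\<And>s t. 0 < s \<Longrightarrow> 0 < t \<Longrightarrow> \<phi> (s + t) = \<phi> s * \<phi> t"
    and bd: "\<And>t. 0 < t \<Longrightarrow> \<bar>\<phi> t\<bar> \<le> 1"
    and lim: "((\<lambda>s. (1 - \<phi> s) / s) \<longlongrightarrow> l) (at_right 0)" and t: "0 < t"
  shows "1 - t * l \<le> \<phi> t" "\<phi> t \<le> exp (- t * l)"
proof -
  \<comment> \<open>A value of \<phi> is the square of the value at half the argument. Nonnegativity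
    is what Bernoulli's inequality and \<open>power_mono\<close> require.\<close>
  have nonneg: "0 \<le> \<phi> s" if "0 < s" for s
    using mult[of "s / 2" "s / 2"] that by simp
  have pow: "\<phi> (real (Suc n) * s) = \<phi> s ^ Suc n" if "0 < s" for n s
  proof (induction n)
    case (Suc n)
    have "\<phi> (real (Suc n) * s + s) = \<phi> s ^ Suc n * \<phi> s"
      using mult[of "real (Suc n) * s" s] Suc that by simp
    then show ?case by (simp add: algebra_simps)
  qed simp
  define s where "s n = t / real (Suc n)" for n
  have s: "0 < s n" "real (Suc n) * s n = t" for n using t by (simp_all add: s_def)
  have "s \<longlonglongrightarrow> 0"
    unfolding s_def using LIMSEQ_Suc[OF lim_const_over_n[of t]] by simp
  then have "filterlim s (at_right 0) sequentially"
    using s(1) by (intro tendsto_imp_filterlim_at_right) simp_all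
  then have L: "(\<lambda>n. (1 - \<phi> (s n)) / s n) \<longlonglongrightarrow> l" by (rule filterlim_compose[OF lim])
  have \<phi>t: "\<phi> t = \<phi> (s n) ^ Suc n" for n using pow[OF s(1)[of n], of n] s(2)[of n] by simp
  have d: "real (Suc n) * (1 - \<phi> (s n)) = t * ((1 - \<phi> (s n)) / s n)" for n
    using s(1)[of n] s(2)[of n, symmetric] by simp
  have "1 - t * ((1 - \<phi> (s n)) / s n) \<le> \<phi> t" for n
    using Bernoulli_inequality[of "\<phi> (s n) - 1" "Suc n"] nonneg[OF s(1)[of n]] d[of n]
    unfolding \<phi>t[of n] by (simp add: algebra_simps)
  moreover have "(\<lambda>n. 1 - t * ((1 - \<phi> (s n)) / s n)) \<longlonglongrightarrow> 1 - t * l" by (intro tendsto_intros L)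
  ultimately show "1 - t * l \<le> \<phi> t" by (auto intro: LIMSEQ_le_const2)
  have "\<phi> t \<le> exp (- t * ((1 - \<phi> (s n)) / s n))" for n
  proof -
    have "\<phi> (s n) \<le> exp (\<phi> (s n) - 1)" using exp_ge_add_one_self[of "\<phi> (s n) - 1"] by simp
    then have "\<phi> t \<le> exp (\<phi> (s n) - 1) ^ Suc n"
      unfolding \<phi>t[of n] using nonneg[OF s(1)] by (rule power_mono)
    also have "\<dots> = exp (real (Suc n) * (\<phi> (s n) - 1))" by (rule exp_of_nat_mult[symmetric])
    also have "real (Suc n) * (\<phi> (s n) - 1) = - (real (Suc n) * (1 - \<phi> (s n)))"
      by (simp only: right_diff_distrib minus_diff_eq mult_1_right)
    also have "\<dots> = - t * ((1 - \<phi> (s n)) / s n)"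
      unfolding d by (simp only: mult_minus_left)
    finally show ?thesis .
  qed
  moreover have "(\<lambda>n. exp (- t * ((1 - \<phi> (s n)) / s n))) \<longlonglongrightarrow> exp (- t * l)" by (intro tendsto_intros L)
  ultimately show "\<phi> t \<le> exp (- t * l)" by (auto intro: LIMSEQ_le_const)
qed

lemma rotation_invariant_prob_return: "rotation_invariant_prob (return borel (0 :: 'p::prime_card padic))"
  unfolding rotation_invariant_prob_def
proof (intro conjI allI impI)
  show "prob_space (return borel (0 :: 'p padic))" by (rule prob_space_return) simp
  fix a :: "'p padic"
  show "distr (return borel 0) borel (\<lambda>x. a * x) = return borel 0"
    by (subst distr_return) auto
qed simp

lemma ball_char_return: "ball_char (return borel (0 :: 'p::prime_card padic)) m = 1"
proof -
  have "ball_mass (return borel (0 :: 'p padic)) m = 1" for m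
    by (simp add: ball_mass_def measure_return)
  then show ?thesis using card_prime_gt_1[where 'p='p] by (simp add: ball_char_def)
qed


section \<open>Characterization of the spectra\<close>

lemma tendsto_SUP_at_bot:
  fixes a :: "int \<Rightarrow> ereal"
  assumes "antimono a"
  shows "(a \<longlongrightarrow> (SUP m. a m)) at_bot"
proof (rule order_tendstoI)
  fix l assume "l < (SUP m. a m)"
  then obtain m where m: "l < a m" by (auto simp: less_SUP_iff)
  have "l < a k" if "k \<le> m" for k using m antimonoD[OF assms that] by (rule less_le_trans)
  then show "\<forall>\<^sub>F k in at_bot. l < a k" unfolding eventually_at_bot_linorder by blast
next
  fix u assume "(SUP m. a m) < u"
  then have "a k < u" for k by (rule le_less_trans[OF SUP_upper[OF UNIV_I]])
  then show "\<forall>\<^sub>F k in at_bot. a k < u" by simp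
qed

lemma jump_eigenvalue_eq:
  assumes "1 < q"
  shows "jump_eigenvalue q a m = a m - inverse (q - 1) * (a (m + 1) - a m)"
  using assms by (simp add: jump_eigenvalue_def field_simps)

text \<open>Vanishing eigenvalues make \<open>a\<close> grow by the factor q at each step, which a
  decreasing nonnegative sequence allows only if it is zero. This shows that the constructed
  semigroup is nontrivial.\<close>

lemma jump_eigenvalue_0_imp:
  assumes q: "1 < q" and a: "antimono a" "\<And>m. 0 \<le> a m" and z: "\<And>m. jump_eigenvalue q a m = 0"
  shows "a m = 0"
proof -
  have "q * a m = a (m + 1)" using z[of m] q by (simp add: jump_eigenvalue_def)
  also have "\<dots> \<le> a m" using a(1) by (simp add: antimono_def)
  finally have "(q - 1) * a m \<le> 0" by (simp add: algebra_simps)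
  then have "a m \<le> 0" using q by (simp add: mult_le_0_iff)
  then show ?thesis using a(2)[of m] by linarith
qed

section \<open>From a Laplacian to the tails of the jump measure\<close>

lemma jump_tails_from_semigroup:
  fixes \<nu> :: "real \<Rightarrow> 'p::prime_card padic measure"
  assumes N: "\<And>t. 0 < t \<Longrightarrow> rotation_invariant_prob (\<nu> t)"
    and conv: "\<And>s t. 0 < s \<Longrightarrow> 0 < t \<Longrightarrow> padic_convolution (\<nu> s) (\<nu> t) = \<nu> (s + t)"
    and lim: "\<And>m. ((\<lambda>t. (1 - ball_char (\<nu> t) m) / t) \<longlongrightarrow> lam m) (at_right 0)"
  obtains a where "antimono a" "(a \<longlongrightarrow> 0) at_top" "\<And>m. lam m = jump_eigenvalue (real CARD('p)) a m"
proof -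
  let ?q = "real CARD('p)"
  have q: "1 < ?q" by simp
  have ev0: "\<forall>\<^sub>F t in at_right (0::real). 0 < t" by (rule eventually_at_right_less)
  \<comment> \<open>The mass of {norm \<ge> p^m} divided by t; hence the index m - 1 of the
    complementary ball.\<close>
  define G where "G t m = (1 - ball_mass (\<nu> t) (m - 1)) / t" for t m
  define L where "L t m = (1 - ball_char (\<nu> t) m) / t" for t m
  \<comment> \<open>The geometric inverse applied to the eigenvalues; that it is the limit of
    \<open>G\<close> is then a conclusion.\<close>
  define a where "a m = (\<Sum>j. (?q - 1) / ?q ^ Suc j * lam (m + int j))" for m
  have LG: "L t m = (?q * G t m - G t (m + 1)) / (?q - 1)" if "0 < t" for t m
    using that q by (simp add: L_def G_def ball_char_def field_simps)
  have Gb: "0 \<le> G t m" "G t (m + 1) \<le> G t m" "G t m \<le> L t m" "\<bar>G t m\<bar> \<le> 1 / t" if t: "0 < t" for t m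
  proof -
    interpret rot_inv "\<nu> t" by unfold_locales (rule N[OF t])
    show "0 \<le> G t m" using ball_mass_le_1 t by (simp add: G_def)
    moreover have "G t m \<le> 1 / t" using ball_mass_nonneg[of "m - 1"] t by (simp add: G_def divide_right_mono)
    ultimately show "\<bar>G t m\<bar> \<le> 1 / t" by simp
    show "G t (m + 1) \<le> G t m" using ball_mass_mono[of "m - 1" m] t by (simp add: G_def divide_right_mono)
    show "G t m \<le> L t m" using ball_char_le[of m] t by (simp add: G_def L_def divide_right_mono)
  qed
  have Ganti: "G t k \<le> G t m" if "0 < t" "m \<le> k" for t m k
    using antimonoD[OF antimono_int[of "G t"] that(2)] Gb(2)[OF that(1)] by blast
  \<comment> \<open>For each fixed t the bound 1/t suffices to invert; it is useless as t tends to
    0, where the domination below takes over.\<close>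
  have GL: "(\<lambda>j. (?q - 1) / ?q ^ Suc j * L t (m + int j)) sums G t m" if "0 < t" for t m
    unfolding LG[OF that] by (rule sums_geometric_resolvent[OF q Gb(4)[OF that]])
  have limL: "((\<lambda>t. L t m) \<longlongrightarrow> lam m) (at_right 0)" for m using lim by (simp add: L_def)
  have limG: "((\<lambda>t. G t m) \<longlongrightarrow> a m) (at_right 0)" for m
  proof -
    have "\<forall>\<^sub>F t in at_right 0. L t m < lam m + 1" by (rule order_tendstoD(2)[OF limL]) simp
    \<comment> \<open>Uniform in j: L at m + j is at most q/(q-1) times G at m + j. By monotonicity
      of \<open>G\<close> in the radius this is at most q/(q-1) times G at m, and G m \<le> L m,
      which stays below lam m + 1.\<close>
    then have "\<forall>\<^sub>F t in at_right 0. \<forall>j. \<bar>L t (m + int j)\<bar> \<le> ?q / (?q - 1) * (lam m + 1)"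
      using ev0
    proof eventually_elim
      case (elim t)
      show ?case
      proof
        fix j
        have "?q * G t (m + int j) - G t (m + int j + 1) \<le> ?q * G t (m + int j)" using Gb(1)[OF elim(2)] by simp
        also have "\<dots> \<le> ?q * (lam m + 1)"
          using Ganti[OF elim(2), of m "m + int j"] Gb(3)[OF elim(2), of m] elim(1) by (intro mult_left_mono) auto
        finally have "L t (m + int j) \<le> ?q * (lam m + 1) / (?q - 1)"
          unfolding LG[OF elim(2)] using q by (intro divide_right_mono) auto
        moreover have "0 \<le> L t (m + int j)" using Gb(1,3)[OF elim(2), of "m + int j"] by linarith
        ultimately show "\<bar>L t (m + int j)\<bar> \<le> ?q / (?q - 1) * (lam m + 1)" by simp
      qed
    qed
    then have *: "((\<lambda>t. \<Sum>j. (?q - 1) / ?q ^ Suc j * L t (m + int j)) \<longlongrightarrow> a m) (at_right 0)"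
      unfolding a_def by (intro tendsto_geometric_suminf[OF q _ limL]) auto
    have "\<forall>\<^sub>F t in at_right 0. (\<Sum>j. (?q - 1) / ?q ^ Suc j * L t (m + int j)) = G t m"
      using ev0 by eventually_elim (rule sums_unique[OF GL, symmetric])
    with * show ?thesis by (rule Lim_transform_eventually)
  qed
  have anti: "antimono a"
  proof (rule antimono_int)
    fix m
    show "a (m + 1) \<le> a m"
      by (rule tendsto_le[OF _ limG limG]) (use ev0 Gb(2) in \<open>auto elim: eventually_mono\<close>)
  qed
  have a0: "0 \<le> a m" for m
    by (rule tendsto_lowerbound[OF limG]) (use ev0 Gb(1) in \<open>auto elim: eventually_mono\<close>)
  have al: "a m \<le> lam m" for m
    by (rule tendsto_le[OF _ limL limG]) (use ev0 Gb(3) in \<open>auto elim: eventually_mono\<close>)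
  have eig: "lam m = jump_eigenvalue ?q a m" for m
  proof (rule tendsto_unique[OF _ limL])
    have "((\<lambda>t. (?q * G t m - G t (m + 1)) / (?q - 1)) \<longlongrightarrow> jump_eigenvalue ?q a m) (at_right 0)"
      unfolding jump_eigenvalue_def using q by (intro tendsto_intros limG) auto
    moreover have "\<forall>\<^sub>F t in at_right 0. (?q * G t m - G t (m + 1)) / (?q - 1) = L t m"
      using ev0 by eventually_elim (rule LG[symmetric])
    ultimately show "((\<lambda>t. L t m) \<longlongrightarrow> jump_eigenvalue ?q a m) (at_right 0)"
      by (rule Lim_transform_eventually)
  qed simp
  interpret N1: rot_inv "\<nu> 1" by unfold_locales (rule N, simp)
  have le_exp: "ball_char (\<nu> 1) m \<le> exp (- lam m)" for m
  proof -
    have "ball_char (\<nu> (s + t)) m = ball_char (\<nu> s) m * ball_char (\<nu> t) m" if "0 < s" "0 < t" for s t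
      using rotation_invariant_convolution(2)[OF N N, of s t m] that by (simp add: conv)
    moreover have "\<bar>ball_char (\<nu> t) m\<bar> \<le> 1" if "0 < t" for t
      using rot_inv.abs_ball_char_le_1[of "\<nu> t" m] N[OF that] by (simp add: rot_inv_def)
    ultimately show ?thesis using multiplicative_bounds(2)[of "\<lambda>t. ball_char (\<nu> t) m" "lam m" 1] lim by simp
  qed
  \<comment> \<open>Squeeze: 0 \<le> a m \<le> lam m, and lam m is at most minus the logarithm of
    the symbol at time 1, which tends to 1 because the time-1 law has total mass 1.\<close>
  have "(a \<longlongrightarrow> 0) at_top"
  proof (rule tendsto_sandwich[OF _ _ tendsto_const])
    have "((\<lambda>m. - ln (ball_char (\<nu> 1) m)) \<longlongrightarrow> - ln 1) at_top"
      by (intro tendsto_intros N1.ball_char_tendsto) simp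
    then show "((\<lambda>m. - ln (ball_char (\<nu> 1) m)) \<longlongrightarrow> 0) at_top" by simp
    have "\<forall>\<^sub>F m in at_top. 0 < ball_char (\<nu> 1) m"
      by (rule order_tendstoD(1)[OF N1.ball_char_tendsto]) simp
    then show "\<forall>\<^sub>F m in at_top. a m \<le> - ln (ball_char (\<nu> 1) m)"
    proof eventually_elim
      case (elim m)
      have "ln (ball_char (\<nu> 1) m) \<le> - lam m" using ln_mono[OF le_exp elim] by simp
      then show ?case using al[of m] by linarith
    qed
  qed (use a0 in simp)
  then show thesis using that anti eig by blast
qed

text \<open>The lower bound 1 - t l of \<open>multiplicative_bounds\<close> is 1 when l = 0, and no
  symbol exceeds 1.\<close>

lemma ball_char_eq_1_of_zero_eigenvalues:
  fixes \<nu> :: "real \<Rightarrow> 'p::prime_card padic measure"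
  assumes N: "\<And>t. 0 < t \<Longrightarrow> rotation_invariant_prob (\<nu> t)"
    and conv: "\<And>s t. 0 < s \<Longrightarrow> 0 < t \<Longrightarrow> padic_convolution (\<nu> s) (\<nu> t) = \<nu> (s + t)"
    and lim: "((\<lambda>t. (1 - ball_char (\<nu> t) m) / t) \<longlongrightarrow> 0) (at_right 0)" and t: "0 < t"
  shows "ball_char (\<nu> t) m = 1"
proof -
  have "ball_char (\<nu> (s + t)) m = ball_char (\<nu> s) m * ball_char (\<nu> t) m" if "0 < s" "0 < t" for s t
    using rotation_invariant_convolution(2)[OF N N, of s t m] that by (simp add: conv)
  moreover have b: "\<bar>ball_char (\<nu> t) m\<bar> \<le> 1" if "0 < t" for t
    using rot_inv.abs_ball_char_le_1[of "\<nu> t" m] N[OF that] by (simp add: rot_inv_def)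
  ultimately have "1 \<le> ball_char (\<nu> t) m"
    using multiplicative_bounds(1)[of "\<lambda>t. ball_char (\<nu> t) m" 0 t] lim t by simp
  then show ?thesis using b[OF t] by linarith
qed

lemma Laplacian_imp_jump_tails:
  fixes lam :: "int \<Rightarrow> real" and \<nu> :: "real \<Rightarrow> 'p::prime_card padic measure"
  assumes sg: "symmetric_convolution_semigroup \<nu>" and ri: "rotation_invariant \<nu>"
    and nontriv: "\<exists>t>0. \<nu> t \<noteq> return borel 0"
    and gen: "\<And>m B f. B \<in> padic_balls m \<Longrightarrow> f \<in> ball_space m B \<Longrightarrow> (f, \<lambda>x. lam m * f x) \<in> generator \<nu>"
  shows "\<exists>a. antimono a \<and> (a \<longlongrightarrow> 0) at_top \<and> (\<forall>m. lam m = jump_eigenvalue (real CARD('p)) a m) \<and> (\<exists>m. 0 < a m)"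
proof -
  have N: "rotation_invariant_prob (\<nu> t)" if "0 < t" for t
    using sg ri that unfolding symmetric_convolution_semigroup_def rotation_invariant_def rotation_invariant_prob_def by blast
  have conv: "padic_convolution (\<nu> s) (\<nu> t) = \<nu> (s + t)" if "0 < s" "0 < t" for s t
    using sg that unfolding symmetric_convolution_semigroup_def by blast
  have lim: "((\<lambda>t. (1 - ball_char (\<nu> t) m) / t) \<longlongrightarrow> lam m) (at_right 0)" for m
    by (rule generator_eigenvalue_limit[OF N gen[OF std_ball(1) std_child_fun_in_ball_space]])
  obtain a where a: "antimono a" "(a \<longlongrightarrow> 0) at_top" "\<And>m. lam m = jump_eigenvalue (real CARD('p)) a m"
    using jump_tails_from_semigroup[OF N conv lim] by metis
  \<comment> \<open>Otherwise all eigenvalues vanish, all symbols are 1, and every measure of the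
    semigroup is the point mass at 0.\<close>
  have "\<exists>m. 0 < a m"
  proof (rule ccontr)
    assume "\<not> (\<exists>m. 0 < a m)"
    then have "a m = 0" for m using antimono_tendsto_0_nonneg[OF a(1,2), of m] by (meson not_less order_antisym)
    then have l0: "lam m = 0" for m by (simp add: a(3) jump_eigenvalue_def)
    have "\<nu> t = return borel 0" if t: "0 < t" for t
    proof (rule ball_char_eqI[OF N[OF t] rotation_invariant_prob_return])
      fix m
      show "ball_char (\<nu> t) m = ball_char (return borel (0 :: 'p padic)) m"
        unfolding ball_char_return
        by (rule ball_char_eq_1_of_zero_eigenvalues[OF N conv _ t]) (use lim[of m] l0 in simp_all)
    qed
    then show False using nontriv by blast
  qed
  then show ?thesis using a by blast
qed

section \<open>From the tails to a Laplacian\<close>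

lemma exp_difference_quotient: "((\<lambda>t. (1 - exp (- t * l)) / t) \<longlongrightarrow> l) (at_right (0::real))"
proof -
  have "((\<lambda>t. - exp (- t * l)) has_real_derivative l) (at 0)"
    by (auto intro!: derivative_eq_intros)
  then have "((\<lambda>t. (1 - exp (- t * l)) / t) \<longlongrightarrow> l) (at 0)"
    by (simp add: DERIV_def)
  then show ?thesis by (rule tendsto_mono[OF at_le, rotated]) simp
qed

text \<open>The symbols are exponential in t. Since a symbol determines its measure, the semigroup
  law follows from that of exp, and weak continuity from the continuity of exp in t.\<close>

lemma jump_tails_imp_Laplacian:
  fixes a :: "int \<Rightarrow> real"
  assumes a: "antimono a" "(a \<longlongrightarrow> 0) at_top" and pos: "0 < a m0"
  shows "\<exists>L :: (('p::prime_card padic \<Rightarrow> real) \<times> ('p padic \<Rightarrow> real)) set.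
        rotation_invariant_Laplacian L \<and>
        (\<forall>m. \<forall>B \<in> padic_balls m. \<forall>f \<in> ball_space m B. (f, \<lambda>x. jump_eigenvalue (real CARD('p)) a m * f x) \<in> L)"
proof -
  let ?q = "real CARD('p)"
  have q: "1 < ?q" by simp
  define \<phi> where "\<phi> t m = exp (- t * jump_eigenvalue ?q a m)" for t m
  have "\<exists>F. ball_cdf F \<and> (\<forall>m. cdf_char ?q F m = \<phi> t m)" if "0 \<le> t" for t
    unfolding \<phi>_def using cdf_char_exp[OF a that, where 'p='p] by metis
  then obtain F where F: "\<And>t. 0 \<le> t \<Longrightarrow> ball_cdf (F t)" "\<And>t m. 0 \<le> t \<Longrightarrow> cdf_char ?q (F t) m = \<phi> t m"
    by metis
  define \<nu> :: "real \<Rightarrow> 'p padic measure" where "\<nu> t = radial_prob (F t)" for t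
  have N: "rotation_invariant_prob (\<nu> t)" if "0 \<le> t" for t
    unfolding \<nu>_def by (rule rotation_invariant_radial_prob[OF F(1)[OF that]])
  have char: "ball_char (\<nu> t) m = \<phi> t m" if "0 \<le> t" for t m
    unfolding \<nu>_def using F that by (simp add: ball_char_radial_prob_eq)
  \<comment> \<open>Time 0 is included in the construction so that weak convergence to the point
    mass is the case t = 0 of \<open>seq\<close>.\<close>
  have \<nu>0: "\<nu> 0 = return borel 0"
    by (rule ball_char_eqI[OF N rotation_invariant_prob_return]) (simp_all add: char ball_char_return \<phi>_def)
  have conv: "padic_convolution (\<nu> s) (\<nu> t) = \<nu> (s + t)" if st: "0 < s" "0 < t" for s t
  proof (rule ball_char_eqI)
    show "rotation_invariant_prob (padic_convolution (\<nu> s) (\<nu> t))" "rotation_invariant_prob (\<nu> (s + t))"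
      using st by (auto intro!: rotation_invariant_convolution(1) N)
    show "ball_char (padic_convolution (\<nu> s) (\<nu> t)) m = ball_char (\<nu> (s + t)) m" for m
      using st rotation_invariant_convolution(2)[OF N N, of s t m]
      by (simp add: char \<phi>_def exp_add[symmetric] algebra_simps)
  qed
  have seq: "(\<lambda>n. \<integral>x. f x \<partial>\<nu> (X n)) \<longlonglongrightarrow> (\<integral>x. f x \<partial>\<nu> t)"
    if f: "continuous_on UNIV f" "bounded (range f)" and X: "\<And>n. 0 \<le> X n" "X \<longlonglongrightarrow> t" and t: "0 \<le> t"
    for f :: "'p padic \<Rightarrow> real" and X t
  proof -
    have lim: "(\<lambda>n. cdf_char ?q (F (X n)) m) \<longlonglongrightarrow> \<phi> t m" for m
      unfolding F(2)[OF X(1)] unfolding \<phi>_def by (intro tendsto_intros X(2))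
    have top: "(\<phi> t \<longlongrightarrow> 1) at_top"
      using tendsto_exp[OF tendsto_mult_left[OF jump_eigenvalue_tendsto[OF q a(2)], of "- t"]]
      by (simp add: \<phi>_def[abs_def])
    obtain G where G: "ball_cdf G" "\<And>m. cdf_char ?q G m = \<phi> t m" "\<And>m. (\<lambda>n. F (X n) m) \<longlonglongrightarrow> G m"
      by (rule cdf_char_limit[OF q F(1)[OF X(1)] lim top]) blast
    \<comment> \<open>\<open>F t\<close> was merely chosen with the right symbol; injectivity
      identifies it with the limit that the continuity theorem produces.\<close>
    have "G = F t" by (rule cdf_char_inj[OF q G(1) F(1)[OF t]]) (simp add: G(2) F(2) t)
    then show ?thesis unfolding \<nu>_def using G(3) by (intro radial_prob_tendsto F X t f) auto
  qed
  have sg: "symmetric_convolution_semigroup \<nu>"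
    unfolding symmetric_convolution_semigroup_def
  proof (intro conjI allI impI)
    fix t :: real assume t: "0 < t"
    interpret rot_inv "\<nu> t" by unfold_locales (use N t in auto)
    show "prob_space (\<nu> t)" by (rule prob_space_axioms)
    show "sets (\<nu> t) = sets borel" by simp
    \<comment> \<open>Reflection is the rotation by -1, so symmetry is part of rotation
      invariance.\<close>
    have "padic_norm (- 1 :: 'p padic) = 1" by (simp add: padic_norm_minus)
    then have "distr (\<nu> t) borel (\<lambda>x. - 1 * x) = \<nu> t"
      using rot_inv unfolding rotation_invariant_prob_def by blast
    then show "distr (\<nu> t) borel uminus = \<nu> t" by simp
  next
    fix s t :: real assume "0 < s" "0 < t"
    then show "padic_convolution (\<nu> s) (\<nu> t) = \<nu> (s + t)" by (rule conv)
  next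
    fix f :: "'p padic \<Rightarrow> real" assume f: "continuous_on UNIV f \<and> bounded (range f)"
    show "continuous_on {0<..} (\<lambda>t. \<integral>x. f x \<partial>\<nu> t)"
      unfolding continuous_on_sequentially comp_def
      using f by (auto intro!: seq less_imp_le)
    have "f \<in> borel_measurable borel" using f by (intro borel_measurable_continuous_onI) simp
    then have f0: "(\<integral>x. f x \<partial>\<nu> 0) = f 0" unfolding \<nu>0 by (intro integral_return) auto
    show "((\<lambda>t. \<integral>x. f x \<partial>\<nu> t) \<longlongrightarrow> f 0) (at_right 0)"
      unfolding tendsto_at_iff_sequentially comp_def f0[symmetric]
      using f by (auto intro!: seq less_imp_le)
  qed
  have ri: "rotation_invariant \<nu>"
    unfolding rotation_invariant_def using N unfolding rotation_invariant_prob_def by (meson less_imp_le)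
  have nontriv: "\<nu> 1 \<noteq> return borel 0"
  proof
    assume "\<nu> 1 = return borel 0"
    then have "jump_eigenvalue ?q a m = 0" for m
      using char[of 1 m] by (simp add: ball_char_return \<phi>_def)
    then have "a m0 = 0"
      using jump_eigenvalue_0_imp[OF q a(1)] antimono_tendsto_0_nonneg[OF a] by blast
    then show False using pos by simp
  qed
  have "(f, \<lambda>x. jump_eigenvalue ?q a m * f x) \<in> generator \<nu>"
    if "B \<in> padic_balls m" "f \<in> ball_space m B" for m B f
  proof (rule generator_ball_spaceI[OF _ that])
    show "rotation_invariant_prob (\<nu> t)" if "0 < t" for t using N that by simp
    have "\<forall>\<^sub>F t in at_right 0. (1 - exp (- t * jump_eigenvalue ?q a m)) / t = (1 - ball_char (\<nu> t) m) / t"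
      using eventually_at_right_less[of "0::real"] by eventually_elim (simp add: char \<phi>_def)
    with exp_difference_quotient
    show "((\<lambda>t. (1 - ball_char (\<nu> t) m) / t) \<longlongrightarrow> jump_eigenvalue ?q a m) (at_right 0)"
      by (rule Lim_transform_eventually)
  qed
  moreover have "rotation_invariant_Laplacian (generator \<nu>)"
    unfolding rotation_invariant_Laplacian_def using sg ri nontriv zero_less_one by blast
  ultimately show ?thesis by blast
qed

theorem theorem5p8:
  fixes lam :: "int \<Rightarrow> real"
  shows
    "(\<exists>L :: (('p::prime_card padic \<Rightarrow> real) \<times> ('p padic \<Rightarrow> real)) set.
        rotation_invariant_Laplacian L \<and>
        (\<forall>m. \<forall>B \<in> padic_balls m. \<forall>f \<in> ball_space m B. (f, \<lambda>x. lam m * f x) \<in> L))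
     \<longleftrightarrow>
     (\<exists>a :: int \<Rightarrow> real.
        (\<forall>m. lam m = a m - inverse (real CARD('p) - 1) * (a (m + 1) - a m)) \<and>
        (\<forall>m. a m \<ge> a (m + 1)) \<and>
        (a \<longlongrightarrow> 0) at_top \<and>
        (\<exists>W :: ereal. 0 < W \<and> W \<le> \<infinity> \<and> ((\<lambda>m. ereal (a m)) \<longlongrightarrow> W) at_bot))"
    (is "?A \<longleftrightarrow> ?B")
proof
  note eig = jump_eigenvalue_eq[OF card_prime_gt_1[where 'p='p]]
  assume ?A
  then obtain \<nu> :: "real \<Rightarrow> 'p padic measure" where
    "symmetric_convolution_semigroup \<nu>" "rotation_invariant \<nu>" "\<exists>t>0. \<nu> t \<noteq> return borel 0"
    "\<And>m B f. B \<in> padic_balls m \<Longrightarrow> f \<in> ball_space m B \<Longrightarrow> (f, \<lambda>x. lam m * f x) \<in> generator \<nu>"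
    unfolding rotation_invariant_Laplacian_def by blast
  then obtain a m0 where a: "antimono a" "(a \<longlongrightarrow> 0) at_top"
      "\<And>m. lam m = jump_eigenvalue (real CARD('p)) a m" "0 < a m0"
    using Laplacian_imp_jump_tails[of \<nu> lam] by blast
  \<comment> \<open>The supremum is taken in the extended reals, so an unbounded \<open>a\<close>
    yields the value infinity.\<close>
  have W: "((\<lambda>m. ereal (a m)) \<longlongrightarrow> (SUP m. ereal (a m))) at_bot"
    using a(1) by (intro tendsto_SUP_at_bot) (simp add: antimono_def)
  have "ereal 0 < ereal (a m0)" using a(4) by simp
  also have "\<dots> \<le> (SUP m. ereal (a m))" by (rule SUP_upper) simp
  finally have "0 < (SUP m. ereal (a m))" by (simp add: zero_ereal_def)
  moreover have "a (m + 1) \<le> a m" for m using a(1) by (simp add: antimono_def)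
  ultimately show ?B using a(2,3) W eig by (intro exI[of _ a]) auto
next
  note eig = jump_eigenvalue_eq[OF card_prime_gt_1[where 'p='p]]
  assume ?B
  then obtain a W where lam: "\<And>m. lam m = jump_eigenvalue (real CARD('p)) a m"
    and dec: "\<And>m. a (m + 1) \<le> a m" and a0: "(a \<longlongrightarrow> 0) at_top"
    and W: "0 < (W :: ereal)" "((\<lambda>m. ereal (a m)) \<longlongrightarrow> W) at_bot"
    unfolding eig by blast
  \<comment> \<open>A positive limit at minus infinity provides the single positive value that
    nontriviality of the semigroup requires.\<close>
  have "\<forall>\<^sub>F m in at_bot. 0 < ereal (a m)" by (rule order_tendstoD(1)[OF W(2,1)])
  then obtain m0 where "0 < a m0" unfolding eventually_at_bot_linorder by auto
  then show ?A
    using jump_tails_imp_Laplacian[OF antimono_int[of a, OF dec] a0, where 'p='p] by (simp add: lam)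
qed

end
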